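(* Let $\mathfrak h$ be a finite-dimensional abelian Lie algebra over $k=\mathbb C$ with a non-degenerate symmetric bilinear form $(-,-)$ and Casimir element $\Omega$. Let $\mathfrak l\subset\mathfrak h$ be a subgroup with $(x,y)\in\mathbb Z$ and $(x,x)\in2\mathbb Z$ for all $x,y\in\mathfrak l$, let $\alpha$ be a normalised 2-cocycle of $\mathfrak l$ with values in $k^\times$ such that $\alpha(x,y)\alpha(y,x)^{-1}=e^{\pi i(x,y)}$ for all $x,y\in\mathfrak l$, and let $A=k[\mathfrak l,\alpha]$. Then the category ${}_A\mathcal C(\mathfrak h,\Omega)^{loc}$ of local $A$-modules has a monoidal grading by the group $\mathfrak l^{\#}/(\mathfrak l+\mathfrak l^{\perp})$: $${}_A\mathcal C(\mathfrak h,\Omega)^{loc}=\bigoplus_{X\in\mathfrak l^{\#}/(\mathfrak l+\mathfrak l^{\perp})}{}_A\mathcal C(\mathfrak h,\Omega)^{loc}_X,$$ where ${}_A\mathcal C(\mathfrak h,\Omega)^{loc}_X$ is the full subcategory of ${}_A\mathcal C(\mathfrak h,\Omega)^{loc}$ consisting of the modules $M$ whose support is the $\mathfrak l$-orbit in $Hom(\mathfrak l,\mathbb Z)$ corresponding to $X$ (together with the zero module).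
   Context: $\Omega=\sum_i u_i\otimes u_i$ for an orthonormal basis $(u_i)$ of $\mathfrak h$. An $\mathfrak h$-module $V$ is locally finite if for any $x\in\mathfrak h$, $v\in V$ there is a nonzero polynomial $f$ with $f(x)v=0$. $\mathcal C(\mathfrak h,\Omega)$ is the category of locally finite $\mathfrak h$-modules with ordinary tensor product and associativity and braiding $c_{M,N}(m\otimes n)=e^{\pi i\Omega}(n\otimes m)$. $k[\mathfrak l,\alpha]$ is the algebra in $\mathcal C(\mathfrak h,\Omega)$ with basis $e_x$, $x\in\mathfrak l$, multiplication $e_xe_y=\alpha(x,y)e_{x+y}$ and $\mathfrak h$-action $z(e_x)=(x,z)e_x$; under the stated condition on $\alpha$ it is commutative in $\mathcal C(\mathfrak h,\Omega)$, i.e. its multiplication $\mu$ satisfies $\mu c_{A,A}=\mu$. A left $A$-module $M$ in $\mathcal C(\mathfrak h,\Omega)$ (an object with an $\mathfrak h$-linear action $\nu:A\otimes M\to M$) is local if $\nu(e^{2\pi i\Omega}(a\otimes m))=am$ for all $a\in A$, $m\in M$. The tensor product $M\otimes_AN$ of left $A$-modules is the coequaliser of the two maps $(\nu_M\otimes1)(c_{M,A}\otimes 1)$ and $1\otimes\nu_N$ from $M\otimes A\otimes N$ to $M\otimes N$; with it local modules form a braided monoidal category ${}_A\mathcal C(\mathfrak h,\Omega)^{loc}$. A local $A$-module $M$ decomposes as a direct sum of $M_\chi=\{m\in M\mid x(m)=\chi(x)m\ \forall x\in\mathfrak l\}$ with $\chi\in Hom(\mathfrak l,\mathbb Z)$;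 its support is $supp(M)=\{\chi\in Hom(\mathfrak l,\mathbb Z)\mid M_\chi\neq0\}$, which is a union of orbits for the translation action of $\mathfrak l$ on $Hom(\mathfrak l,\mathbb Z)$ via the homomorphism $x\mapsto(x,-)$. $\mathfrak l^{\#}=\{x\in\mathfrak h\mid(x,\mathfrak l)\subset\mathbb Z\}$ and $\mathfrak l^\perp=\{x\in\mathfrak h\mid(x,\mathfrak l)=0\}$. The map $\mathfrak l^{\#}\to Hom(\mathfrak l,\mathbb Z)$, $x\mapsto(x,-)$, is surjective with kernel $\mathfrak l^\perp$, so the group of $\mathfrak l$-orbits in $Hom(\mathfrak l,\mathbb Z)$ is identified with $\mathfrak l^{\#}/(\mathfrak l+\mathfrak l^\perp)$. A (monoidal) $H$-grading on a monoidal category $\mathcal D$, for a group $H$, is a decomposition $\mathcal D=\bigoplus_{h\in H}\mathcal D_h$ such that the tensor product of an object of $\mathcal D_f$ and an object of $\mathcal D_g$ belongs to $\mathcal D_{fg}$. *)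

theory Defs
  imports
    Complex_Main
    "HOL-Library.Poly_Mapping"
    "HOL-Computational_Algebra.Polynomial"
    "HOL-Algebra.Module"
    "HOL-Algebra.Coset"
    "HOL-Algebra.AbelCoset"
    "HOL-Algebra.Elementary_Groups"
begin

section \<open>Complex vector spaces with an explicit carrier\<close>

text \<open>
  Vector spaces are HOL-Algebra modules over the ring \<open>cfield\<close>, so that quotients and tensor
  products can be formed. The record type \<^typ>\<open>('a, 'b) module\<close> extends rings; on a mere vector
  space the ring fields \<open>mult\<close> and \<open>one\<close> carry no meaning and are left \<^term>\<open>undefined\<close>.
\<close>

definition cfield :: "(complex, complex) module" where
  "cfield = \<lparr>carrier = UNIV, monoid.mult = (*), one = 1, zero = 0, add = (+), smult = (*)\<rparr>"

definition lin_maps ::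
  "(complex, 'v, 'y) module_scheme \<Rightarrow> (complex, 'w, 'z) module_scheme \<Rightarrow> ('v \<Rightarrow> 'w) set" where
  "lin_maps V W = {f \<in> carrier V \<rightarrow>\<^sub>E carrier W.
     (\<forall>v\<in>carrier V. \<forall>v'\<in>carrier V. f (v \<oplus>\<^bsub>V\<^esub> v') = f v \<oplus>\<^bsub>W\<^esub> f v') \<and>
     (\<forall>c. \<forall>v\<in>carrier V. f (c \<odot>\<^bsub>V\<^esub> v) = c \<odot>\<^bsub>W\<^esub> f v)}"

definition lin_span :: "(complex, 'v, 'z) module_scheme \<Rightarrow> 'v set \<Rightarrow> 'v set" where
  "lin_span V S = \<Inter>{W. submodule W cfield V \<and> S \<subseteq> W}"

definition free_space :: "'s set \<Rightarrow> (complex, 's \<Rightarrow>\<^sub>0 complex) module" where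
  "free_space S = \<lparr>carrier = {p. Poly_Mapping.keys p \<subseteq> S}, monoid.mult = undefined, one = undefined,
     zero = 0, add = (+), smult = (\<lambda>c. Poly_Mapping.map ((*) c))\<rparr>"

text \<open>
  Elements of \<open>V/W\<close> are cosets. \<open>quot_map V W f\<close> is the map of \<open>V/W\<close> induced by a linear
  endomorphism \<open>f\<close> of \<open>V\<close> that preserves \<open>W\<close>: then \<open>W + f t\<close> is the same coset for all \<open>t \<in> X\<close>.
\<close>

definition quot_map ::
  "(complex, 'v, 'z) module_scheme \<Rightarrow> 'v set \<Rightarrow> ('v \<Rightarrow> 'v) \<Rightarrow> 'v set \<Rightarrow> 'v set" where
  "quot_map V W f X = (\<Union>t\<in>X. W +>\<^bsub>V\<^esub> f t)"

definition quot_space ::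
  "(complex, 'v, 'z) module_scheme \<Rightarrow> 'v set \<Rightarrow> (complex, 'v set) module" where
  "quot_space V W = \<lparr>carrier = a_rcosets\<^bsub>V\<^esub> W, monoid.mult = undefined, one = undefined,
     zero = W, add = (\<lambda>X Y. X <+>\<^bsub>V\<^esub> Y), smult = (\<lambda>c. quot_map V W (\<lambda>v. c \<odot>\<^bsub>V\<^esub> v))\<rparr>"


section \<open>Tensor products of vector spaces\<close>

definition tensor_relations ::
  "(complex, 'm, 'y) module_scheme \<Rightarrow> (complex, 'n, 'z) module_scheme \<Rightarrow> ('m \<times> 'n \<Rightarrow>\<^sub>0 complex) set"
  where
  "tensor_relations M N =
     {Poly_Mapping.single (m \<oplus>\<^bsub>M\<^esub> m', n) 1 - Poly_Mapping.single (m, n) 1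
        - Poly_Mapping.single (m', n) 1 |
        m m' n. m \<in> carrier M \<and> m' \<in> carrier M \<and> n \<in> carrier N} \<union>
     {Poly_Mapping.single (m, n \<oplus>\<^bsub>N\<^esub> n') 1 - Poly_Mapping.single (m, n) 1
        - Poly_Mapping.single (m, n') 1 |
        m n n'. m \<in> carrier M \<and> n \<in> carrier N \<and> n' \<in> carrier N} \<union>
     {Poly_Mapping.single (c \<odot>\<^bsub>M\<^esub> m, n) 1 - Poly_Mapping.single (m, n) c |
        c m n. m \<in> carrier M \<and> n \<in> carrier N} \<union>
     {Poly_Mapping.single (m, c \<odot>\<^bsub>N\<^esub> n) 1 - Poly_Mapping.single (m, n) c |
        c m n. m \<in> carrier M \<and> n \<in> carrier N}"

definition tensor_kernel ::
  "(complex, 'm, 'y) module_scheme \<Rightarrow> (complex, 'n, 'z) module_scheme \<Rightarrow> ('m \<times> 'n \<Rightarrow>\<^sub>0 complex) set"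
  where
  "tensor_kernel M N = lin_span (free_space (carrier M \<times> carrier N)) (tensor_relations M N)"

definition tensor_space ::
  "(complex, 'm, 'y) module_scheme \<Rightarrow> (complex, 'n, 'z) module_scheme
     \<Rightarrow> (complex, ('m \<times> 'n \<Rightarrow>\<^sub>0 complex) set) module" where
  "tensor_space M N = quot_space (free_space (carrier M \<times> carrier N)) (tensor_kernel M N)"

definition tens ::
  "(complex, 'm, 'y) module_scheme \<Rightarrow> (complex, 'n, 'z) module_scheme
     \<Rightarrow> 'm \<Rightarrow> 'n \<Rightarrow> ('m \<times> 'n \<Rightarrow>\<^sub>0 complex) set" where
  "tens M N m n =
     tensor_kernel M N +>\<^bsub>free_space (carrier M \<times> carrier N)\<^esub> Poly_Mapping.single (m, n) 1"

text \<open>\<open>tensor_lift M N P \<beta>\<close> is the linear map out of the tensor product given by a bilinear map \<open>\<beta>\<close>.\<close>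

definition tensor_lift ::
  "(complex, 'm, 'x) module_scheme \<Rightarrow> (complex, 'n, 'y) module_scheme \<Rightarrow>
   (complex, 'p, 'z) module_scheme \<Rightarrow> ('m \<Rightarrow> 'n \<Rightarrow> 'p) \<Rightarrow> ('m \<times> 'n \<Rightarrow>\<^sub>0 complex) set \<Rightarrow> 'p" where
  "tensor_lift M N P \<beta> = (THE f. f \<in> lin_maps (tensor_space M N) P \<and>
     (\<forall>m\<in>carrier M. \<forall>n\<in>carrier N. f (tens M N m n) = \<beta> m n))"

definition tensor_map ::
  "(complex, 'm, 'w) module_scheme \<Rightarrow> (complex, 'n, 'x) module_scheme \<Rightarrow>
   (complex, 'p, 'y) module_scheme \<Rightarrow> (complex, 'q, 'z) module_scheme \<Rightarrow>
   ('m \<Rightarrow> 'p) \<Rightarrow> ('n \<Rightarrow> 'q) \<Rightarrow> ('m \<times> 'n \<Rightarrow>\<^sub>0 complex) set \<Rightarrow> ('p \<times> 'q \<Rightarrow>\<^sub>0 complex) set" where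
  "tensor_map M N P Q f g =
     tensor_lift M N (tensor_space P Q) (\<lambda>m n. tens P Q (f m) (g n))"

definition tensor_assoc ::
  "(complex, 'm, 'x) module_scheme \<Rightarrow> (complex, 'n, 'y) module_scheme \<Rightarrow>
   (complex, 'p, 'z) module_scheme \<Rightarrow>
   (('m \<times> 'n \<Rightarrow>\<^sub>0 complex) set \<times> 'p \<Rightarrow>\<^sub>0 complex) set \<Rightarrow>
   ('m \<times> ('n \<times> 'p \<Rightarrow>\<^sub>0 complex) set \<Rightarrow>\<^sub>0 complex) set" where
  "tensor_assoc M N P =
     tensor_lift (tensor_space M N) P (tensor_space M (tensor_space N P))
       (\<lambda>t p. tensor_lift M N (tensor_space M (tensor_space N P))
                (\<lambda>m n. tens M (tensor_space N P) m (tens N P n p)) t)"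


section \<open>Exponentials of locally finite operators\<close>

text \<open>
  For a locally finite endomorphism \<open>T\<close> the vectors \<open>T^n v / n!\<close> span a finite-dimensional
  subspace, and \<open>e^T v\<close> is the sum of their series there. \<open>fd_sums V s w\<close> says that all terms of
  \<open>s\<close> are combinations of finitely many vectors \<open>b j\<close> with summable coefficients, and that \<open>w\<close> is
  the resulting sum; the \<open>b j\<close> need not be independent, since linear maps between
  finite-dimensional spaces are continuous.
\<close>

definition fd_sums :: "(complex, 'v, 'z) module_scheme \<Rightarrow> (nat \<Rightarrow> 'v) \<Rightarrow> 'v \<Rightarrow> bool" where
  "fd_sums V s w \<longleftrightarrow> (\<exists>(r::nat) b a.
     (\<forall>j<r. b j \<in> carrier V \<and> summable (a j)) \<and>
     (\<forall>n. s n = (\<Oplus>\<^bsub>V\<^esub>j\<in>{..<r}. (a j n :: complex) \<odot>\<^bsub>V\<^esub> b j)) \<and>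
     w = (\<Oplus>\<^bsub>V\<^esub>j\<in>{..<r}. suminf (a j) \<odot>\<^bsub>V\<^esub> b j))"

definition lf_exp :: "(complex, 'v, 'z) module_scheme \<Rightarrow> ('v \<Rightarrow> 'v) \<Rightarrow> 'v \<Rightarrow> 'v" where
  "lf_exp V T v = (THE w. fd_sums V (\<lambda>n. (1 / fact n) \<odot>\<^bsub>V\<^esub> (T ^^ n) v) w)"


section \<open>The abelian Lie algebra and its Casimir element\<close>

text \<open>
  The Lie algebra is a type \<open>'h\<close> with scalar multiplication \<open>sc\<close>; being abelian, it is just a
  vector space.
\<close>

definition nondeg_sym_bilinear ::
  "(complex \<Rightarrow> 'h::ab_group_add \<Rightarrow> 'h) \<Rightarrow> ('h \<Rightarrow> 'h \<Rightarrow> complex) \<Rightarrow> bool" where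
  "nondeg_sym_bilinear sc B \<longleftrightarrow>
     (\<forall>x y. B x y = B y x) \<and> (\<forall>x. Vector_Spaces.linear sc (*) (B x)) \<and>
     (\<forall>x. (\<forall>y. B x y = 0) \<longrightarrow> x = 0)"

definition orthonormal_basis ::
  "(complex \<Rightarrow> 'h::ab_group_add \<Rightarrow> 'h) \<Rightarrow> ('h \<Rightarrow> 'h \<Rightarrow> complex) \<Rightarrow> 'h set \<Rightarrow> bool" where
  "orthonormal_basis sc B U \<longleftrightarrow> finite_dimensional_vector_space sc U \<and>
     (\<forall>u\<in>U. \<forall>v\<in>U. B u v = (if u = v then 1 else 0))"

text \<open>
  A non-degenerate symmetric form over the complex numbers has an orthonormal basis, and
  \<open>\<Sum>u. u \<otimes> u\<close> does not depend on it.
\<close>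

definition some_onb ::
  "(complex \<Rightarrow> 'h::ab_group_add \<Rightarrow> 'h) \<Rightarrow> ('h \<Rightarrow> 'h \<Rightarrow> complex) \<Rightarrow> 'h set" where
  "some_onb sc B = (SOME U. orthonormal_basis sc B U)"


section \<open>The braided category of locally finite modules\<close>

text \<open>
  Below, \<open>U\<close> always stands for an orthonormal basis; the Casimir element enters only through it.
\<close>

record ('h, 'v) hmod = "(complex, 'v) module" +
  act :: "'h \<Rightarrow> 'v \<Rightarrow> 'v"

definition hmodule ::
  "(complex \<Rightarrow> 'h::ab_group_add \<Rightarrow> 'h) \<Rightarrow> ('h, 'v, 'z) hmod_scheme \<Rightarrow> bool" where
  "hmodule sc V \<longleftrightarrow> Module.module cfield V \<and>
     (\<forall>x. \<forall>v\<in>carrier V. act V x v \<in> carrier V) \<and>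
     (\<forall>x. \<forall>v\<in>carrier V. \<forall>w\<in>carrier V. act V x (v \<oplus>\<^bsub>V\<^esub> w) = act V x v \<oplus>\<^bsub>V\<^esub> act V x w) \<and>
     (\<forall>x c. \<forall>v\<in>carrier V. act V x (c \<odot>\<^bsub>V\<^esub> v) = c \<odot>\<^bsub>V\<^esub> act V x v) \<and>
     (\<forall>x y. \<forall>v\<in>carrier V. act V (x + y) v = act V x v \<oplus>\<^bsub>V\<^esub> act V y v) \<and>
     (\<forall>c x. \<forall>v\<in>carrier V. act V (sc c x) v = c \<odot>\<^bsub>V\<^esub> act V x v) \<and>
     (\<forall>x y. \<forall>v\<in>carrier V. act V x (act V y v) = act V y (act V x v))"

definition locally_finite :: "('h, 'v, 'z) hmod_scheme \<Rightarrow> bool" where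
  "locally_finite V \<longleftrightarrow> (\<forall>x. \<forall>v\<in>carrier V. \<exists>f::complex poly. f \<noteq> 0 \<and>
     (\<Oplus>\<^bsub>V\<^esub>i\<in>{..Polynomial.degree f}. Polynomial.coeff f i \<odot>\<^bsub>V\<^esub> (act V x ^^ i) v) = \<zero>\<^bsub>V\<^esub>)"

definition tensor ::
  "('h, 'm, 'y) hmod_scheme \<Rightarrow> ('h, 'n, 'z) hmod_scheme \<Rightarrow> ('h, ('m \<times> 'n \<Rightarrow>\<^sub>0 complex) set) hmod"
  where
  "tensor M N = module.extend (tensor_space M N) (hmod.fields (\<lambda>x.
     tensor_lift M N (tensor_space M N)
       (\<lambda>m n. tens M N (act M x m) n \<oplus>\<^bsub>tensor_space M N\<^esub> tens M N m (act N x n))))"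

definition Omega ::
  "'h set \<Rightarrow> ('h, 'm, 'y) hmod_scheme \<Rightarrow> ('h, 'n, 'z) hmod_scheme
     \<Rightarrow> ('m \<times> 'n \<Rightarrow>\<^sub>0 complex) set \<Rightarrow> ('m \<times> 'n \<Rightarrow>\<^sub>0 complex) set" where
  "Omega U M N = tensor_lift M N (tensor_space M N)
     (\<lambda>m n. \<Oplus>\<^bsub>tensor_space M N\<^esub>u\<in>U. tens M N (act M u m) (act N u n))"

definition exp_Omega ::
  "'h set \<Rightarrow> ('h, 'm, 'y) hmod_scheme \<Rightarrow> ('h, 'n, 'z) hmod_scheme \<Rightarrow> complex
     \<Rightarrow> ('m \<times> 'n \<Rightarrow>\<^sub>0 complex) set \<Rightarrow> ('m \<times> 'n \<Rightarrow>\<^sub>0 complex) set" where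
  "exp_Omega U M N c = lf_exp (tensor_space M N) (\<lambda>t. c \<odot>\<^bsub>tensor_space M N\<^esub> Omega U M N t)"

definition braiding ::
  "'h set \<Rightarrow> ('h, 'm, 'y) hmod_scheme \<Rightarrow> ('h, 'n, 'z) hmod_scheme
     \<Rightarrow> ('m \<times> 'n \<Rightarrow>\<^sub>0 complex) set \<Rightarrow> ('n \<times> 'm \<Rightarrow>\<^sub>0 complex) set" where
  "braiding U M N = tensor_lift M N (tensor_space N M)
     (\<lambda>m n. exp_Omega U N M (complex_of_real pi * \<i>) (tens N M n m))"


section \<open>Modules over an algebra in the category\<close>

text \<open>
  An algebra in the category is an \<open>hmod\<close> record whose ring fields are meaningful. The action
  \<open>\<nu>\<close> of an algebra \<open>A\<close> on \<open>M\<close> is stored as the bilinear map \<open>lact M\<close>.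
\<close>

record ('h, 'a, 'v) amod = "('h, 'v) hmod" +
  lact :: "'a \<Rightarrow> 'v \<Rightarrow> 'v"

definition nu ::
  "('h, 'a, 'x) hmod_scheme \<Rightarrow> ('h, 'a, 'v, 'z) amod_scheme \<Rightarrow> ('a \<times> 'v \<Rightarrow>\<^sub>0 complex) set \<Rightarrow> 'v" where
  "nu A M = tensor_lift A M M (lact M)"

definition amodule ::
  "(complex \<Rightarrow> 'h::ab_group_add \<Rightarrow> 'h) \<Rightarrow> ('h, 'a, 'x) hmod_scheme
     \<Rightarrow> ('h, 'a, 'v, 'z) amod_scheme \<Rightarrow> bool" where
  "amodule sc A M \<longleftrightarrow> hmodule sc M \<and> locally_finite M \<and>
     (\<forall>a\<in>carrier A. \<forall>m\<in>carrier M. lact M a m \<in> carrier M) \<and>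
     (\<forall>a\<in>carrier A. \<forall>b\<in>carrier A. \<forall>m\<in>carrier M.
        lact M (a \<oplus>\<^bsub>A\<^esub> b) m = lact M a m \<oplus>\<^bsub>M\<^esub> lact M b m) \<and>
     (\<forall>a\<in>carrier A. \<forall>m\<in>carrier M. \<forall>n\<in>carrier M.
        lact M a (m \<oplus>\<^bsub>M\<^esub> n) = lact M a m \<oplus>\<^bsub>M\<^esub> lact M a n) \<and>
     (\<forall>c. \<forall>a\<in>carrier A. \<forall>m\<in>carrier M. lact M (c \<odot>\<^bsub>A\<^esub> a) m = c \<odot>\<^bsub>M\<^esub> lact M a m) \<and>
     (\<forall>c. \<forall>a\<in>carrier A. \<forall>m\<in>carrier M. lact M a (c \<odot>\<^bsub>M\<^esub> m) = c \<odot>\<^bsub>M\<^esub> lact M a m) \<and>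
     (\<forall>x. \<forall>a\<in>carrier A. \<forall>m\<in>carrier M.
        act M x (lact M a m) = lact M (act A x a) m \<oplus>\<^bsub>M\<^esub> lact M a (act M x m)) \<and>
     (\<forall>a\<in>carrier A. \<forall>b\<in>carrier A. \<forall>m\<in>carrier M.
        lact M (a \<otimes>\<^bsub>A\<^esub> b) m = lact M a (lact M b m)) \<and>
     (\<forall>m\<in>carrier M. lact M \<one>\<^bsub>A\<^esub> m = m)"

definition local_modules ::
  "(complex \<Rightarrow> 'h::ab_group_add \<Rightarrow> 'h) \<Rightarrow> 'h set \<Rightarrow> ('h, 'a) hmod \<Rightarrow> ('h, 'a, 'v) amod set" where
  "local_modules sc U A = {M. amodule sc A M \<and>
     (\<forall>a\<in>carrier A. \<forall>m\<in>carrier M.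
        nu A M (exp_Omega U A M (2 * complex_of_real pi * \<i>) (tens A M a m)) = lact M a m)}"

definition amod_hom ::
  "('h, 'a) hmod \<Rightarrow> ('h, 'a, 'v) amod \<Rightarrow> ('h, 'a, 'w) amod \<Rightarrow> ('v \<Rightarrow> 'w) set" where
  "amod_hom A M N = {f \<in> lin_maps M N.
     (\<forall>x. \<forall>m\<in>carrier M. f (act M x m) = act N x (f m)) \<and>
     (\<forall>a\<in>carrier A. \<forall>m\<in>carrier M. f (lact M a m) = lact N a (f m))}"

definition amod_iso :: "('h, 'a) hmod \<Rightarrow> ('h, 'a, 'v) amod \<Rightarrow> ('h, 'a, 'w) amod \<Rightarrow> bool" where
  "amod_iso A M N \<longleftrightarrow> (\<exists>f\<in>amod_hom A M N. bij_betw f (carrier M) (carrier N))"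

text \<open>
  \<open>tensor_over U A M N\<close> is the coequaliser of \<open>(\<nu>\<^sub>M \<otimes> 1) (c \<otimes> 1)\<close> and \<open>1 \<otimes> \<nu>\<^sub>N\<close>, that is, the
  quotient of \<open>M \<otimes> N\<close> by the image of their difference. Its action is induced by \<open>\<nu>\<^sub>M \<otimes> 1\<close>.
\<close>

definition balancing_left ::
  "'h set \<Rightarrow> ('h, 'a) hmod \<Rightarrow> ('h, 'a, 'm) amod \<Rightarrow> ('h, 'a, 'n) amod
     \<Rightarrow> (('m \<times> 'a \<Rightarrow>\<^sub>0 complex) set \<times> 'n \<Rightarrow>\<^sub>0 complex) set \<Rightarrow> ('m \<times> 'n \<Rightarrow>\<^sub>0 complex) set" where
  "balancing_left U A M N t =
     tensor_map (tensor A M) N M N (nu A M) (\<lambda>n. n)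
       (tensor_map (tensor M A) N (tensor A M) N (braiding U M A) (\<lambda>n. n) t)"

definition balancing_right ::
  "('h, 'a) hmod \<Rightarrow> ('h, 'a, 'm) amod \<Rightarrow> ('h, 'a, 'n) amod
     \<Rightarrow> (('m \<times> 'a \<Rightarrow>\<^sub>0 complex) set \<times> 'n \<Rightarrow>\<^sub>0 complex) set \<Rightarrow> ('m \<times> 'n \<Rightarrow>\<^sub>0 complex) set" where
  "balancing_right A M N t =
     tensor_map M (tensor A N) M N (\<lambda>m. m) (nu A N) (tensor_assoc M A N t)"

definition balancing_image ::
  "'h set \<Rightarrow> ('h, 'a) hmod \<Rightarrow> ('h, 'a, 'm) amod \<Rightarrow> ('h, 'a, 'n) amod
     \<Rightarrow> ('m \<times> 'n \<Rightarrow>\<^sub>0 complex) set set" where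
  "balancing_image U A M N =
     {balancing_left U A M N t \<ominus>\<^bsub>tensor M N\<^esub> balancing_right A M N t | t.
        t \<in> carrier (tensor (tensor M A) N)}"

definition tensor_over ::
  "'h set \<Rightarrow> ('h, 'a) hmod \<Rightarrow> ('h, 'a, 'm) amod \<Rightarrow> ('h, 'a, 'n) amod
     \<Rightarrow> ('h, 'a, ('m \<times> 'n \<Rightarrow>\<^sub>0 complex) set set) amod" where
  "tensor_over U A M N =
     (let T = tensor M N; R = balancing_image U A M N
      in hmod.extend
           (module.extend (quot_space T R) (hmod.fields (\<lambda>x. quot_map T R (act T x))))
           (amod.fields (\<lambda>a. quot_map T R (tensor_map M N M N (lact M a) (\<lambda>n. n)))))"

definition direct_sum :: "'i set \<Rightarrow> ('i \<Rightarrow> ('h, 'a, 'v) amod) \<Rightarrow> ('h, 'a, 'i \<Rightarrow> 'v) amod" where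
  "direct_sum I F =
     \<lparr>carrier = {f \<in> Pi\<^sub>E I (\<lambda>i. carrier (F i)). finite {i \<in> I. f i \<noteq> \<zero>\<^bsub>F i\<^esub>}},
      monoid.mult = undefined, one = undefined,
      zero = (\<lambda>i\<in>I. \<zero>\<^bsub>F i\<^esub>), add = (\<lambda>f g. \<lambda>i\<in>I. f i \<oplus>\<^bsub>F i\<^esub> g i),
      smult = (\<lambda>c f. \<lambda>i\<in>I. c \<odot>\<^bsub>F i\<^esub> f i),
      act = (\<lambda>x f. \<lambda>i\<in>I. act (F i) x (f i)), lact = (\<lambda>a f. \<lambda>i\<in>I. lact (F i) a (f i))\<rparr>"

text \<open>
  For a full subcategory \<open>D\<close> of \<open>A\<close>-modules and full subcategories \<open>E i\<close> of \<open>D\<close>, this is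
  \<open>D = \<Oplus>i\<in>I. E i\<close>: every object is a (possibly infinite) direct sum of objects of the \<open>E i\<close>, and
  there are no non-zero morphisms between objects of different \<open>E i\<close>.
\<close>

definition category_decomposition ::
  "('h, 'a) hmod \<Rightarrow> 'i set \<Rightarrow> ('h, 'a, 'v) amod set \<Rightarrow> ('i \<Rightarrow> ('h, 'a, 'v) amod set) \<Rightarrow> bool" where
  "category_decomposition A I D E \<longleftrightarrow>
     (\<forall>i\<in>I. E i \<subseteq> D) \<and>
     (\<forall>M\<in>D. \<exists>F. (\<forall>i\<in>I. F i \<in> E i) \<and> amod_iso A M (direct_sum I F)) \<and>
     (\<forall>i\<in>I. \<forall>j\<in>I. i \<noteq> j \<longrightarrow> (\<forall>M\<in>E i. \<forall>N\<in>E j. \<forall>f\<in>amod_hom A M N. \<forall>m\<in>carrier M. f m = \<zero>\<^bsub>N\<^esub>))"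


section \<open>The algebra of a lattice and the grading group\<close>

definition add_grp :: "'h::ab_group_add set \<Rightarrow> 'h monoid" where
  "add_grp S = \<lparr>carrier = S, monoid.mult = (+), one = 0\<rparr>"

definition normalised_cocycle :: "'h::ab_group_add set \<Rightarrow> ('h \<Rightarrow> 'h \<Rightarrow> complex) \<Rightarrow> bool" where
  "normalised_cocycle L \<alpha> \<longleftrightarrow>
     (\<forall>x\<in>L. \<forall>y\<in>L. \<alpha> x y \<noteq> 0) \<and>
     (\<forall>x\<in>L. \<forall>y\<in>L. \<forall>z\<in>L. \<alpha> x y * \<alpha> (x + y) z = \<alpha> y z * \<alpha> x (y + z)) \<and>
     (\<forall>x\<in>L. \<alpha> x 0 = 1 \<and> \<alpha> 0 x = 1)"

text \<open>The basis vector \<open>e\<^sub>x\<close> is encoded as \<open>Poly_Mapping.single x 1\<close>.\<close>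

definition lattice_algebra ::
  "('h \<Rightarrow> 'h \<Rightarrow> complex) \<Rightarrow> 'h::ab_group_add set \<Rightarrow> ('h \<Rightarrow> 'h \<Rightarrow> complex) \<Rightarrow> ('h, 'h \<Rightarrow>\<^sub>0 complex) hmod"
  where
  "lattice_algebra B L \<alpha> =
     \<lparr>carrier = {p. Poly_Mapping.keys p \<subseteq> L},
      monoid.mult = (\<lambda>p q. \<Sum>x\<in>Poly_Mapping.keys p. \<Sum>y\<in>Poly_Mapping.keys q.
        Poly_Mapping.single (x + y) (Poly_Mapping.lookup p x * Poly_Mapping.lookup q y * \<alpha> x y)),
      one = Poly_Mapping.single 0 1, zero = 0, add = (+),
      smult = (\<lambda>c. Poly_Mapping.map ((*) c)),
      act = (\<lambda>z p. \<Sum>x\<in>Poly_Mapping.keys p. Poly_Mapping.single x (B x z * Poly_Mapping.lookup p x))\<rparr>"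

definition dual_lattice :: "('h \<Rightarrow> 'h \<Rightarrow> complex) \<Rightarrow> 'h set \<Rightarrow> 'h set" where
  "dual_lattice B L = {x. \<forall>y\<in>L. B x y \<in> \<int>}"

definition perp :: "('h \<Rightarrow> 'h \<Rightarrow> complex) \<Rightarrow> 'h set \<Rightarrow> 'h set" where
  "perp B L = {x. \<forall>y\<in>L. B x y = 0}"

definition grading_group :: "('h \<Rightarrow> 'h \<Rightarrow> complex) \<Rightarrow> 'h::ab_group_add set \<Rightarrow> 'h set monoid" where
  "grading_group B L =
     add_grp (dual_lattice B L) Mod {x + y | x y. x \<in> L \<and> y \<in> perp B L}"

text \<open>\<open>Hom(L, \<int>)\<close>; characters are extensional, so that equality is equality on \<open>L\<close>.\<close>

definition characters :: "'h::ab_group_add set \<Rightarrow> ('h \<Rightarrow> int) set" where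
  "characters L = hom (add_grp L) integer_group \<inter> extensional L"

definition pairing_char :: "('h \<Rightarrow> 'h \<Rightarrow> complex) \<Rightarrow> 'h set \<Rightarrow> 'h \<Rightarrow> 'h \<Rightarrow> int" where
  "pairing_char B L x = (\<lambda>y\<in>L. THE n. B x y = of_int n)"

definition lattice_orbit :: "('h \<Rightarrow> 'h \<Rightarrow> complex) \<Rightarrow> 'h set \<Rightarrow> ('h \<Rightarrow> int) \<Rightarrow> ('h \<Rightarrow> int) set" where
  "lattice_orbit B L \<chi> = {(\<lambda>y\<in>L. pairing_char B L x y + \<chi> y) | x. x \<in> L}"

text \<open>All \<open>x\<close> in one class \<open>X\<close> give the same orbit, so the union is that single orbit.\<close>

definition class_orbit :: "('h \<Rightarrow> 'h \<Rightarrow> complex) \<Rightarrow> 'h set \<Rightarrow> 'h set \<Rightarrow> ('h \<Rightarrow> int) set" where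
  "class_orbit B L X = (\<Union>x\<in>X. lattice_orbit B L (pairing_char B L x))"

definition weight_space :: "('h, 'v, 'z) hmod_scheme \<Rightarrow> 'h set \<Rightarrow> ('h \<Rightarrow> int) \<Rightarrow> 'v set" where
  "weight_space M L \<chi> = {m \<in> carrier M. \<forall>x\<in>L. act M x m = of_int (\<chi> x) \<odot>\<^bsub>M\<^esub> m}"

definition supp :: "'h::ab_group_add set \<Rightarrow> ('h, 'v, 'z) hmod_scheme \<Rightarrow> ('h \<Rightarrow> int) set" where
  "supp L M = {\<chi> \<in> characters L. weight_space M L \<chi> \<noteq> {\<zero>\<^bsub>M\<^esub>}}"

definition local_modules_graded ::
  "(complex \<Rightarrow> 'h::ab_group_add \<Rightarrow> 'h) \<Rightarrow> ('h \<Rightarrow> 'h \<Rightarrow> complex) \<Rightarrow> 'h set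
     \<Rightarrow> ('h, 'h \<Rightarrow>\<^sub>0 complex) hmod \<Rightarrow> 'h set \<Rightarrow> ('h, 'h \<Rightarrow>\<^sub>0 complex, 'v) amod set" where
  "local_modules_graded sc B L A X =
     {M \<in> local_modules sc (some_onb sc B) A.
        supp L M = class_orbit B L X \<or> carrier M = {\<zero>\<^bsub>M\<^esub>}}"

end

theory Submission
  imports Defs "HOL-Computational_Algebra.Fundamental_Theorem_Algebra"
begin

text \<open>
  Since \<open>z (e\<^sub>x) = (x, z) e\<^sub>x\<close>, the Casimir element acts on \<open>e\<^sub>x \<otimes> m\<close> as \<open>e\<^sub>x \<otimes> x m\<close>. As \<open>e\<^sub>x\<close> is
  invertible, \<open>M\<close> is local iff \<open>e\<^bsup>2\<pi>i x\<^esup> = 1\<close> on \<open>M\<close> for all lattice elements \<open>x\<close>, and for locally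
  finite \<open>M\<close> this says that each \<open>x\<close> is diagonalisable with integral eigenvalues. A finite maximal
  independent subset of the lattice then makes \<open>M\<close> the sum of its weight spaces, and every weight
  that occurs extends to a linear functional, hence comes from the dual lattice. Multiplication by
  \<open>e\<^sub>x\<close> permutes the weight spaces within an orbit, so \<open>M\<close> is the direct sum of its parts over the orbits; \<open>M\<close> has degree \<open>X\<close>
  iff the weight spaces for \<open>X\<close> generate it. Weights add under \<open>\<otimes>\<close>, which passes to
  \<open>M \<otimes>\<^sub>A N\<close>: it is the quotient of \<open>M \<otimes> N\<close> by the vectors
  \<open>e\<^bsup>\<pi>i \<chi>(z)\<^esup> e\<^sub>z v \<otimes> w - v \<otimes> e\<^sub>z w\<close> with \<open>v\<close> of weight \<open>\<chi>\<close>, and these span an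
  \<open>A\<close>-stable subspace because of the commutation rule for \<open>\<alpha>\<close>.
\<close>

section \<open>Linear algebra over explicit carriers, up to the universal property of the tensor
  product\<close>

section \<open>Complex vector spaces\<close>

text \<open>Locality is a statement about \<open>lf_exp\<close>, a definite description that means
  something only once its series is known to converge. At a vector v with (y - l) v = z and (y - l)
  z = 0 the value can be computed by hand, and locality reads e^(2 pi i l) (v + 2 pi i z) = v. For z
  = 0 this makes eigenvalues integral; in general it then forces z = 0. So Jordan chains of length
  two already decide semisimplicity. Once weight vectors generate M, the exponentials exist
  everywhere and are linear, and the braiding can be used.

  L may fail to be finitely generated: all rational multiples of an isotropic vector are allowed.
  This is why independence is taken over the complex numbers, where the dimension of
  \<open>'h\<close> bounds the independent subset.

  The support says which weight spaces are non-zero, which is hard to control in a quotient.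
  Generation by weight vectors passes to tensor products and quotients, covers the zero module, and
  already contains locality.\<close>

lemma cfield_simps [simp]:
  "carrier cfield = UNIV" "\<one>\<^bsub>cfield\<^esub> = 1" "\<zero>\<^bsub>cfield\<^esub> = 0"
  "a \<oplus>\<^bsub>cfield\<^esub> b = a + b" "a \<otimes>\<^bsub>cfield\<^esub> b = a * b"
  by (simp_all add: cfield_def)

lemma cring_cfield: "cring cfield"
proof (rule cringI)
  show "abelian_group cfield"
  proof (rule abelian_groupI)
    show "\<exists>y\<in>carrier cfield. y \<oplus>\<^bsub>cfield\<^esub> x = \<zero>\<^bsub>cfield\<^esub>" for x
      by (rule bexI[of _ "- x"]) auto
  qed auto
  show "Group.comm_monoid cfield"
    by (rule comm_monoidI) auto
qed (auto simp: algebra_simps)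

locale vector_sp =
  fixes V :: "(complex, 'v, 'z) module_scheme" (structure)
  assumes is_module: "Module.module cfield V"

sublocale vector_sp \<subseteq> abelian_group V
  using is_module by (rule Module.module.axioms(2))

text \<open>No rule for negation is asked for: \<open>(-1) \<odot> x\<close> is an inverse of
  \<open>x\<close>, by distributivity and \<open>0 \<odot> x = \<zero>\<close>.\<close>

lemma vector_spI:
  fixes V :: "(complex, 'v, 'z) module_scheme" (structure)
  assumes "\<And>x y. x \<in> carrier V \<Longrightarrow> y \<in> carrier V \<Longrightarrow> x \<oplus> y \<in> carrier V"
    and "\<zero> \<in> carrier V"
    and "\<And>x y z. x \<in> carrier V \<Longrightarrow> y \<in> carrier V \<Longrightarrow> z \<in> carrier V \<Longrightarrow> (x \<oplus> y) \<oplus> z = x \<oplus> (y \<oplus> z)"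
    and "\<And>x y. x \<in> carrier V \<Longrightarrow> y \<in> carrier V \<Longrightarrow> x \<oplus> y = y \<oplus> x"
    and zl: "\<And>x. x \<in> carrier V \<Longrightarrow> \<zero> \<oplus> x = x"
    and sc: "\<And>c x. x \<in> carrier V \<Longrightarrow> c \<odot> x \<in> carrier V"
    and ld: "\<And>c d x. x \<in> carrier V \<Longrightarrow> (c + d) \<odot> x = c \<odot> x \<oplus> d \<odot> x"
    and "\<And>c x y. x \<in> carrier V \<Longrightarrow> y \<in> carrier V \<Longrightarrow> c \<odot> (x \<oplus> y) = c \<odot> x \<oplus> c \<odot> y"
    and "\<And>c d x. x \<in> carrier V \<Longrightarrow> (c * d) \<odot> x = c \<odot> (d \<odot> x)"
    and one: "\<And>x. x \<in> carrier V \<Longrightarrow> 1 \<odot> x = x"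
    and z: "\<And>x. x \<in> carrier V \<Longrightarrow> 0 \<odot> x = \<zero>"
  shows "vector_sp V"
proof -
  have inv: "\<exists>y\<in>carrier V. y \<oplus> x = \<zero>" if x: "x \<in> carrier V" for x
  proof
    show "(-1) \<odot> x \<oplus> x = \<zero>"
      using ld[OF x, of "-1" 1] one[OF x] z[OF x] by simp
    show "(-1) \<odot> x \<in> carrier V" using sc x .
  qed
  have "abelian_group V"
    by (rule abelian_groupI) (fact assms inv)+
  then have "Module.module cfield V"
    by (rule moduleI[OF cring_cfield]) (simp_all add: assms)
  then show ?thesis by (rule vector_sp.intro)
qed

context vector_sp
begin

lemma smult_closed [simp, intro]: "x \<in> carrier V \<Longrightarrow> c \<odot> x \<in> carrier V"
  using module.smult_closed[OF is_module, of c x] by simp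

lemma smult_add_left: "x \<in> carrier V \<Longrightarrow> (c + d) \<odot> x = c \<odot> x \<oplus> d \<odot> x"
  using module.smult_l_distr[OF is_module, of c d x] by simp

lemma smult_add_right: "x \<in> carrier V \<Longrightarrow> y \<in> carrier V \<Longrightarrow> c \<odot> (x \<oplus> y) = c \<odot> x \<oplus> c \<odot> y"
  using module.smult_r_distr[OF is_module, of c x y] by simp

lemma smult_smult [simp]: "x \<in> carrier V \<Longrightarrow> c \<odot> (d \<odot> x) = (c * d) \<odot> x"
  using module.smult_assoc1[OF is_module, of c d x] by simp

lemma smult_one [simp]: "x \<in> carrier V \<Longrightarrow> 1 \<odot> x = x"
  using module.smult_one[OF is_module, of x] by simp

lemma smult_zero_left [simp]: "x \<in> carrier V \<Longrightarrow> 0 \<odot> x = \<zero>"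
  using module.smult_l_null[OF is_module, of x] by simp

lemma smult_zero_right [simp]: "c \<odot> \<zero> = \<zero>"
  using module.smult_r_null[OF is_module, of c] by simp

lemma a_inv_eq_smult: "x \<in> carrier V \<Longrightarrow> \<ominus> x = (-1) \<odot> x"
proof -
  assume x: "x \<in> carrier V"
  have "(-1) \<odot> x \<oplus> x = (-1 + 1) \<odot> x" using x by (simp only: smult_add_left smult_one)
  then show ?thesis using x by (intro minus_equality) auto
qed

lemma minus_eq_smult: "x \<in> carrier V \<Longrightarrow> y \<in> carrier V \<Longrightarrow> x \<ominus> y = x \<oplus> (-1) \<odot> y"
  by (simp add: a_minus_def a_inv_eq_smult)

lemma add_smult_self: "x \<in> carrier V \<Longrightarrow> c \<odot> x \<oplus> d \<odot> x = (c + d) \<odot> x"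
  by (simp add: smult_add_left)

text \<open>Differences are written as \<open>x \<oplus> (-1) \<odot> y\<close> from here on, so
  that the rules for sums and scalar multiples handle them too; this is the way back to
  equations.\<close>

lemma add_eq_zero_iff: "x \<in> carrier V \<Longrightarrow> y \<in> carrier V \<Longrightarrow> x \<oplus> (-1) \<odot> y = \<zero> \<longleftrightarrow> x = y"
  by (metis a_inv_eq_smult minus_equality minus_minus r_neg smult_closed local.add.inv_closed)

lemma smult_eq_zero: "x \<in> carrier V \<Longrightarrow> c \<odot> x = \<zero> \<longleftrightarrow> c = 0 \<or> x = \<zero>"
proof -
  assume x: "x \<in> carrier V"
  have "x = \<zero>" if "c \<noteq> 0" "c \<odot> x = \<zero>"
  proof -
    have "(inverse c) \<odot> (c \<odot> x) = x" using that(1) x by simp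
    then show ?thesis unfolding that(2) by simp
  qed
  then show ?thesis using x by auto
qed

lemma smult_right_cancel:
  assumes x: "x \<in> carrier V" "x \<noteq> \<zero>" and eq: "a \<odot> x = b \<odot> x"
  shows "a = b"
proof -
  have "(a + (- b)) \<odot> x = b \<odot> x \<oplus> (- b) \<odot> x" unfolding smult_add_left[OF x(1)] eq ..
  also have "\<dots> = \<zero>" by (simp add: add_smult_self x(1))
  finally show ?thesis using smult_eq_zero[OF x(1)] x(2) by simp
qed

lemma finsum_smult:
  "finite I \<Longrightarrow> f \<in> I \<rightarrow> carrier V \<Longrightarrow> c \<odot> (\<Oplus>i\<in>I. f i) = (\<Oplus>i\<in>I. c \<odot> f i)"
  using module.finsum_smult_ldistr[OF is_module, of I c f] by simp

lemma subspaceI: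
  assumes "W \<subseteq> carrier V" "\<zero> \<in> W" "\<And>a b. a \<in> W \<Longrightarrow> b \<in> W \<Longrightarrow> a \<oplus> b \<in> W"
    "\<And>c a. a \<in> W \<Longrightarrow> c \<odot> a \<in> W"
  shows "submodule W cfield V"
  by (rule module.submoduleI[OF is_module]) (use assms in \<open>auto simp: a_inv_eq_smult subsetD\<close>)

lemma subspaceD:
  assumes "submodule W cfield V"
  shows "W \<subseteq> carrier V" "\<zero> \<in> W" "\<And>a b. a \<in> W \<Longrightarrow> b \<in> W \<Longrightarrow> a \<oplus> b \<in> W"
    "\<And>c a. a \<in> W \<Longrightarrow> c \<odot> a \<in> W" "\<And>a. a \<in> W \<Longrightarrow> a \<in> carrier V"
proof -
  note E = module.submoduleE[OF is_module assms]
  show "W \<subseteq> carrier V" "\<And>a b. a \<in> W \<Longrightarrow> b \<in> W \<Longrightarrow> a \<oplus> b \<in> W" "\<And>c a. a \<in> W \<Longrightarrow> c \<odot> a \<in> W"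
    "\<And>a. a \<in> W \<Longrightarrow> a \<in> carrier V"
    using E by auto
  obtain w where "w \<in> W" using E(2) by blast
  then show "\<zero> \<in> W" using E(4)[of 0 w] E(1) by (simp add: subsetD)
qed

lemma subspace_vector_sp:
  assumes "submodule W cfield V"
  shows "vector_sp (V\<lparr>carrier := W\<rparr>)"
  using submodule.submodule_is_module[OF assms is_module] by (simp add: vector_sp_def)

lemma subspace_span:
  assumes "S \<subseteq> carrier V"
  shows "submodule (lin_span V S) cfield V"
proof (rule subspaceI)
  have c: "submodule (carrier V) cfield V" by (rule subspaceI) auto
  show "lin_span V S \<subseteq> carrier V" unfolding lin_span_def using c assms by blast
qed (auto simp: lin_span_def dest: subspaceD)

lemma span_superset: "S \<subseteq> lin_span V S"
  by (auto simp: lin_span_def)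

lemma span_minimal: "submodule W cfield V \<Longrightarrow> S \<subseteq> W \<Longrightarrow> lin_span V S \<subseteq> W"
  by (auto simp: lin_span_def)

end

text \<open>Leaves the values off the carrier open, so that compositions and lambda terms qualify;
  \<open>lin_maps_iff\<close> brings back the extensionality that \<open>lin_maps\<close>
  demands.\<close>

definition is_linear ::
  "(complex, 'v, 'y) module_scheme \<Rightarrow> (complex, 'w, 'z) module_scheme \<Rightarrow> ('v \<Rightarrow> 'w) \<Rightarrow> bool" where
  "is_linear V W f \<longleftrightarrow> (\<forall>v\<in>carrier V. f v \<in> carrier W) \<and>
     (\<forall>v\<in>carrier V. \<forall>v'\<in>carrier V. f (v \<oplus>\<^bsub>V\<^esub> v') = f v \<oplus>\<^bsub>W\<^esub> f v') \<and>
     (\<forall>c. \<forall>v\<in>carrier V. f (c \<odot>\<^bsub>V\<^esub> v) = c \<odot>\<^bsub>W\<^esub> f v)"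

lemma lin_maps_iff: "f \<in> lin_maps V W \<longleftrightarrow> is_linear V W f \<and> f \<in> extensional (carrier V)"
  by (auto simp: lin_maps_def is_linear_def PiE_def)

lemma is_linearI:
  assumes "\<And>v. v \<in> carrier V \<Longrightarrow> f v \<in> carrier W"
    "\<And>v v'. v \<in> carrier V \<Longrightarrow> v' \<in> carrier V \<Longrightarrow> f (v \<oplus>\<^bsub>V\<^esub> v') = f v \<oplus>\<^bsub>W\<^esub> f v'"
    "\<And>c v. v \<in> carrier V \<Longrightarrow> f (c \<odot>\<^bsub>V\<^esub> v) = c \<odot>\<^bsub>W\<^esub> f v"
  shows "is_linear V W f"
  using assms by (auto simp: is_linear_def)

lemma is_linearD:
  assumes "is_linear V W f"
  shows "v \<in> carrier V \<Longrightarrow> f v \<in> carrier W"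
    "v \<in> carrier V \<Longrightarrow> v' \<in> carrier V \<Longrightarrow> f (v \<oplus>\<^bsub>V\<^esub> v') = f v \<oplus>\<^bsub>W\<^esub> f v'"
    "v \<in> carrier V \<Longrightarrow> f (c \<odot>\<^bsub>V\<^esub> v) = c \<odot>\<^bsub>W\<^esub> f v"
  using assms by (auto simp: is_linear_def)

lemma is_linear_comp: "is_linear V W f \<Longrightarrow> is_linear W X g \<Longrightarrow> is_linear V X (\<lambda>v. g (f v))"
  by (simp add: is_linear_def)

lemma is_linear_zero:
  assumes "vector_sp V" "vector_sp W" "is_linear V W f"
  shows "f \<zero>\<^bsub>V\<^esub> = \<zero>\<^bsub>W\<^esub>"
proof -
  interpret V: vector_sp V by fact
  interpret W: vector_sp W by fact
  have "f (0 \<odot>\<^bsub>V\<^esub> \<zero>\<^bsub>V\<^esub>) = 0 \<odot>\<^bsub>W\<^esub> f \<zero>\<^bsub>V\<^esub>" using is_linearD(3)[OF assms(3)] by blast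
  then show ?thesis using is_linearD(1)[OF assms(3)] by simp
qed

lemma is_linear_finsum:
  assumes "vector_sp V" "vector_sp W" "is_linear V W f" "finite I" "\<And>i. i \<in> I \<Longrightarrow> g i \<in> carrier V"
  shows "f (\<Oplus>\<^bsub>V\<^esub>i\<in>I. g i) = (\<Oplus>\<^bsub>W\<^esub>i\<in>I. f (g i))"
proof -
  interpret V: vector_sp V by fact
  interpret W: vector_sp W by fact
  show ?thesis using assms(4,5)
  proof (induction I)
    case empty then show ?case using is_linear_zero[OF assms(1-3)] by simp
  next
    case (insert i I)
    have "g \<in> I \<rightarrow> carrier V" "g i \<in> carrier V" using insert by auto
    moreover have "(\<lambda>i. f (g i)) \<in> I \<rightarrow> carrier W" "f (g i) \<in> carrier W"
      using insert is_linearD(1)[OF assms(3)] by auto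
    ultimately show ?case using insert by (simp add: is_linearD(2)[OF assms(3)])
  qed
qed

lemma is_linear_add:
  assumes "vector_sp W" "is_linear V W f" "is_linear V W g"
  shows "is_linear V W (\<lambda>v. f v \<oplus>\<^bsub>W\<^esub> g v)"
proof -
  interpret W: vector_sp W by fact
  show ?thesis using assms(2,3) unfolding is_linear_def
    by (auto simp: W.smult_add_right W.a_ac)
qed

lemma is_linear_smult:
  assumes "vector_sp W" "is_linear V W f"
  shows "is_linear V W (\<lambda>v. c \<odot>\<^bsub>W\<^esub> f v)"
proof -
  interpret W: vector_sp W by fact
  show ?thesis using assms(2) unfolding is_linear_def
    by (auto simp: W.smult_add_right mult.commute)
qed

lemma is_linear_id: "is_linear V V (\<lambda>v. v)"
  by (simp add: is_linear_def)

subsection \<open>Quotient spaces\<close>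

context vector_sp
begin

context
  fixes W
  assumes sub: "submodule W cfield V"
begin

lemma subspace_abelian: "abelian_subgroup W V"
  by (rule abelian_subgroupI3[OF additive_subgroupI[OF submodule.axioms(1)[OF sub]]])
     (rule abelian_group_axioms)

lemma coset_eq_iff:
  assumes "x \<in> carrier V" "y \<in> carrier V"
  shows "W +> x = W +> y \<longleftrightarrow> x \<oplus> (-1) \<odot> y \<in> W"
proof -
  interpret S: abelian_subgroup W V by (rule subspace_abelian)
  have "W +> x = W +> y \<longleftrightarrow> x \<in> W +> y"
    using S.a_repr_independence' S.a_repr_independenceD assms by metis
  then show ?thesis using S.a_rcos_module assms by (simp add: a_inv_eq_smult)
qed

lemma mem_coset: "x \<in> carrier V \<Longrightarrow> x \<in> W +> x"
  by (rule abelian_subgroup.a_rcos_self[OF subspace_abelian])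

lemma coset_mem: "y \<in> W +> x \<Longrightarrow> x \<in> carrier V \<Longrightarrow> y \<in> carrier V \<and> W +> y = W +> x"
  using abelian_subgroup.a_elemrcos_carrier[OF subspace_abelian]
    abelian_subgroup.a_repr_independence'[OF subspace_abelian] by metis

lemma quot_carrier: "carrier (quot_space V W) = (\<lambda>v. W +> v) ` carrier V"
  by (auto simp: quot_space_def A_RCOSETS_def')

lemma quot_zero: "\<zero>\<^bsub>quot_space V W\<^esub> = W"
  by (simp add: quot_space_def)

lemma quot_add:
  "x \<in> carrier V \<Longrightarrow> y \<in> carrier V \<Longrightarrow> (W +> x) \<oplus>\<^bsub>quot_space V W\<^esub> (W +> y) = W +> (x \<oplus> y)"
  by (simp add: quot_space_def abelian_subgroup.a_rcos_sum[OF subspace_abelian])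

lemma quot_map_coset:
  assumes "is_linear V V f" "\<And>w. w \<in> W \<Longrightarrow> f w \<in> W" "x \<in> carrier V"
  shows "quot_map V W f (W +> x) = W +> f x"
proof -
  have "W +> f y = W +> f x" if y: "y \<in> W +> x" for y
  proof -
    have y': "y \<in> carrier V" "W +> y = W +> x" using coset_mem[OF y assms(3)] by simp_all
    then have "f (y \<oplus> (-1) \<odot> x) \<in> W" using coset_eq_iff assms(2,3) by blast
    then have "f y \<oplus> (-1) \<odot> f x \<in> W" using is_linearD[OF assms(1)] y' assms(3) by simp
    then show ?thesis using coset_eq_iff y' assms(3) is_linearD(1)[OF assms(1)] by blast
  qed
  then show ?thesis using mem_coset[OF assms(3)] unfolding quot_map_def by blast
qed

lemma quot_smult: "x \<in> carrier V \<Longrightarrow> c \<odot>\<^bsub>quot_space V W\<^esub> (W +> x) = W +> (c \<odot> x)"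
proof -
  have "is_linear V V (\<lambda>v. c \<odot> v)"
    by (rule is_linear_smult[OF vector_sp_axioms is_linear_id])
  then show "x \<in> carrier V \<Longrightarrow> ?thesis"
    using quot_map_coset subspaceD[OF sub] by (simp add: quot_space_def)
qed

lemma quot_vector_sp: "vector_sp (quot_space V W)"
proof -
  \<comment> \<open>Zero is written as a coset, and the simp rule that would undo this is removed,
    so that all elements of the quotient have the same form.\<close>
  have z: "\<zero>\<^bsub>quot_space V W\<^esub> = W +> \<zero>"
    using subspaceD[OF sub] by (simp add: quot_zero)
  show ?thesis
    by (rule vector_spI)
      (auto simp: quot_carrier z quot_add quot_smult a_ac smult_add_left smult_add_right
        simp del: a_coset_add_zero)
qed

lemma quot_proj_linear: "is_linear V (quot_space V W) (\<lambda>v. W +> v)"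
  by (rule is_linearI) (auto simp: quot_carrier quot_add quot_smult)

lemma quot_lift_exists:
  assumes "vector_sp P" "is_linear V P g" "\<And>w. w \<in> W \<Longrightarrow> g w = \<zero>\<^bsub>P\<^esub>"
  shows "\<exists>f\<in>lin_maps (quot_space V W) P. \<forall>v\<in>carrier V. f (W +> v) = g v"
proof -
  interpret P: vector_sp P by fact
  \<comment> \<open>Any representative will do, because \<open>g\<close> kills \<open>W\<close>; the
    restriction supplies the extensionality.\<close>
  define f where "f = (\<lambda>X\<in>carrier (quot_space V W). g (SOME v. v \<in> X))"
  have f: "f (W +> v) = g v" if v: "v \<in> carrier V" for v
  proof -
    define u where "u = (SOME u. u \<in> W +> v)"
    have "u \<in> W +> v" unfolding u_def by (rule someI[of _ v]) (rule mem_coset[OF v])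
    then have u: "u \<in> carrier V" "W +> u = W +> v" using coset_mem[OF _ v] by blast+
    then have "u \<oplus> (-1) \<odot> v \<in> W" using coset_eq_iff[of u v] v by simp
    then have "g (u \<oplus> (-1) \<odot> v) = \<zero>\<^bsub>P\<^esub>" by (rule assms(3))
    then have "g u \<oplus>\<^bsub>P\<^esub> (-1) \<odot>\<^bsub>P\<^esub> g v = \<zero>\<^bsub>P\<^esub>" using is_linearD[OF assms(2)] u v by simp
    then have "g u = g v" using P.add_eq_zero_iff is_linearD(1)[OF assms(2)] u v by simp
    then show ?thesis using v by (simp add: f_def quot_carrier u_def)
  qed
  have "is_linear (quot_space V W) P f"
    by (rule is_linearI)
      (auto simp: quot_carrier quot_add quot_smult f is_linearD[OF assms(2)])
  moreover have "f \<in> extensional (carrier (quot_space V W))" by (simp add: f_def)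
  ultimately have "f \<in> lin_maps (quot_space V W) P" by (simp add: lin_maps_iff)
  then show ?thesis using f by blast
qed

end
end

subsection \<open>Free vector spaces\<close>

lemma lookup_map_times [simp]:
  "Poly_Mapping.lookup (Poly_Mapping.map ((*) (c::complex)) p) k = c * Poly_Mapping.lookup p k"
  by (simp add: Poly_Mapping.map.rep_eq when_def)

lemma keys_map_times: "Poly_Mapping.keys (Poly_Mapping.map ((*) (c::complex)) p) \<subseteq> Poly_Mapping.keys p"
  by (auto simp: in_keys_iff)

lemma map_times_single [simp]:
  "Poly_Mapping.map ((*) (c::complex)) (Poly_Mapping.single k d) = Poly_Mapping.single k (c * d)"
  by (rule poly_mapping_eqI) (simp add: lookup_single when_def)

lemma free_space_simps [simp]:
  "carrier (free_space S) = {p. Poly_Mapping.keys p \<subseteq> S}" "\<zero>\<^bsub>free_space S\<^esub> = 0"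
  "p \<oplus>\<^bsub>free_space S\<^esub> q = p + q" "c \<odot>\<^bsub>free_space S\<^esub> p = Poly_Mapping.map ((*) c) p"
  by (simp_all add: free_space_def)

text \<open>The algebra of the lattice has the same underlying vector space, hence the general form.\<close>

lemma free_like_vector_sp:
  fixes V :: "(complex, 's \<Rightarrow>\<^sub>0 complex, 'z) module_scheme"
  assumes "carrier V = {p. Poly_Mapping.keys p \<subseteq> S}" "\<zero>\<^bsub>V\<^esub> = 0"
    "\<And>p q. p \<oplus>\<^bsub>V\<^esub> q = p + q" "\<And>c p. c \<odot>\<^bsub>V\<^esub> p = Poly_Mapping.map ((*) c) p"
  shows "vector_sp V"
proof (rule vector_spI)
  fix p q :: "'s \<Rightarrow>\<^sub>0 complex"
  show "p \<oplus>\<^bsub>V\<^esub> q \<in> carrier V" if "p \<in> carrier V" "q \<in> carrier V"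
    using that Poly_Mapping.keys_add[of p q] unfolding assms by blast
  show "c \<odot>\<^bsub>V\<^esub> p \<in> carrier V" if "p \<in> carrier V" for c
    using that keys_map_times[of c p] unfolding assms by blast
qed (simp_all add: assms poly_mapping_eq_iff fun_eq_iff lookup_add distrib_left distrib_right)

lemma free_vector_sp: "vector_sp (free_space S)"
  by (rule free_like_vector_sp) auto

lemma free_induct:
  assumes "Poly_Mapping.keys p \<subseteq> S" "P 0"
    "\<And>s c. s \<in> S \<Longrightarrow> P (Poly_Mapping.single s (c::complex))"
    "\<And>p q. Poly_Mapping.keys p \<subseteq> S \<Longrightarrow> Poly_Mapping.keys q \<subseteq> S \<Longrightarrow> P p \<Longrightarrow> P q \<Longrightarrow> P (p + q)"
  shows "P p"
proof -
  have s: "p = (\<Sum>s\<in>Poly_Mapping.keys p. Poly_Mapping.single s (Poly_Mapping.lookup p s))"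
    by (rule poly_mapping_eqI)
       (simp add: lookup_sum lookup_single when_def in_keys_iff)
  \<comment> \<open>The support is carried along because the rule for sums asks for it.\<close>
  have "Poly_Mapping.keys (\<Sum>s\<in>I. Poly_Mapping.single s (Poly_Mapping.lookup p s)) \<subseteq> S \<and>
      P (\<Sum>s\<in>I. Poly_Mapping.single s (Poly_Mapping.lookup p s))"
    if "finite I" "I \<subseteq> S" for I
    using that
  proof (induction I)
    case empty then show ?case using assms(2) by simp
  next
    case (insert i I)
    have "Poly_Mapping.keys (Poly_Mapping.single i (Poly_Mapping.lookup p i)) \<subseteq> S"
      using insert by (auto simp: in_keys_iff lookup_single when_def)
    moreover have "P (Poly_Mapping.single i (Poly_Mapping.lookup p i))"
      using insert assms(3) by simp
    moreover note Poly_Mapping.keys_add[of "Poly_Mapping.single i (Poly_Mapping.lookup p i)"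
        "\<Sum>s\<in>I. Poly_Mapping.single s (Poly_Mapping.lookup p s)"]
    ultimately show ?case using insert assms(4) by (simp add: Un_subset_iff subset_trans)
  qed
  then show ?thesis using s assms(1) finite_keys by metis
qed

lemma free_lift_exists:
  assumes "vector_sp P" "\<And>s. s \<in> S \<Longrightarrow> \<beta> s \<in> carrier P"
  shows "\<exists>g. is_linear (free_space S) P g \<and> (\<forall>s\<in>S. \<forall>c. g (Poly_Mapping.single s c) = c \<odot>\<^bsub>P\<^esub> \<beta> s)"
proof -
  interpret P: vector_sp P by fact
  define g where "g = (\<lambda>p. \<Oplus>\<^bsub>P\<^esub>s\<in>Poly_Mapping.keys p. Poly_Mapping.lookup p s \<odot>\<^bsub>P\<^esub> \<beta> s)"
  \<comment> \<open>Enlarging the index set beyond the support adds only zero terms; this lets the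
    supports of two summands be merged.\<close>
  have g: "g p = (\<Oplus>\<^bsub>P\<^esub>s\<in>I. Poly_Mapping.lookup p s \<odot>\<^bsub>P\<^esub> \<beta> s)"
    if "finite I" "Poly_Mapping.keys p \<subseteq> I" "I \<subseteq> S" for p I
    unfolding g_def
    by (rule P.add.finprod_mono_neutral_cong_left)
       (use that assms(2) in \<open>auto simp: in_keys_iff subset_iff\<close>)
  have cl: "(\<lambda>s. c s \<odot>\<^bsub>P\<^esub> \<beta> s) \<in> I \<rightarrow> carrier P" if "I \<subseteq> S" for I c
    using that assms(2) by auto
  have "is_linear (free_space S) P g"
  proof (rule is_linearI)
    fix p assume "p \<in> carrier (free_space S)"
    then show "g p \<in> carrier P" by (auto simp: g_def cl)
  next
    fix p q assume pq: "p \<in> carrier (free_space S)" "q \<in> carrier (free_space S)"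
    let ?I = "Poly_Mapping.keys p \<union> Poly_Mapping.keys q"
    have I: "?I \<subseteq> S" "finite ?I" using pq by auto
    have "g (p + q) = (\<Oplus>\<^bsub>P\<^esub>s\<in>?I. Poly_Mapping.lookup (p + q) s \<odot>\<^bsub>P\<^esub> \<beta> s)"
      by (rule g) (use I Poly_Mapping.keys_add[of p q] in auto)
    also have "\<dots> = (\<Oplus>\<^bsub>P\<^esub>s\<in>?I. Poly_Mapping.lookup p s \<odot>\<^bsub>P\<^esub> \<beta> s \<oplus>\<^bsub>P\<^esub> Poly_Mapping.lookup q s \<odot>\<^bsub>P\<^esub> \<beta> s)"
      by (rule P.finsum_cong') (use I assms(2) in \<open>auto simp: lookup_add P.smult_add_left subset_iff\<close>)
    also have "\<dots> = g p \<oplus>\<^bsub>P\<^esub> g q"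
      by (subst P.finsum_addf) (use I g[of ?I p] g[of ?I q] cl in auto)
    finally show "g (p \<oplus>\<^bsub>free_space S\<^esub> q) = g p \<oplus>\<^bsub>P\<^esub> g q" by simp
  next
    fix c p assume p: "p \<in> carrier (free_space S)"
    let ?I = "Poly_Mapping.keys p"
    have "g (Poly_Mapping.map ((*) c) p) = (\<Oplus>\<^bsub>P\<^esub>s\<in>?I. Poly_Mapping.lookup (Poly_Mapping.map ((*) c) p) s \<odot>\<^bsub>P\<^esub> \<beta> s)"
      by (rule g) (use p keys_map_times[of c p] in auto)
    also have "\<dots> = (\<Oplus>\<^bsub>P\<^esub>s\<in>?I. c \<odot>\<^bsub>P\<^esub> (Poly_Mapping.lookup p s \<odot>\<^bsub>P\<^esub> \<beta> s))"
      by (rule P.finsum_cong') (use p assms(2) in \<open>auto simp: subset_iff\<close>)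
    also have "\<dots> = c \<odot>\<^bsub>P\<^esub> g p"
      unfolding g_def by (subst P.finsum_smult) (use p cl in auto)
    finally show "g (c \<odot>\<^bsub>free_space S\<^esub> p) = c \<odot>\<^bsub>P\<^esub> g p" by simp
  qed
  moreover have "g (Poly_Mapping.single s c) = c \<odot>\<^bsub>P\<^esub> \<beta> s" if "s \<in> S" for s c
    using that assms(2) by (subst g[of "{s}"]) (auto)
  ultimately show ?thesis by blast
qed

subsection \<open>Tensor products\<close>

definition is_bilinear ::
  "(complex, 'm, 'x) module_scheme \<Rightarrow> (complex, 'n, 'y) module_scheme \<Rightarrow>
   (complex, 'p, 'z) module_scheme \<Rightarrow> ('m \<Rightarrow> 'n \<Rightarrow> 'p) \<Rightarrow> bool" where
  "is_bilinear M N P \<beta> \<longleftrightarrow> (\<forall>n\<in>carrier N. is_linear M P (\<lambda>m. \<beta> m n)) \<and>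
     (\<forall>m\<in>carrier M. is_linear N P (\<beta> m))"

lemma is_bilinearI:
  assumes "\<And>m n. m \<in> carrier M \<Longrightarrow> n \<in> carrier N \<Longrightarrow> \<beta> m n \<in> carrier P"
    "\<And>m m' n. m \<in> carrier M \<Longrightarrow> m' \<in> carrier M \<Longrightarrow> n \<in> carrier N \<Longrightarrow>
       \<beta> (m \<oplus>\<^bsub>M\<^esub> m') n = \<beta> m n \<oplus>\<^bsub>P\<^esub> \<beta> m' n"
    "\<And>m n n'. m \<in> carrier M \<Longrightarrow> n \<in> carrier N \<Longrightarrow> n' \<in> carrier N \<Longrightarrow>
       \<beta> m (n \<oplus>\<^bsub>N\<^esub> n') = \<beta> m n \<oplus>\<^bsub>P\<^esub> \<beta> m n'"
    "\<And>c m n. m \<in> carrier M \<Longrightarrow> n \<in> carrier N \<Longrightarrow> \<beta> (c \<odot>\<^bsub>M\<^esub> m) n = c \<odot>\<^bsub>P\<^esub> \<beta> m n"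
    "\<And>c m n. m \<in> carrier M \<Longrightarrow> n \<in> carrier N \<Longrightarrow> \<beta> m (c \<odot>\<^bsub>N\<^esub> n) = c \<odot>\<^bsub>P\<^esub> \<beta> m n"
  shows "is_bilinear M N P \<beta>"
  using assms by (simp add: is_bilinear_def is_linear_def)

lemma is_bilinearD:
  assumes "is_bilinear M N P \<beta>"
  shows "n \<in> carrier N \<Longrightarrow> is_linear M P (\<lambda>m. \<beta> m n)" "m \<in> carrier M \<Longrightarrow> is_linear N P (\<beta> m)"
    "m \<in> carrier M \<Longrightarrow> n \<in> carrier N \<Longrightarrow> \<beta> m n \<in> carrier P"
  using assms by (simp_all add: is_bilinear_def is_linear_def)

lemma is_bilinear_comp:
  assumes "is_bilinear M N P \<beta>" "is_linear P Q f"
  shows "is_bilinear M N Q (\<lambda>m n. f (\<beta> m n))"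
  using assms by (simp add: is_bilinear_def is_linear_def)

lemma is_bilinear_comp2:
  assumes "is_bilinear P Q R \<beta>" "is_linear M P f" "is_linear N Q g"
  shows "is_bilinear M N R (\<lambda>m n. \<beta> (f m) (g n))"
  using assms by (simp add: is_bilinear_def is_linear_def)

lemma is_bilinear_add:
  assumes "vector_sp P" "is_bilinear M N P \<beta>" "is_bilinear M N P \<gamma>"
  shows "is_bilinear M N P (\<lambda>m n. \<beta> m n \<oplus>\<^bsub>P\<^esub> \<gamma> m n)"
  using assms(2,3) by (simp add: is_bilinear_def is_linear_add[OF assms(1)])

lemma map_times_minus_one [simp]: "Poly_Mapping.map ((*) (-1 :: complex)) p = - p"
  by (rule poly_mapping_eqI) simp

locale tensor_pair = M: vector_sp M + N: vector_sp N
  for M :: "(complex, 'm, 'y) module_scheme" and N :: "(complex, 'n, 'z) module_scheme"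
begin

lemma tensor_relations_subset:
  "tensor_relations M N \<subseteq> carrier (free_space (carrier M \<times> carrier N))"
proof -
  have d: "Poly_Mapping.keys (p - q) \<subseteq> S" if "Poly_Mapping.keys p \<subseteq> S" "Poly_Mapping.keys q \<subseteq> S"
    for p q :: "('m \<times> 'n) \<Rightarrow>\<^sub>0 complex" and S
    using that by (rule order_trans[OF keys_diff Un_least])
  have k: "Poly_Mapping.keys (Poly_Mapping.single (m, n) (c::complex)) \<subseteq> carrier M \<times> carrier N"
    if "m \<in> carrier M" "n \<in> carrier N" for m n c
    using that by simp
  show ?thesis
  proof
    fix r assume "r \<in> tensor_relations M N"
    then have "Poly_Mapping.keys r \<subseteq> carrier M \<times> carrier N"
      unfolding tensor_relations_def
      by (elim UnE CollectE exE conjE) (simp_all only:, (intro d k; simp)+)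
    then show "r \<in> carrier (free_space (carrier M \<times> carrier N))" by simp
  qed
qed

lemma tensor_kernel_subspace:
  "submodule (tensor_kernel M N) cfield (free_space (carrier M \<times> carrier N))"
  unfolding tensor_kernel_def
  by (rule vector_sp.subspace_span[OF free_vector_sp tensor_relations_subset])

lemma tensor_relations_kernel: "tensor_relations M N \<subseteq> tensor_kernel M N"
  unfolding tensor_kernel_def by (rule vector_sp.span_superset[OF free_vector_sp])

lemma tensor_vector_sp: "vector_sp (tensor_space M N)"
  unfolding tensor_space_def
  by (rule vector_sp.quot_vector_sp[OF free_vector_sp tensor_kernel_subspace])

lemma tens_closed [simp, intro]:
  "m \<in> carrier M \<Longrightarrow> n \<in> carrier N \<Longrightarrow> tens M N m n \<in> carrier (tensor_space M N)"
  unfolding tensor_space_def tens_def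
    vector_sp.quot_carrier[OF free_vector_sp tensor_kernel_subspace]
  by (rule imageI) simp

text \<open>Each of the four kinds of relations is one symbol minus its expansion, so this single
  shape yields all bilinearity rules.\<close>

lemma tens_eqI:
  assumes "p \<in> carrier (free_space (carrier M \<times> carrier N))" "m \<in> carrier M" "n \<in> carrier N"
    "Poly_Mapping.single (m, n) 1 - p \<in> tensor_relations M N"
  shows "tens M N m n = tensor_kernel M N +>\<^bsub>free_space (carrier M \<times> carrier N)\<^esub> p"
  unfolding tens_def
  by (subst vector_sp.coset_eq_iff[OF free_vector_sp tensor_kernel_subspace])
    (use assms tensor_relations_kernel in auto)

lemma tens_coset_smult:
  "m \<in> carrier M \<Longrightarrow> n \<in> carrier N \<Longrightarrow> c \<odot>\<^bsub>tensor_space M N\<^esub> tens M N m n =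
    tensor_kernel M N +>\<^bsub>free_space (carrier M \<times> carrier N)\<^esub> Poly_Mapping.single (m, n) c"
  unfolding tens_def tensor_space_def
  by (subst vector_sp.quot_smult[OF free_vector_sp tensor_kernel_subspace]) auto

lemma tens_bilinear: "is_bilinear M N (tensor_space M N) (tens M N)"
proof (rule is_bilinearI)
  let ?F = "free_space (carrier M \<times> carrier N)" and ?K = "tensor_kernel M N"
  have add: "tens M N a b \<oplus>\<^bsub>tensor_space M N\<^esub> tens M N a' b' =
      ?K +>\<^bsub>?F\<^esub> (Poly_Mapping.single (a, b) 1 + Poly_Mapping.single (a', b') 1)"
    if "a \<in> carrier M" "b \<in> carrier N" "a' \<in> carrier M" "b' \<in> carrier N" for a b a' b'
    unfolding tens_def tensor_space_def
    by (subst vector_sp.quot_add[OF free_vector_sp tensor_kernel_subspace]) (use that in auto)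
  have k: "Poly_Mapping.single (a, b) (1::complex) + Poly_Mapping.single (a', b') 1 \<in> carrier ?F"
    if "a \<in> carrier M" "b \<in> carrier N" "a' \<in> carrier M" "b' \<in> carrier N" for a b a' b'
    using Poly_Mapping.keys_add[of "Poly_Mapping.single (a, b) (1::complex)" "Poly_Mapping.single (a', b') 1"]
      that by auto
  fix m m' n n' c
  assume m: "m \<in> carrier M" and n: "n \<in> carrier N"
  show "tens M N m n \<in> carrier (tensor_space M N)" using m n ..
  show "tens M N (c \<odot>\<^bsub>M\<^esub> m) n = c \<odot>\<^bsub>tensor_space M N\<^esub> tens M N m n"
    unfolding tens_coset_smult[OF m n]
    by (rule tens_eqI) (use m n in \<open>auto simp: tensor_relations_def\<close>)
  show "tens M N m (c \<odot>\<^bsub>N\<^esub> n) = c \<odot>\<^bsub>tensor_space M N\<^esub> tens M N m n"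
    unfolding tens_coset_smult[OF m n]
    by (rule tens_eqI) (use m n in \<open>auto simp: tensor_relations_def\<close>)
  show "tens M N (m \<oplus>\<^bsub>M\<^esub> m') n = tens M N m n \<oplus>\<^bsub>tensor_space M N\<^esub> tens M N m' n"
    if m': "m' \<in> carrier M"
    unfolding add[OF m n m' n]
    by (rule tens_eqI[OF k[OF m n m' n]])
      (use m n m' in \<open>auto simp: tensor_relations_def diff_diff_add[symmetric]\<close>)
  show "tens M N m (n \<oplus>\<^bsub>N\<^esub> n') = tens M N m n \<oplus>\<^bsub>tensor_space M N\<^esub> tens M N m n'"
    if n': "n' \<in> carrier N"
    unfolding add[OF m n m n']
    by (rule tens_eqI[OF k[OF m n m n']])
      (use m n n' in \<open>auto simp: tensor_relations_def diff_diff_add[symmetric]\<close>)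
qed

lemmas tens_add_left = is_linearD(2)[OF is_bilinearD(1)[OF tens_bilinear]]
lemmas tens_add_right = is_linearD(2)[OF is_bilinearD(2)[OF tens_bilinear]]
lemmas tens_smult_left = is_linearD(3)[OF is_bilinearD(1)[OF tens_bilinear]]
lemmas tens_smult_right = is_linearD(3)[OF is_bilinearD(2)[OF tens_bilinear]]
lemmas tens_zero_left = is_linear_zero[OF M.vector_sp_axioms tensor_vector_sp is_bilinearD(1)[OF tens_bilinear]]
lemmas tens_zero_right = is_linear_zero[OF N.vector_sp_axioms tensor_vector_sp is_bilinearD(2)[OF tens_bilinear]]

text \<open>Two cases suffice: a scalar is absorbed into the first factor, and zero is the tensor of
  two zeros.\<close>

lemma tensor_induct [consumes 1, case_names tens add]:
  assumes "t \<in> carrier (tensor_space M N)"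
    and t: "\<And>m n. m \<in> carrier M \<Longrightarrow> n \<in> carrier N \<Longrightarrow> P (tens M N m n)"
    and a: "\<And>s t. s \<in> carrier (tensor_space M N) \<Longrightarrow> t \<in> carrier (tensor_space M N) \<Longrightarrow>
      P s \<Longrightarrow> P t \<Longrightarrow> P (s \<oplus>\<^bsub>tensor_space M N\<^esub> t)"
  shows "P t"
proof -
  let ?F = "free_space (carrier M \<times> carrier N)" and ?K = "tensor_kernel M N"
  interpret F: vector_sp ?F by (rule free_vector_sp)
  obtain p where p: "Poly_Mapping.keys p \<subseteq> carrier M \<times> carrier N" "t = ?K +>\<^bsub>?F\<^esub> p"
    using assms(1) unfolding tensor_space_def F.quot_carrier[OF tensor_kernel_subspace] by auto
  have "P (?K +>\<^bsub>?F\<^esub> p)" using p(1)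
  proof (rule free_induct)
    have "?K +>\<^bsub>?F\<^esub> 0 = tens M N \<zero>\<^bsub>M\<^esub> \<zero>\<^bsub>N\<^esub>"
      using tens_coset_smult[of "\<zero>\<^bsub>M\<^esub>" "\<zero>\<^bsub>N\<^esub>" 0] tens_zero_left[of "\<zero>\<^bsub>N\<^esub>"]
        vector_sp.smult_zero_right[OF tensor_vector_sp] by simp
    then show "P (?K +>\<^bsub>?F\<^esub> 0)" using t by simp
  next
    fix s c assume "s \<in> carrier M \<times> carrier N"
    then obtain m n where s: "s = (m, n)" "m \<in> carrier M" "n \<in> carrier N" by auto
    then have "?K +>\<^bsub>?F\<^esub> Poly_Mapping.single s c = tens M N (c \<odot>\<^bsub>M\<^esub> m) n"
      using tens_coset_smult[of m n c] tens_smult_left[of n m c] by simp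
    then show "P (?K +>\<^bsub>?F\<^esub> Poly_Mapping.single s c)" using t s by simp
  next
    fix p q
    assume k: "Poly_Mapping.keys p \<subseteq> carrier M \<times> carrier N" "Poly_Mapping.keys q \<subseteq> carrier M \<times> carrier N"
      and P: "P (?K +>\<^bsub>?F\<^esub> p)" "P (?K +>\<^bsub>?F\<^esub> q)"
    have c: "?K +>\<^bsub>?F\<^esub> p \<in> carrier (tensor_space M N)" "?K +>\<^bsub>?F\<^esub> q \<in> carrier (tensor_space M N)"
      unfolding tensor_space_def F.quot_carrier[OF tensor_kernel_subspace] using k by auto
    have "(?K +>\<^bsub>?F\<^esub> p) \<oplus>\<^bsub>tensor_space M N\<^esub> (?K +>\<^bsub>?F\<^esub> q) = ?K +>\<^bsub>?F\<^esub> (p + q)"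
      unfolding tensor_space_def using F.quot_add[OF tensor_kernel_subspace, of p q] k by simp
    then show "P (?K +>\<^bsub>?F\<^esub> (p + q))" using a[OF c P] by simp
  qed
  then show ?thesis using p by simp
qed

lemma tensor_lift_exists:
  assumes "vector_sp P" "is_bilinear M N P \<beta>"
  shows "\<exists>f\<in>lin_maps (tensor_space M N) P. \<forall>m\<in>carrier M. \<forall>n\<in>carrier N. f (tens M N m n) = \<beta> m n"
proof -
  let ?F = "free_space (carrier M \<times> carrier N)" and ?K = "tensor_kernel M N"
  interpret F: vector_sp ?F by (rule free_vector_sp)
  interpret P: vector_sp P by fact
  have \<beta>: "\<beta> m n \<in> carrier P" if "m \<in> carrier M" "n \<in> carrier N" for m n
    using is_bilinearD(3)[OF assms(2) that] .
  obtain g where g: "is_linear ?F P g"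
    "\<And>m n c. m \<in> carrier M \<Longrightarrow> n \<in> carrier N \<Longrightarrow> g (Poly_Mapping.single (m, n) c) = c \<odot>\<^bsub>P\<^esub> \<beta> m n"
    using free_lift_exists[OF assms(1), of "carrier M \<times> carrier N" "\<lambda>(m, n). \<beta> m n"] \<beta> by auto
  have diff: "g (p - q) = g p \<oplus>\<^bsub>P\<^esub> (-1) \<odot>\<^bsub>P\<^esub> g q" if "p \<in> carrier ?F" "q \<in> carrier ?F" for p q
  proof -
    have "- q \<in> carrier ?F" using that by simp
    then have "g (p + - q) = g p \<oplus>\<^bsub>P\<^esub> g (- q)"
      using is_linearD(2)[OF g(1), of p "- q"] that by simp
    then show ?thesis using is_linearD(3)[OF g(1) that(2), of "-1"] by simp
  qed
  have dc: "p - q \<in> carrier ?F" if "p \<in> carrier ?F" "q \<in> carrier ?F" for p q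
    using that unfolding free_space_simps mem_Collect_eq by (rule order_trans[OF keys_diff Un_least])
  have sg: "Poly_Mapping.single (m, n) c \<in> carrier ?F" if "m \<in> carrier M" "n \<in> carrier N" for m n c
    using that by (auto split: if_splits)
  note ev = diff dc sg g(2) is_linearD[OF is_bilinearD(1)[OF assms(2)]]
    is_linearD[OF is_bilinearD(2)[OF assms(2)]] \<beta>
  \<comment> \<open>Under \<open>g\<close> the additivity relations take the form
    \<open>two\<close>, the homogeneity relations the form \<open>one\<close>.\<close>
  have two: "(x \<oplus>\<^bsub>P\<^esub> y) \<oplus>\<^bsub>P\<^esub> (-1) \<odot>\<^bsub>P\<^esub> x \<oplus>\<^bsub>P\<^esub> (-1) \<odot>\<^bsub>P\<^esub> y = \<zero>\<^bsub>P\<^esub>"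
    if "x \<in> carrier P" "y \<in> carrier P" for x y
  proof -
    have "(x \<oplus>\<^bsub>P\<^esub> y) \<oplus>\<^bsub>P\<^esub> (-1) \<odot>\<^bsub>P\<^esub> x \<oplus>\<^bsub>P\<^esub> (-1) \<odot>\<^bsub>P\<^esub> y =
      (x \<oplus>\<^bsub>P\<^esub> y) \<oplus>\<^bsub>P\<^esub> (-1) \<odot>\<^bsub>P\<^esub> (x \<oplus>\<^bsub>P\<^esub> y)"
      using that by (simp add: P.smult_add_right P.a_assoc)
    then show ?thesis using that P.add_eq_zero_iff by simp
  qed
  have one: "c \<odot>\<^bsub>P\<^esub> x \<oplus>\<^bsub>P\<^esub> (- c) \<odot>\<^bsub>P\<^esub> x = \<zero>\<^bsub>P\<^esub>" if "x \<in> carrier P" for c x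
    using that by (simp add: P.add_smult_self)
  have "g r = \<zero>\<^bsub>P\<^esub>" if "r \<in> tensor_relations M N" for r
    using that unfolding tensor_relations_def
    by (elim UnE CollectE exE conjE) (simp_all add: ev two one del: free_space_simps)
  then have "tensor_relations M N \<subseteq> {p \<in> carrier ?F. g p = \<zero>\<^bsub>P\<^esub>}"
    using tensor_relations_subset by blast
  moreover have "submodule {p \<in> carrier ?F. g p = \<zero>\<^bsub>P\<^esub>} cfield ?F"
    by (rule F.subspaceI)
      (use is_linearD[OF g(1)] is_linear_zero[OF free_vector_sp assms(1) g(1)]
        F.a_closed F.smult_closed in \<open>auto simp del: free_space_simps\<close>)
  ultimately have "?K \<subseteq> {p \<in> carrier ?F. g p = \<zero>\<^bsub>P\<^esub>}"
    unfolding tensor_kernel_def by (intro F.span_minimal)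
  then obtain f where f: "f \<in> lin_maps (tensor_space M N) P" "\<And>v. v \<in> carrier ?F \<Longrightarrow> f (?K +>\<^bsub>?F\<^esub> v) = g v"
    using F.quot_lift_exists[OF tensor_kernel_subspace assms(1) g(1)] unfolding tensor_space_def by blast
  have "f (tens M N m n) = \<beta> m n" if "m \<in> carrier M" "n \<in> carrier N" for m n
    using f(2)[OF sg[OF that, of 1]] g(2)[OF that] \<beta>[OF that] by (simp add: tens_def)
  then show ?thesis using f(1) by blast
qed

lemma tensor_linear_eqI:
  assumes "vector_sp P" "is_linear (tensor_space M N) P f" "is_linear (tensor_space M N) P g"
    "\<And>m n. m \<in> carrier M \<Longrightarrow> n \<in> carrier N \<Longrightarrow> f (tens M N m n) = g (tens M N m n)"
    "t \<in> carrier (tensor_space M N)"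
  shows "f t = g t"
  using assms(5) by (induction rule: tensor_induct) (simp_all add: assms(4) is_linearD[OF assms(2)] is_linearD[OF assms(3)])

text \<open>Linear maps that agree on pure tensors agree on the carrier, and extensionality fixes
  the values elsewhere; so the definite description in \<open>tensor_lift\<close> denotes.\<close>

lemma tensor_lift_prop:
  assumes "vector_sp P" "is_bilinear M N P \<beta>"
  shows "tensor_lift M N P \<beta> \<in> lin_maps (tensor_space M N) P \<and>
    (\<forall>m\<in>carrier M. \<forall>n\<in>carrier N. tensor_lift M N P \<beta> (tens M N m n) = \<beta> m n)"
proof -
  obtain f where f: "f \<in> lin_maps (tensor_space M N) P"
    "\<forall>m\<in>carrier M. \<forall>n\<in>carrier N. f (tens M N m n) = \<beta> m n"
    using tensor_lift_exists[OF assms] by blast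
  have "\<exists>!f. f \<in> lin_maps (tensor_space M N) P \<and>
    (\<forall>m\<in>carrier M. \<forall>n\<in>carrier N. f (tens M N m n) = \<beta> m n)"
  proof (rule ex1I[of _ f])
    fix g assume g: "g \<in> lin_maps (tensor_space M N) P \<and>
      (\<forall>m\<in>carrier M. \<forall>n\<in>carrier N. g (tens M N m n) = \<beta> m n)"
    show "g = f"
    proof (rule extensionalityI[of _ "carrier (tensor_space M N)"])
      show "g t = f t" if "t \<in> carrier (tensor_space M N)" for t
        by (rule tensor_linear_eqI[OF assms(1) _ _ _ that])
          (use f g in \<open>auto simp: lin_maps_iff\<close>)
    qed (use f g in \<open>auto simp: lin_maps_iff\<close>)
  qed (use f in blast)
  from theI'[OF this] show ?thesis unfolding tensor_lift_def .
qed

lemma tensor_lift_linear: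
  "vector_sp P \<Longrightarrow> is_bilinear M N P \<beta> \<Longrightarrow> is_linear (tensor_space M N) P (tensor_lift M N P \<beta>)"
  using tensor_lift_prop[of P \<beta>] by (simp add: lin_maps_iff)

lemma tensor_lift_tens:
  "vector_sp P \<Longrightarrow> is_bilinear M N P \<beta> \<Longrightarrow> m \<in> carrier M \<Longrightarrow> n \<in> carrier N \<Longrightarrow>
    tensor_lift M N P \<beta> (tens M N m n) = \<beta> m n"
  using tensor_lift_prop[of P \<beta>] by simp

end

lemma tensor_map_props:
  assumes "vector_sp M" "vector_sp N" "vector_sp P" "vector_sp Q"
    and f: "is_linear M P f" and g: "is_linear N Q g"
  shows "is_linear (tensor_space M N) (tensor_space P Q) (tensor_map M N P Q f g)"
    and "m \<in> carrier M \<Longrightarrow> n \<in> carrier N \<Longrightarrow>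
      tensor_map M N P Q f g (tens M N m n) = tens P Q (f m) (g n)"
proof -
  interpret S: tensor_pair M N by (intro tensor_pair.intro assms)
  interpret T: tensor_pair P Q by (intro tensor_pair.intro assms)
  note b = is_bilinear_comp2[OF T.tens_bilinear f g]
  show "is_linear (tensor_space M N) (tensor_space P Q) (tensor_map M N P Q f g)"
    unfolding tensor_map_def by (rule S.tensor_lift_linear[OF T.tensor_vector_sp b])
  show "m \<in> carrier M \<Longrightarrow> n \<in> carrier N \<Longrightarrow>
      tensor_map M N P Q f g (tens M N m n) = tens P Q (f m) (g n)"
    unfolding tensor_map_def by (rule S.tensor_lift_tens[OF T.tensor_vector_sp b])
qed

lemma tensor_assoc_props:
  assumes "vector_sp M" "vector_sp N" "vector_sp P"
  shows "is_linear (tensor_space (tensor_space M N) P) (tensor_space M (tensor_space N P))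
      (tensor_assoc M N P)"
    and "m \<in> carrier M \<Longrightarrow> n \<in> carrier N \<Longrightarrow> p \<in> carrier P \<Longrightarrow>
      tensor_assoc M N P (tens (tensor_space M N) P (tens M N m n) p) =
        tens M (tensor_space N P) m (tens N P n p)"
proof -
  interpret MN: tensor_pair M N by (intro tensor_pair.intro assms)
  interpret NP: tensor_pair N P by (intro tensor_pair.intro assms)
  interpret MN_P: tensor_pair "tensor_space M N" P
    by (intro tensor_pair.intro assms MN.tensor_vector_sp)
  interpret M_NP: tensor_pair M "tensor_space N P"
    by (intro tensor_pair.intro assms NP.tensor_vector_sp)
  let ?T = "tensor_space M (tensor_space N P)"
  let ?g = "\<lambda>p. tensor_lift M N ?T (\<lambda>m n. tens M (tensor_space N P) m (tens N P n p))"
  interpret T: vector_sp ?T by (rule M_NP.tensor_vector_sp)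
  have b1: "is_bilinear M N ?T (\<lambda>m n. tens M (tensor_space N P) m (tens N P n p))"
    if "p \<in> carrier P" for p
    by (rule is_bilinear_comp2[OF M_NP.tens_bilinear is_linear_id is_bilinearD(1)[OF NP.tens_bilinear that]])
  note gl = MN.tensor_lift_linear[OF M_NP.tensor_vector_sp b1]
  note gt = MN.tensor_lift_tens[OF M_NP.tensor_vector_sp b1]
  \<comment> \<open>The inner lift depends on \<open>p\<close> through a definite description, so
    linearity in \<open>p\<close> has to be checked on pure tensors \<open>t\<close>.\<close>
  have "is_linear P ?T (\<lambda>p. ?g p t)" if t: "t \<in> carrier (tensor_space M N)" for t
  proof (rule is_linearI)
    fix p q c assume p: "p \<in> carrier P"
    show "?g p t \<in> carrier ?T" using is_linearD(1)[OF gl[OF p] t] .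
    show "?g (c \<odot>\<^bsub>P\<^esub> p) t = c \<odot>\<^bsub>?T\<^esub> ?g p t"
      by (rule MN.tensor_linear_eqI[OF M_NP.tensor_vector_sp _ _ _ t])
        (use p in \<open>auto intro!: gl is_linear_smult M_NP.tensor_vector_sp
          simp: gt NP.tens_smult_right M_NP.tens_smult_right\<close>)
    assume q: "q \<in> carrier P"
    show "?g (p \<oplus>\<^bsub>P\<^esub> q) t = ?g p t \<oplus>\<^bsub>?T\<^esub> ?g q t"
      by (rule MN.tensor_linear_eqI[OF M_NP.tensor_vector_sp _ _ _ t])
        (use p q in \<open>auto intro!: gl is_linear_add M_NP.tensor_vector_sp
          simp: gt NP.tens_add_right M_NP.tens_add_right\<close>)
  qed
  then have b2: "is_bilinear (tensor_space M N) P ?T (\<lambda>t p. ?g p t)"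
    using gl by (simp add: is_bilinear_def)
  show "is_linear (tensor_space (tensor_space M N) P) ?T (tensor_assoc M N P)"
    unfolding tensor_assoc_def by (rule MN_P.tensor_lift_linear[OF M_NP.tensor_vector_sp b2])
  show "tensor_assoc M N P (tens (tensor_space M N) P (tens M N m n) p) =
        tens M (tensor_space N P) m (tens N P n p)"
    if "m \<in> carrier M" "n \<in> carrier N" "p \<in> carrier P"
    unfolding tensor_assoc_def using that
    by (simp add: MN_P.tensor_lift_tens[OF M_NP.tensor_vector_sp b2] gt)
qed

section \<open>Series inside finite-dimensional subspaces, and the exponential\<close>

section \<open>Exponentials\<close>

context vector_sp
begin

lemma finsum_lessThan_Suc:
  assumes "\<And>j. j < Suc r \<Longrightarrow> f j \<in> carrier V"
  shows "(\<Oplus>j\<in>{..<Suc r}. f j) = f r \<oplus> (\<Oplus>j\<in>{..<r}. f j)"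
  unfolding lessThan_Suc by (rule finsum_insert) (use assms in auto)

lemma finsum_append:
  fixes r k :: nat
  assumes "\<And>j. j < r \<Longrightarrow> f j \<in> carrier V" "\<And>j. j < k \<Longrightarrow> g j \<in> carrier V"
  shows "(\<Oplus>j\<in>{..<r + k}. if j < r then f j else g (j - r)) = (\<Oplus>j\<in>{..<r}. f j) \<oplus> (\<Oplus>j\<in>{..<k}. g j)"
  using assms(2)
proof (induction k)
  case 0
  have "(\<Oplus>j\<in>{..<r}. if j < r then f j else g (j - r)) = (\<Oplus>j\<in>{..<r}. f j)"
    by (rule finsum_cong') (use assms in auto)
  moreover have "(\<Oplus>j\<in>{..<r}. f j) \<in> carrier V" by (rule finsum_closed) (use assms in auto)
  ultimately show ?case by simp
next
  case (Suc k)
  have f: "(\<Oplus>j\<in>{..<r}. f j) \<in> carrier V" by (rule finsum_closed) (use assms in auto)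
  have g: "(\<Oplus>j\<in>{..<k}. g j) \<in> carrier V" by (rule finsum_closed) (use Suc.prems in auto)
  have "(\<Oplus>j\<in>{..<Suc (r + k)}. if j < r then f j else g (j - r)) =
      g k \<oplus> ((\<Oplus>j\<in>{..<r}. f j) \<oplus> (\<Oplus>j\<in>{..<k}. g j))"
    by (subst finsum_lessThan_Suc) (use assms(1) Suc in auto)
  also have "\<dots> = (\<Oplus>j\<in>{..<r}. f j) \<oplus> (\<Oplus>j\<in>{..<Suc k}. g j)"
    by (subst finsum_lessThan_Suc) (use Suc.prems f g in \<open>auto simp: a_lcomm\<close>)
  finally show ?case by simp
qed

text \<open>The heart of the uniqueness of sums, since the vectors \<open>b j\<close> may be
  dependent. If the last vector ever occurs with a non-zero coefficient, that relation expresses it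
  by the others, and eliminating it shortens the family; otherwise its coefficients sum to
  0.\<close>

lemma null_series:
  fixes b :: "nat \<Rightarrow> 'v" and c :: "nat \<Rightarrow> nat \<Rightarrow> complex"
  assumes "\<And>j. j < r \<Longrightarrow> b j \<in> carrier V" "\<And>j. j < r \<Longrightarrow> summable (c j)"
    "\<And>n. (\<Oplus>j\<in>{..<r}. c j n \<odot> b j) = \<zero>"
  shows "(\<Oplus>j\<in>{..<r}. suminf (c j) \<odot> b j) = \<zero>"
  using assms
proof (induction r arbitrary: c)
  case 0 then show ?case by simp
next
  case (Suc r)
  have b: "b j \<in> carrier V" if "j < Suc r" for j using Suc.prems(1) that .
  have S: "(\<Oplus>j\<in>{..<r}. d j \<odot> b j) \<in> carrier V" for d :: "nat \<Rightarrow> complex"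
    by (rule finsum_closed) (use b in auto)
  have split: "(\<Oplus>j\<in>{..<Suc r}. d j \<odot> b j) = d r \<odot> b r \<oplus> (\<Oplus>j\<in>{..<r}. d j \<odot> b j)" for d
    by (rule finsum_lessThan_Suc) (use b in auto)
  have comb: "(\<Oplus>j\<in>{..<r}. (d j + x * e j) \<odot> b j) =
      (\<Oplus>j\<in>{..<r}. d j \<odot> b j) \<oplus> x \<odot> (\<Oplus>j\<in>{..<r}. e j \<odot> b j)" for d e and x :: complex
  proof -
    have "(\<Oplus>j\<in>{..<r}. (d j + x * e j) \<odot> b j) = (\<Oplus>j\<in>{..<r}. d j \<odot> b j \<oplus> x \<odot> (e j \<odot> b j))"
      by (rule finsum_cong') (use b in \<open>auto simp: smult_add_left\<close>)
    also have "\<dots> = (\<Oplus>j\<in>{..<r}. d j \<odot> b j) \<oplus> (\<Oplus>j\<in>{..<r}. x \<odot> (e j \<odot> b j))"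
      by (rule finsum_addf) (use b in auto)
    also have "(\<Oplus>j\<in>{..<r}. x \<odot> (e j \<odot> b j)) = x \<odot> (\<Oplus>j\<in>{..<r}. e j \<odot> b j)"
      by (rule finsum_smult[symmetric]) (use b in auto)
    finally show ?thesis .
  qed
  show ?case
  proof (cases "\<forall>n. c r n = 0")
    case True
    then have "suminf (c r) = 0" by (metis suminf_zero ext)
    moreover have "(\<Oplus>j\<in>{..<r}. c j n \<odot> b j) = \<zero>" for n
      using Suc.prems(3)[of n] True b S by (simp add: split)
    then have "(\<Oplus>j\<in>{..<r}. suminf (c j) \<odot> b j) = \<zero>"
      by (intro Suc.IH) (use Suc.prems in auto)
    ultimately show ?thesis using b by (simp add: split)
  next
    case False
    then obtain n0 where n0: "c r n0 \<noteq> 0" by blast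
    \<comment> \<open>The coefficients of \<open>b r\<close> in terms of the earlier vectors, read
      off from the relation at \<open>n0\<close>.\<close>
    define d where "d j = - (c j n0 / c r n0)" for j
    have br: "b r = (\<Oplus>j\<in>{..<r}. d j \<odot> b j)"
    proof -
      have "(\<Oplus>j\<in>{..<r}. d j \<odot> b j) = (\<Oplus>j\<in>{..<r}. (0 + (- inverse (c r n0)) * c j n0) \<odot> b j)"
        by (simp add: d_def divide_inverse mult.commute)
      also have "\<dots> = (- inverse (c r n0)) \<odot> (\<Oplus>j\<in>{..<r}. c j n0 \<odot> b j)"
      proof -
        have "(\<Oplus>j\<in>{..<r}. 0 \<odot> b j) = \<zero>"
          by (rule add.finprod_one_eqI) (use b in auto)
        then show ?thesis unfolding comb using S by simp
      qed
      also have "(\<Oplus>j\<in>{..<r}. c j n0 \<odot> b j) = (- c r n0) \<odot> b r"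
      proof -
        have "c r n0 \<odot> b r \<oplus> (\<Oplus>j\<in>{..<r}. c j n0 \<odot> b j) = \<zero>"
          using Suc.prems(3)[of n0] by (simp add: split)
        then show ?thesis
          using add_eq_zero_iff[of "\<Oplus>j\<in>{..<r}. c j n0 \<odot> b j" "(- c r n0) \<odot> b r"] b S
          by (simp add: a_comm)
      qed
      finally show ?thesis using n0 b by simp
    qed
    have "(\<Oplus>j\<in>{..<r}. (c j n + c r n * d j) \<odot> b j) = \<zero>" for n
      using Suc.prems(3)[of n] unfolding comb split br[symmetric] using b S by (simp add: a_comm)
    then have z: "(\<Oplus>j\<in>{..<r}. (suminf (\<lambda>n. c j n + c r n * d j)) \<odot> b j) = \<zero>"
      by (intro Suc.IH) (use Suc.prems in \<open>auto intro!: summable_add summable_mult2\<close>)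
    have "(\<Oplus>j\<in>{..<r}. (suminf (\<lambda>n. c j n + c r n * d j)) \<odot> b j) =
        (\<Oplus>j\<in>{..<r}. (suminf (c j) + suminf (c r) * d j) \<odot> b j)"
    proof (rule finsum_cong')
      fix j assume "j \<in> {..<r}"
      then have "(suminf (\<lambda>n. c j n + c r n * d j)) = suminf (c j) + suminf (c r) * d j"
        using Suc.prems(2) by (subst suminf_add[symmetric]) (auto intro!: summable_mult2 simp: suminf_mult2)
      then show "(suminf (\<lambda>n. c j n + c r n * d j)) \<odot> b j = (suminf (c j) + suminf (c r) * d j) \<odot> b j" by simp
    qed (use b in auto)
    then have "(\<Oplus>j\<in>{..<r}. suminf (c j) \<odot> b j) \<oplus> suminf (c r) \<odot> b r = \<zero>"
      using z unfolding comb br[symmetric] by simp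
    then show ?thesis using b S by (simp add: split a_comm)
  qed
qed

lemma fd_sums_add:
  assumes "fd_sums V s w" "fd_sums V s' w'"
  shows "fd_sums V (\<lambda>n. s n \<oplus> s' n) (w \<oplus> w')"
proof -
  obtain r b and a :: "nat \<Rightarrow> nat \<Rightarrow> complex" where 1: "\<And>j. j < r \<Longrightarrow> b j \<in> carrier V \<and> summable (a j)"
    "\<And>n. s n = (\<Oplus>j\<in>{..<r}. a j n \<odot> b j)" "w = (\<Oplus>j\<in>{..<r}. suminf (a j) \<odot> b j)"
    using assms(1) unfolding fd_sums_def by auto
  obtain k b' and a' :: "nat \<Rightarrow> nat \<Rightarrow> complex" where 2: "\<And>j. j < k \<Longrightarrow> b' j \<in> carrier V \<and> summable (a' j)"
    "\<And>n. s' n = (\<Oplus>j\<in>{..<k}. a' j n \<odot> b' j)" "w' = (\<Oplus>j\<in>{..<k}. suminf (a' j) \<odot> b' j)"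
    using assms(2) unfolding fd_sums_def by auto
  define A where "A j = (if j < r then a j else a' (j - r))" for j
  define C where "C j = (if j < r then b j else b' (j - r))" for j
  have j': "j - r < k" if "j < r + k" "\<not> j < r" for j using that by simp
  have e: "(\<lambda>j. h (A j) \<odot> C j) = (\<lambda>j. if j < r then h (a j) \<odot> b j else h (a' (j - r)) \<odot> b' (j - r))"
    for h :: "(nat \<Rightarrow> complex) \<Rightarrow> complex" by (auto simp: A_def C_def fun_eq_iff)
  have "s n \<oplus> s' n = (\<Oplus>j\<in>{..<r + k}. A j n \<odot> C j)" for n
    unfolding e[of "\<lambda>x. x n"] 1 2 by (subst finsum_append) (use 1(1) 2(1) in auto)
  moreover have "w \<oplus> w' = (\<Oplus>j\<in>{..<r + k}. suminf (A j) \<odot> C j)"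
    unfolding e[of suminf] 1 2 by (subst finsum_append) (use 1(1) 2(1) in auto)
  moreover have "C j \<in> carrier V \<and> summable (A j)" if "j < r + k" for j
    using 1(1) 2(1) j' that by (auto simp: A_def C_def)
  ultimately show ?thesis unfolding fd_sums_def by blast
qed

end

text \<open>Since dependent vectors are allowed, the images \<open>f (b j)\<close> serve with the
  same coefficients.\<close>

lemma fd_sums_linear:
  assumes "vector_sp V" "vector_sp W" "is_linear V W f" "fd_sums V s w"
  shows "fd_sums W (\<lambda>n. f (s n)) (f w)"
proof -
  obtain r b and a :: "nat \<Rightarrow> nat \<Rightarrow> complex" where 1: "\<And>j. j < r \<Longrightarrow> b j \<in> carrier V \<and> summable (a j)"
    "\<And>n. s n = (\<Oplus>\<^bsub>V\<^esub>j\<in>{..<r}. a j n \<odot>\<^bsub>V\<^esub> b j)" "w = (\<Oplus>\<^bsub>V\<^esub>j\<in>{..<r}. suminf (a j) \<odot>\<^bsub>V\<^esub> b j)"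
    using assms(4) unfolding fd_sums_def by auto
  interpret V: vector_sp V by fact
  interpret W: vector_sp W by fact
  have e: "f (\<Oplus>\<^bsub>V\<^esub>j\<in>{..<r}. d j \<odot>\<^bsub>V\<^esub> b j) = (\<Oplus>\<^bsub>W\<^esub>j\<in>{..<r}. d j \<odot>\<^bsub>W\<^esub> f (b j))" for d
  proof -
    have "f (\<Oplus>\<^bsub>V\<^esub>j\<in>{..<r}. d j \<odot>\<^bsub>V\<^esub> b j) = (\<Oplus>\<^bsub>W\<^esub>j\<in>{..<r}. f (d j \<odot>\<^bsub>V\<^esub> b j))"
      by (rule is_linear_finsum[OF assms(1-3)]) (use 1(1) in auto)
    also have "\<dots> = (\<Oplus>\<^bsub>W\<^esub>j\<in>{..<r}. d j \<odot>\<^bsub>W\<^esub> f (b j))"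
      by (rule W.finsum_cong') (use 1(1) is_linearD[OF assms(3)] in auto)
    finally show ?thesis .
  qed
  have "\<forall>j<r. f (b j) \<in> carrier W \<and> summable (a j)" using 1(1) is_linearD(1)[OF assms(3)] by blast
  moreover have "\<forall>n. f (s n) = (\<Oplus>\<^bsub>W\<^esub>j\<in>{..<r}. a j n \<odot>\<^bsub>W\<^esub> f (b j))" unfolding 1 e by simp
  moreover have "f w = (\<Oplus>\<^bsub>W\<^esub>j\<in>{..<r}. suminf (a j) \<odot>\<^bsub>W\<^esub> f (b j))" unfolding 1 e by simp
  ultimately show ?thesis unfolding fd_sums_def
    by (intro exI[of _ r] exI[of _ "\<lambda>j. f (b j)"] exI[of _ a] conjI)
qed

text \<open>A relation in place of the function \<open>lf_exp\<close>: it asserts convergence and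
  value together, and can be added and scaled before the exponential is known to exist
  everywhere.\<close>

definition has_exp :: "(complex, 'v, 'z) module_scheme \<Rightarrow> ('v \<Rightarrow> 'v) \<Rightarrow> 'v \<Rightarrow> 'v \<Rightarrow> bool" where
  "has_exp V T v w \<longleftrightarrow> fd_sums V (\<lambda>n. (1 / fact n) \<odot>\<^bsub>V\<^esub> (T ^^ n) v) w"

lemma is_linear_funpow: "is_linear V V T \<Longrightarrow> is_linear V V (T ^^ n)"
  by (induction n) (simp_all add: is_linear_def)

context vector_sp
begin

lemma fd_sums_closed: "fd_sums V s w \<Longrightarrow> w \<in> carrier V"
  unfolding fd_sums_def by (auto intro!: finsum_closed)

lemma fd_sums_zero:
  assumes "fd_sums V (\<lambda>n. \<zero>) w"
  shows "w = \<zero>"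
proof -
  obtain r b and a :: "nat \<Rightarrow> nat \<Rightarrow> complex" where "\<And>j. j < r \<Longrightarrow> b j \<in> carrier V \<and> summable (a j)"
    "\<And>n. \<zero> = (\<Oplus>j\<in>{..<r}. a j n \<odot> b j)" "w = (\<Oplus>j\<in>{..<r}. suminf (a j) \<odot> b j)"
    using assms unfolding fd_sums_def by auto
  then show ?thesis using null_series[of r b a] by simp
qed

text \<open>The difference of the two presentations presents the zero sequence, and
  \<open>null_series\<close> computes its sum.\<close>

lemma fd_sums_unique:
  assumes "fd_sums V s w" "fd_sums V s w'"
  shows "w = w'"
proof -
  have l: "is_linear V V (\<lambda>v. (-1) \<odot> v)"
    by (rule is_linear_smult[OF vector_sp_axioms is_linear_id])
  have s: "s n \<in> carrier V" for n
    using assms(1) unfolding fd_sums_def by (auto intro!: finsum_closed)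
  have "fd_sums V (\<lambda>n. s n \<oplus> (-1) \<odot> s n) (w \<oplus> (-1) \<odot> w')"
    by (rule fd_sums_add[OF assms(1) fd_sums_linear[OF vector_sp_axioms vector_sp_axioms l assms(2)]])
  moreover have "s n \<oplus> (-1) \<odot> s n = \<zero>" for n
    using s add_eq_zero_iff by blast
  ultimately have "fd_sums V (\<lambda>n. \<zero>) (w \<oplus> (-1) \<odot> w')" by simp
  then have "w \<oplus> (-1) \<odot> w' = \<zero>" by (rule fd_sums_zero)
  then show ?thesis using add_eq_zero_iff assms fd_sums_closed by blast
qed

lemma fd_sums_scalar:
  assumes "v \<in> carrier V" "a sums x"
  shows "fd_sums V (\<lambda>n. a n \<odot> v) (x \<odot> v)"
  unfolding fd_sums_def using assms
  by (intro exI[of _ 1] exI[of _ "\<lambda>_. v"] exI[of _ "\<lambda>_. a"])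
    (auto simp: sums_iff lessThan_Suc)

lemma has_exp_closed: "has_exp V T v w \<Longrightarrow> w \<in> carrier V"
  unfolding has_exp_def by (rule fd_sums_closed)

lemma lf_exp_eqI: "has_exp V T v w \<Longrightarrow> lf_exp V T v = w"
  unfolding lf_exp_def has_exp_def by (rule the_equality) (auto intro: fd_sums_unique)

lemma has_exp_add:
  assumes "is_linear V V T" "v \<in> carrier V" "v' \<in> carrier V" "has_exp V T v w" "has_exp V T v' w'"
  shows "has_exp V T (v \<oplus> v') (w \<oplus> w')"
proof -
  note l = is_linear_funpow[OF assms(1)]
  show ?thesis
    using fd_sums_add[OF assms(4,5)[unfolded has_exp_def]] assms(2,3)
    by (simp add: has_exp_def is_linearD[OF l] smult_add_right)
qed

lemma has_exp_smult:
  assumes "is_linear V V T" "v \<in> carrier V" "has_exp V T v w"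
  shows "has_exp V T (c \<odot> v) (c \<odot> w)"
proof -
  note l = is_linear_funpow[OF assms(1)]
  show ?thesis
    using fd_sums_linear[OF vector_sp_axioms vector_sp_axioms
        is_linear_smult[OF vector_sp_axioms is_linear_id] assms(3)[unfolded has_exp_def], of c] assms(2)
    by (simp add: has_exp_def is_linearD[OF l] mult.commute)
qed

text \<open>On a Jordan chain of length two, T^n v = l^n v + n l^(n-1) w, and both coefficient
  sequences divided by n! sum to e^l.\<close>

lemma has_exp_jordan:
  assumes T: "is_linear V V T" and v: "v \<in> carrier V" and w: "w \<in> carrier V"
    and Tv: "T v = l \<odot> v \<oplus> w" and Tw: "T w = l \<odot> w"
  shows "has_exp V T v (exp l \<odot> v \<oplus> exp l \<odot> w)"
proof -
  have "(T ^^ n) w = l ^ n \<odot> w" for n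
    by (induction n) (simp_all add: w Tw is_linearD[OF T] mult.commute)
  \<comment> \<open>At n = 0 the truncated exponent n - 1 is harmless, because the factor n
    vanishes.\<close>
  moreover have "(T ^^ n) v = l ^ n \<odot> v \<oplus> (of_nat n * l ^ (n - 1)) \<odot> w" for n
  proof (induction n)
    case 0 then show ?case using v w by simp
  next
    case (Suc n)
    have "T ((T ^^ n) v) = l ^ n \<odot> (l \<odot> v \<oplus> w) \<oplus> (of_nat n * l ^ (n - 1)) \<odot> (l \<odot> w)"
      using v w by (simp add: Suc is_linearD[OF T] Tv Tw)
    also have "\<dots> = (l ^ Suc n) \<odot> v \<oplus> (l ^ n + of_nat n * l ^ (n - 1) * l) \<odot> w"
      using v w by (simp add: smult_add_right smult_add_left a_assoc mult.commute)
    also have "l ^ n + of_nat n * l ^ (n - 1) * l = of_nat (Suc n) * l ^ (Suc n - 1)"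
      by (cases n) (simp_all add: algebra_simps)
    finally show ?case by simp
  qed
  moreover have "(\<lambda>n. (1 / fact n) * l ^ n) sums exp l"
    using exp_converges[of l] by (simp add: scaleR_conv_of_real field_simps)
  moreover have "(\<lambda>n. (1 / fact n) * (of_nat n * l ^ (n - 1))) sums exp l"
  proof -
    \<comment> \<open>The term at 0 vanishes, and (n + 1) / (n + 1)! = 1 / n! turns the shifted
      series into the exponential series.\<close>
    have e: "(1 / fact (Suc n)) * (of_nat (Suc n) * l ^ (Suc n - 1)) = (1 / fact n) * l ^ n" for n
    proof -
      have "of_nat (Suc n) \<noteq> (0 :: complex)" by (simp del: of_nat_Suc)
      then show ?thesis by (simp add: fact_Suc del: of_nat_Suc)
    qed
    have "(\<lambda>n. (1 / fact (Suc n)) * (of_nat (Suc n) * l ^ (Suc n - 1))) sums exp l"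
      unfolding e by (rule calculation(3))
    from sums_Suc[OF this] show ?thesis by simp
  qed
  ultimately have "fd_sums V (\<lambda>n. ((1 / fact n) * l ^ n) \<odot> v \<oplus> ((1 / fact n) * (of_nat n * l ^ (n - 1))) \<odot> w)
      (exp l \<odot> v \<oplus> exp l \<odot> w)"
    by (intro fd_sums_add fd_sums_scalar v w)
  then show ?thesis using v w \<open>\<And>n. (T ^^ n) v = _ n\<close>
    by (simp add: has_exp_def smult_add_right)
qed

lemma has_exp_eigen:
  assumes "is_linear V V T" "v \<in> carrier V" "T v = l \<odot> v"
  shows "has_exp V T v (exp l \<odot> v)"
  using has_exp_jordan[OF assms(1,2), of \<zero> l] assms is_linear_zero[OF vector_sp_axioms vector_sp_axioms assms(1)]
  by simp

end

section \<open>Local finiteness through lists of linear factors\<close>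

section \<open>Locally finite operators\<close>

text \<open>The product of the factors T - l, for l in the list, annihilates v. Over the complex
  numbers this can replace annihilation by a non-zero polynomial, and lists are easier to induct
  on.\<close>

fun killed :: "(complex, 'v, 'z) module_scheme \<Rightarrow> ('v \<Rightarrow> 'v) \<Rightarrow> complex list \<Rightarrow> 'v \<Rightarrow> bool" where
  "killed V T [] v \<longleftrightarrow> v = \<zero>\<^bsub>V\<^esub>"
| "killed V T (l # ls) v \<longleftrightarrow> killed V T ls (T v \<oplus>\<^bsub>V\<^esub> (- l) \<odot>\<^bsub>V\<^esub> v)"

text \<open>Annihilating factors travel along any map that intertwines the two operators. It is
  applied to scalars, to \<open>T\<close> itself and to the projection onto a quotient.\<close>

lemma killed_linear:
  assumes "vector_sp V" "vector_sp W" "is_linear V V T" "is_linear V W q"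
    "\<And>v. v \<in> carrier V \<Longrightarrow> q (T v) = S (q v)"
  shows "v \<in> carrier V \<Longrightarrow> killed V T ls v \<Longrightarrow> killed W S ls (q v)"
proof (induction ls arbitrary: v)
  case Nil then show ?case using is_linear_zero[OF assms(1,2,4)] by simp
next
  case (Cons l ls)
  interpret V: vector_sp V by fact
  have c: "T v \<oplus>\<^bsub>V\<^esub> (- l) \<odot>\<^bsub>V\<^esub> v \<in> carrier V" using Cons.prems is_linearD[OF assms(3)] by simp
  show ?case using Cons.IH[OF c] Cons.prems is_linearD[OF assms(3)] assms(5) by (simp add: is_linearD[OF assms(4)])
qed

context vector_sp
begin

context
  fixes T
  assumes T: "is_linear V V T"
begin

lemma shift_linear: "is_linear V V (\<lambda>v. T v \<oplus> c \<odot> v)"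
  by (intro is_linear_add is_linear_smult vector_sp_axioms T is_linear_id)

lemma killed_zero: "killed V T ls \<zero>"
  by (induction ls) (simp_all add: is_linear_zero[OF vector_sp_axioms vector_sp_axioms T])

lemma killed_add:
  "v \<in> carrier V \<Longrightarrow> w \<in> carrier V \<Longrightarrow> killed V T ls v \<Longrightarrow> killed V T ls w \<Longrightarrow> killed V T ls (v \<oplus> w)"
  by (induction ls arbitrary: v w)
    (simp_all add: is_linearD[OF shift_linear])

lemma killed_smult: "v \<in> carrier V \<Longrightarrow> killed V T ls v \<Longrightarrow> killed V T ls (c \<odot> v)"
  by (rule killed_linear[OF vector_sp_axioms vector_sp_axioms T
        is_linear_smult[OF vector_sp_axioms is_linear_id]]) (simp_all add: is_linearD[OF T])

lemma killed_T: "v \<in> carrier V \<Longrightarrow> killed V T ls v \<Longrightarrow> killed V T ls (T v)"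
  by (rule killed_linear[OF vector_sp_axioms vector_sp_axioms T T]) auto

lemma killed_append1: "v \<in> carrier V \<Longrightarrow> killed V T ls v \<Longrightarrow> killed V T (ls @ ks) v"
  by (induction ls arbitrary: v) (simp_all add: killed_zero is_linearD[OF shift_linear])

text \<open>The factors in \<open>ks\<close> act first, and each keeps the vector inside the
  \<open>T\<close>-stable space killed by \<open>ls\<close>. Together with
  \<open>killed_append1\<close> this gives two vectors a common list.\<close>

lemma killed_append2: "v \<in> carrier V \<Longrightarrow> killed V T ls v \<Longrightarrow> killed V T (ks @ ls) v"
  by (induction ks arbitrary: v)
    (simp_all add: killed_T killed_add killed_smult is_linearD[OF shift_linear] is_linearD[OF T])

lemma killed_subspace: "submodule {v \<in> carrier V. \<exists>ls. killed V T ls v} cfield V"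
proof (rule subspaceI)
  fix v w assume "v \<in> {v \<in> carrier V. \<exists>ls. killed V T ls v}" "w \<in> {v \<in> carrier V. \<exists>ls. killed V T ls v}"
  then obtain ls ks where "v \<in> carrier V" "killed V T ls v" "w \<in> carrier V" "killed V T ks w" by blast
  then have "v \<oplus> w \<in> carrier V" "killed V T (ls @ ks) (v \<oplus> w)"
    using killed_append1 killed_append2 killed_add by auto
  then show "v \<oplus> w \<in> {v \<in> carrier V. \<exists>ls. killed V T ls v}" by blast
next
  fix c v assume "v \<in> {v \<in> carrier V. \<exists>ls. killed V T ls v}"
  then show "c \<odot> v \<in> {v \<in> carrier V. \<exists>ls. killed V T ls v}" using killed_smult by blast
qed (use killed_zero in auto)

lemma poly_apply_bound:
  assumes "v \<in> carrier V" "Polynomial.degree p \<le> N"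
  shows "(\<Oplus>i\<in>{..Polynomial.degree p}. Polynomial.coeff p i \<odot> (T ^^ i) v) =
    (\<Oplus>i\<in>{..N}. Polynomial.coeff p i \<odot> (T ^^ i) v)"
  by (rule add.finprod_mono_neutral_cong_left)
    (use assms is_linearD(1)[OF is_linear_funpow[OF T]] in \<open>auto simp: coeff_eq_0\<close>)

text \<open>Evaluating (X - l) p at v is evaluating p at (T - l) v, so a linear factor of the
  polynomial corresponds to an entry of the list in \<open>killed\<close>.\<close>

lemma poly_apply_mult:
  assumes v: "v \<in> carrier V"
  shows "(\<Oplus>i\<in>{..Polynomial.degree ([:- l, 1:] * p)}. Polynomial.coeff ([:- l, 1:] * p) i \<odot> (T ^^ i) v) =
    (\<Oplus>i\<in>{..Polynomial.degree p}. Polynomial.coeff p i \<odot> (T ^^ i) (T v \<oplus> (- l) \<odot> v))"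
proof -
  note Ti = is_linearD[OF is_linear_funpow[OF T]]
  have Tv: "T v \<in> carrier V" using is_linearD(1)[OF T v] .
  let ?n = "Polynomial.degree p" and ?q = "[:- l, 1:] * p"
  let ?t = "\<lambda>i. (T ^^ i) v" and ?c = "Polynomial.coeff p"
  have t: "?t i \<in> carrier V" for i using Ti(1) v .
  have d: "Polynomial.degree ?q \<le> Suc ?n"
    using degree_mult_le[of "[:- l, 1:]" p] by simp
  have cl: "(\<Oplus>i\<in>I. a i \<odot> ?t i) \<in> carrier V" for I and a :: "nat \<Rightarrow> complex"
    by (rule finsum_closed) (use t in auto)
  \<comment> \<open>Multiplication by X moves each coefficient up by one degree, which is one more
    application of \<open>T\<close>; the new constant coefficient is 0.\<close>
  have shift: "(\<Oplus>i\<in>{..Suc ?n}. (case i of 0 \<Rightarrow> 0 | Suc j \<Rightarrow> ?c j) \<odot> ?t i) = (\<Oplus>i\<in>{..?n}. ?c i \<odot> (T ^^ i) (T v))"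
  proof -
    have "(\<Oplus>i\<in>{..?n}. ?c i \<odot> ?t (Suc i)) = (\<Oplus>i\<in>{..?n}. ?c i \<odot> (T ^^ i) (T v))"
      by (rule finsum_cong') (use Ti Tv in \<open>auto simp: funpow_Suc_right simp del: funpow.simps(2)\<close>)
    then show ?thesis
      by (subst finsum_Suc2) (use t Ti Tv v in \<open>auto intro!: r_zero finsum_closed simp del: funpow.simps(2)\<close>)
  qed
  have "(\<Oplus>i\<in>{..Polynomial.degree ?q}. Polynomial.coeff ?q i \<odot> ?t i) = (\<Oplus>i\<in>{..Suc ?n}. Polynomial.coeff ?q i \<odot> ?t i)"
    by (rule poly_apply_bound[OF v d])
  also have "\<dots> = (\<Oplus>i\<in>{..Suc ?n}. (case i of 0 \<Rightarrow> 0 | Suc j \<Rightarrow> ?c j) \<odot> ?t i \<oplus> (- l) \<odot> (?c i \<odot> ?t i))"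
  proof (rule finsum_cong')
    fix i
    have "Polynomial.coeff ?q i = (case i of 0 \<Rightarrow> 0 | Suc j \<Rightarrow> ?c j) + (- l) * ?c i"
      by (simp add: coeff_pCons split: nat.split)
    then show "Polynomial.coeff ?q i \<odot> ?t i =
        (case i of 0 \<Rightarrow> 0 | Suc j \<Rightarrow> ?c j) \<odot> ?t i \<oplus> (- l) \<odot> (?c i \<odot> ?t i)"
      using t by (simp only: smult_add_left smult_smult)
  qed (use t in auto)
  also have "\<dots> = (\<Oplus>i\<in>{..Suc ?n}. (case i of 0 \<Rightarrow> 0 | Suc j \<Rightarrow> ?c j) \<odot> ?t i) \<oplus> (\<Oplus>i\<in>{..Suc ?n}. (- l) \<odot> (?c i \<odot> ?t i))"
    by (rule finsum_addf) (use t in auto)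
  also have "(\<Oplus>i\<in>{..Suc ?n}. (- l) \<odot> (?c i \<odot> ?t i)) = (- l) \<odot> (\<Oplus>i\<in>{..Suc ?n}. ?c i \<odot> ?t i)"
    by (rule finsum_smult[symmetric]) (use t in auto)
  also have "(\<Oplus>i\<in>{..Suc ?n}. ?c i \<odot> ?t i) = (\<Oplus>i\<in>{..?n}. ?c i \<odot> ?t i)"
    by (rule poly_apply_bound[OF v, symmetric]) simp
  also have "(- l) \<odot> (\<Oplus>i\<in>{..?n}. ?c i \<odot> ?t i) = (\<Oplus>i\<in>{..?n}. (- l) \<odot> (?c i \<odot> ?t i))"
    by (rule finsum_smult) (use t in auto)
  also have "(\<Oplus>i\<in>{..Suc ?n}. (case i of 0 \<Rightarrow> 0 | Suc j \<Rightarrow> ?c j) \<odot> ?t i) \<oplus> (\<Oplus>i\<in>{..?n}. (- l) \<odot> (?c i \<odot> ?t i)) =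
      (\<Oplus>i\<in>{..?n}. ?c i \<odot> (T ^^ i) (T v) \<oplus> (- l) \<odot> (?c i \<odot> ?t i))"
    unfolding shift by (rule finsum_addf[symmetric]) (use t Ti Tv in auto)
  also have "\<dots> = (\<Oplus>i\<in>{..?n}. ?c i \<odot> (T ^^ i) (T v \<oplus> (- l) \<odot> v))"
    by (rule finsum_cong') (use v Tv in \<open>auto simp: Ti smult_add_right mult.commute\<close>)
  finally show ?thesis .
qed

text \<open>A root, from the fundamental theorem of algebra, becomes the head of the list and lowers
  the degree; a non-zero constant finally forces v = 0, the case of the empty list. The converse
  multiplies the factors together again, starting from the polynomial 1.\<close>

lemma locally_finite_iff_killed:
  assumes v: "v \<in> carrier V"
  shows "(\<exists>f::complex poly. f \<noteq> 0 \<and>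
      (\<Oplus>i\<in>{..Polynomial.degree f}. Polynomial.coeff f i \<odot> (T ^^ i) v) = \<zero>) \<longleftrightarrow> (\<exists>ls. killed V T ls v)"
proof
  assume "\<exists>ls. killed V T ls v"
  then obtain ls where "killed V T ls v" by blast
  then show "\<exists>f::complex poly. f \<noteq> 0 \<and>
      (\<Oplus>i\<in>{..Polynomial.degree f}. Polynomial.coeff f i \<odot> (T ^^ i) v) = \<zero>" using v
  proof (induction ls arbitrary: v)
    case Nil then show ?case by (intro exI[of _ "1"]) simp
  next
    case (Cons l ls)
    have "T v \<oplus> (- l) \<odot> v \<in> carrier V" using Cons.prems is_linearD[OF shift_linear] by simp
    then obtain f :: "complex poly" where "f \<noteq> 0"
      "(\<Oplus>i\<in>{..Polynomial.degree f}. Polynomial.coeff f i \<odot> (T ^^ i) (T v \<oplus> (- l) \<odot> v)) = \<zero>"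
      using Cons by auto
    then show ?case using poly_apply_mult[OF Cons.prems(2), of l f]
      by (intro exI[of _ "[:- l, 1:] * f"]) (simp del: mult_pCons_left)
  qed
next
  assume "\<exists>f::complex poly. f \<noteq> 0 \<and>
      (\<Oplus>i\<in>{..Polynomial.degree f}. Polynomial.coeff f i \<odot> (T ^^ i) v) = \<zero>"
  then obtain f :: "complex poly" where "f \<noteq> 0"
    "(\<Oplus>i\<in>{..Polynomial.degree f}. Polynomial.coeff f i \<odot> (T ^^ i) v) = \<zero>" by blast
  then show "\<exists>ls. killed V T ls v" using v
  proof (induction "Polynomial.degree f" arbitrary: f v)
    case 0
    then have "Polynomial.coeff f 0 \<odot> v = \<zero>" by simp
    moreover have "Polynomial.coeff f 0 \<noteq> 0" using 0 by (metis leading_coeff_0_iff)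
    ultimately have "killed V T [] v" using smult_eq_zero[OF 0(4)] by simp
    then show ?case by blast
  next
    case (Suc n)
    then have "\<not> constant (poly f)" by (simp add: constant_degree)
    then obtain l where "poly f l = 0" using fundamental_theorem_of_algebra by blast
    then obtain g where g: "f = [:- l, 1:] * g" by (metis dvd_def poly_eq_0_iff_dvd)
    have "g \<noteq> 0" using g Suc.prems by auto
    moreover have "n = Polynomial.degree g"
      using Suc.hyps(2) g \<open>g \<noteq> 0\<close> degree_mult_eq[of "[:- l, 1:]" g] by (simp del: mult_pCons_left)
    moreover have "T v \<oplus> (- l) \<odot> v \<in> carrier V" using Suc.prems is_linearD[OF shift_linear] by simp
    ultimately obtain ls where "killed V T ls (T v \<oplus> (- l) \<odot> v)"
      using Suc.hyps(1)[of g "T v \<oplus> (- l) \<odot> v"] Suc.prems(2) poly_apply_mult[OF Suc.prems(3), of l g] g by auto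
    then have "killed V T (l # ls) v" by simp
    then show ?case by blast
  qed
qed

end
end

section \<open>Orthonormal bases and vectors representing functionals\<close>

section \<open>The form and the grading group\<close>

locale nondeg_form = h: finite_dimensional_vector_space sc Bs
  for sc :: "complex \<Rightarrow> 'h::ab_group_add \<Rightarrow> 'h" and Bs +
  fixes B :: "'h \<Rightarrow> 'h \<Rightarrow> complex"
  assumes nondeg: "nondeg_sym_bilinear sc B"
begin

lemma B_sym: "B x y = B y x"
  using nondeg by (simp add: nondeg_sym_bilinear_def)

lemma B_nondeg: "(\<And>y. B x y = 0) \<Longrightarrow> x = 0"
  using nondeg by (simp add: nondeg_sym_bilinear_def)

lemma B_linear: "Vector_Spaces.linear sc (*) (B x)"
  using nondeg by (simp add: nondeg_sym_bilinear_def)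

lemma B_add [simp]: "B x (y + z) = B x y + B x z" "B (y + z) x = B y x + B z x"
  using B_linear[of x] by (simp_all add: Vector_Spaces.linear_iff B_sym[of _ x])

lemma B_scale [simp]: "B x (sc c y) = c * B x y" "B (sc c y) x = c * B y x"
  using B_linear[of x] by (simp_all add: Vector_Spaces.linear_iff B_sym[of _ x])

lemma B_zero [simp]: "B x 0 = 0" "B 0 x = 0"
  using B_scale(1)[of x 0 0] B_sym[of 0 x] by simp_all

lemma B_minus [simp]: "B x (- y) = - B x y" "B (- y) x = - B y x"
  using B_add(1)[of x y "- y"] B_sym[of "- y" x] B_sym[of y x] by (simp_all add: add_eq_0_iff2)

lemma B_diff [simp]: "B x (y - z) = B x y - B x z" "B (y - z) x = B y x - B z x"
  using B_add(1)[of x y "- z"] B_add(2)[of y "- z" x] by simp_all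

lemma B_sum: "B x (sum f I) = (\<Sum>i\<in>I. B x (f i))"
  by (induction I rule: infinite_finite_induct) simp_all

lemma onb_coeff:
  assumes "finite U" "\<forall>u\<in>U. \<forall>v\<in>U. B u v = (if u = v then 1 else 0)" "u \<in> U"
  shows "B u (\<Sum>v\<in>U. sc (f v) v) = f u"
proof -
  have "B u (\<Sum>v\<in>U. sc (f v) v) = (\<Sum>v\<in>U. if v = u then f v else 0)"
    unfolding B_sum by (rule sum.cong) (use assms in auto)
  then show ?thesis using assms by simp
qed

text \<open>A maximal orthonormal set spans: otherwise the form is non-zero on its orthogonal
  complement, hence by polarisation has a non-isotropic vector there.\<close>

lemma onb_exists: "\<exists>U. orthonormal_basis sc B U"
proof -
  define on where "on U \<longleftrightarrow> finite U \<and> (\<forall>u\<in>U. \<forall>v\<in>U. B u v = (if u = v then 1 else 0))" for U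
  have ind: "h.independent U" if "on U" for U
  proof (rule h.independent_if_scalars_zero)
    show "f x = 0" if "(\<Sum>x\<in>U. sc (f x) x) = 0" "x \<in> U" for f x
      using onb_coeff[of U x f] that \<open>on U\<close> by (simp add: on_def)
  qed (use that in \<open>simp add: on_def\<close>)
  \<comment> \<open>Independence bounds the size, so a largest orthonormal set exists.\<close>
  have "card U < Suc (h.dim UNIV)" if "on U" for U
    unfolding less_Suc_eq_le by (rule h.independent_card_le_dim[OF _ ind[OF that]]) simp
  moreover have "on {}" by (simp add: on_def)
  ultimately have "\<exists>U. on U \<and> (\<forall>U'. on U' \<longrightarrow> card U' \<le> card U)"
    using ex_has_greatest_nat[of on "{}" card "Suc (h.dim UNIV)"] by blast
  then obtain U where U: "on U" "\<And>U'. on U' \<Longrightarrow> card U' \<le> card U" by blast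
  have fin: "finite U" using U(1) by (simp add: on_def)
  have "h.span U = UNIV"
  proof (rule ccontr)
    assume "h.span U \<noteq> UNIV"
    then obtain x where x: "x \<notin> h.span U" by blast
    define pr where "pr z = z - (\<Sum>u\<in>U. sc (B u z) u)" for z
    have pr: "B u (pr z) = 0" if "u \<in> U" for u z
      using onb_coeff[OF fin _ that, of "\<lambda>u. B u z"] U(1) that by (simp add: pr_def on_def)
    have "pr x \<noteq> 0"
    proof
      assume "pr x = 0"
      then have "x = (\<Sum>u\<in>U. sc (B u x) u)" by (simp add: pr_def)
      then show False using x h.span_sum[of U "\<lambda>u. sc (B u x) u" U] h.span_scale h.span_base by metis
    qed
    then obtain y where y: "B (pr x) y \<noteq> 0" using B_nondeg by blast
    have "B (pr x) (pr y) = B (pr x) y - (\<Sum>u\<in>U. B (pr x) (sc (B u y) u))"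
      by (simp add: pr_def[of y] B_sum)
    also have "(\<Sum>u\<in>U. B (pr x) (sc (B u y) u)) = 0"
      by (rule sum.neutral) (use pr in \<open>auto simp: B_sym[of "pr x"]\<close>)
    finally have xy: "B (pr x) (pr y) \<noteq> 0" using y by simp
    have "\<exists>w. (\<forall>u\<in>U. B u w = 0) \<and> B w w \<noteq> 0"
    proof (rule ccontr)
      assume "\<not> ?thesis"
      then have iso: "B w w = 0" if "\<forall>u\<in>U. B u w = 0" for w using that by blast
      have "B (pr x + pr y) (pr x + pr y) = 0" "B (pr x) (pr x) = 0" "B (pr y) (pr y) = 0"
        by (rule iso; simp add: pr)+
      then show False using xy B_sym[of "pr y" "pr x"] by simp
    qed
    then obtain w where w: "\<forall>u\<in>U. B u w = 0" "B w w \<noteq> 0" by blast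
    define e where "e = sc (inverse (csqrt (B w w))) w"
    have e: "B e e = 1" "\<forall>u\<in>U. B u e = 0"
    proof -
      have "inverse (csqrt (B w w)) * inverse (csqrt (B w w)) = inverse (B w w)"
        using inverse_mult_distrib[of "csqrt (B w w)" "csqrt (B w w)"] power2_csqrt[of "B w w"]
        by (simp only: power2_eq_square)
      then have "B e e = inverse (B w w) * B w w" by (simp only: e_def B_scale mult.assoc[symmetric])
      then show "B e e = 1" using w(2) by simp
    qed (use w(1) in \<open>simp add: e_def\<close>)
    then have "e \<notin> U" using e by force
    moreover have "on (insert e U)"
      unfolding on_def
    proof (intro conjI ballI)
      fix u v assume "u \<in> insert e U" "v \<in> insert e U"
      then show "B u v = (if u = v then 1 else 0)"
        using U(1) e \<open>e \<notin> U\<close> B_sym[of e v] unfolding on_def by (metis insertE)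
    qed (use fin in simp)
    ultimately show False using U(2)[of "insert e U"] fin by simp
  qed
  then have "orthonormal_basis sc B U"
    unfolding orthonormal_basis_def finite_dimensional_vector_space_def finite_dimensional_vector_space_axioms_def
    using U(1) ind[OF U(1)] h.vector_space_axioms by (simp add: on_def)
  then show ?thesis by blast
qed

abbreviation U where "U \<equiv> some_onb sc B"

lemma onb_U: "orthonormal_basis sc B U"
  unfolding some_onb_def using onb_exists by (rule someI_ex)

lemma finite_U: "finite U"
  using onb_U by (simp add: orthonormal_basis_def finite_dimensional_vector_space_def
    finite_dimensional_vector_space_axioms_def)

text \<open>The vector minus its expansion is orthogonal to \<open>U\<close>, hence to its span, and
  non-degeneracy applies. Through this identity the sum over \<open>U\<close> in the Casimir element
  becomes the action of a single vector.\<close>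

lemma onb_expand: "y = (\<Sum>u\<in>U. sc (B u y) u)"
proof -
  define z where "z = y - (\<Sum>u\<in>U. sc (B u y) u)"
  have o: "\<forall>u\<in>U. \<forall>v\<in>U. B u v = (if u = v then 1 else 0)" and s: "h.span U = UNIV"
    using onb_U by (simp_all add: orthonormal_basis_def finite_dimensional_vector_space_def
        finite_dimensional_vector_space_axioms_def)
  have z: "B u z = 0" if "u \<in> U" for u
    using onb_coeff[OF finite_U o that, of "\<lambda>u. B u y"] by (simp add: z_def)
  have "B z v = 0" for v
  proof -
    have "v \<in> h.span U" using s by simp
    then show ?thesis by (induction rule: h.span_induct_alt) (simp_all add: B_sym[of z] z)
  qed
  then have "z = 0" by (rule B_nondeg)
  then show ?thesis by (simp add: z_def)
qed

text \<open>Turns a weight, once extended to a linear functional, into a vector; its coordinates in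
  the orthonormal basis are the values \<open>g u\<close>.\<close>

lemma functional_rep:
  assumes "Vector_Spaces.linear sc (*) g"
  shows "\<exists>x. \<forall>y. g y = B x y"
proof -
  have lin: "g (y + z) = g y + g z" "g (sc c y) = c * g y" for y z c
    using assms by (simp_all add: Vector_Spaces.linear_iff)
  have g0: "g 0 = 0" using lin(2)[of 0 0] by simp
  have gs: "g (sum f I) = (\<Sum>i\<in>I. g (f i))" for f :: "'h \<Rightarrow> 'h" and I
    by (induction I rule: infinite_finite_induct) (simp_all add: g0 lin)
  have "g y = B (\<Sum>u\<in>U. sc (g u) u) y" for y
  proof -
    have "g y = (\<Sum>u\<in>U. B u y * g u)" by (subst onb_expand[of y]) (simp add: gs lin)
    also have "\<dots> = B (\<Sum>u\<in>U. sc (g u) u) y"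
      unfolding B_sym[of "sum _ _" y] B_sum by (rule sum.cong) (simp_all add: B_sym[of y])
    finally show ?thesis .
  qed
  then show ?thesis by blast
qed

end

section \<open>The dual lattice, its characters, and the cosets that index the grading\<close>

locale even_lattice = nondeg_form sc Bs B
  for sc :: "complex \<Rightarrow> 'h::ab_group_add \<Rightarrow> 'h" and Bs and B +
  fixes L :: "'h set" and \<alpha> :: "'h \<Rightarrow> 'h \<Rightarrow> complex"
  assumes L_subgroup: "subgroup L (add_grp UNIV)"
    and L_int: "\<forall>x\<in>L. \<forall>y\<in>L. B x y \<in> \<int>"
    and L_even: "\<forall>x\<in>L. \<exists>k::int. B x x = of_int (2 * k)"
    and cocycle: "normalised_cocycle L \<alpha>"
    and \<alpha>_comm: "\<forall>x\<in>L. \<forall>y\<in>L. \<alpha> x y * inverse (\<alpha> y x) = exp (complex_of_real pi * \<i> * B x y)"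
begin

abbreviation D where "D \<equiv> dual_lattice B L"
abbreviation G where "G \<equiv> grading_group B L"
abbreviation pc where "pc \<equiv> pairing_char B L"

lemma L_zero [simp]: "0 \<in> L"
  using subgroup.one_closed[OF L_subgroup] by (simp add: add_grp_def)

lemma L_add [simp, intro]: "x \<in> L \<Longrightarrow> y \<in> L \<Longrightarrow> x + y \<in> L"
  using subgroup.m_closed[OF L_subgroup] by (simp add: add_grp_def)

lemma L_minus [simp, intro]: "x \<in> L \<Longrightarrow> - x \<in> L"
proof -
  assume x: "x \<in> L"
  have "group (add_grp (UNIV :: 'h set))"
    by (rule groupI) (auto simp: add_grp_def add.assoc intro: exI[of _ "- _"] left_minus)
  then have "inv\<^bsub>add_grp UNIV\<^esub> x = - x"
    by (rule group.inv_equality) (simp_all add: add_grp_def)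
  then show ?thesis using subgroup.m_inv_closed[OF L_subgroup x] by simp
qed

lemma L_dual: "L \<subseteq> D"
  using L_int by (auto simp: dual_lattice_def)

lemma dual_add: "x \<in> D \<Longrightarrow> y \<in> D \<Longrightarrow> x + y \<in> D"
  by (auto simp: dual_lattice_def)

lemma perp_dual: "perp B L \<subseteq> D"
  by (auto simp: dual_lattice_def perp_def)

lemma of_int_pc: "x \<in> D \<Longrightarrow> y \<in> L \<Longrightarrow> of_int (pc x y) = B x y"
proof -
  assume x: "x \<in> D" and y: "y \<in> L"
  then obtain n where n: "B x y = of_int n" by (auto simp: dual_lattice_def elim!: Ints_cases)
  then have "(THE n. B x y = of_int n) = n" by (intro the_equality) auto
  then show ?thesis using y n by (simp add: pairing_char_def)
qed

lemma pc_ext: "pc x \<in> extensional L"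
  by (simp add: pairing_char_def)

lemma pc_eqI:
  assumes "x \<in> D" "\<chi> \<in> extensional L" "\<And>y. y \<in> L \<Longrightarrow> B x y = of_int (\<chi> y)"
  shows "pc x = \<chi>"
proof (rule extensionalityI[OF pc_ext assms(2)])
  fix y assume y: "y \<in> L"
  have "(of_int (pc x y) :: complex) = of_int (\<chi> y)" using of_int_pc[OF assms(1) y] assms(3)[OF y] by simp
  then show "pc x y = \<chi> y" by (simp only: of_int_eq_iff)
qed

lemma pc_add:
  assumes "x \<in> D" "y \<in> D"
  shows "(\<lambda>z\<in>L. pc x z + pc y z) = pc (x + y)"
  by (rule pc_eqI[symmetric]) (use assms in \<open>auto simp: dual_add of_int_pc\<close>)

text \<open>This is where \<open>perp B L\<close> enters the grading group: it is the kernel of the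
  passage from dual vectors to characters.\<close>

lemma pc_eq_iff:
  assumes "x \<in> D" "y \<in> D"
  shows "pc x = pc y \<longleftrightarrow> x - y \<in> perp B L"
proof
  assume e: "pc x = pc y"
  have "B x z = B y z" if "z \<in> L" for z
    using of_int_pc[OF assms(1) that] of_int_pc[OF assms(2) that] e by simp
  then show "x - y \<in> perp B L" by (simp add: perp_def)
next
  assume "x - y \<in> perp B L"
  then show "pc x = pc y"
    by (intro pc_eqI) (use assms in \<open>auto simp: pc_ext of_int_pc perp_def\<close>)
qed

lemma pc_character: "x \<in> D \<Longrightarrow> pc x \<in> characters L"
proof -
  assume x: "x \<in> D"
  have "pc x (y + z) = pc x y + pc x z" if "y \<in> L" "z \<in> L" for y z
  proof -
    have "(of_int (pc x (y + z)) :: complex) = of_int (pc x y + pc x z)"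
      using x that by (simp add: of_int_pc)
    then show ?thesis by (simp only: of_int_eq_iff)
  qed
  then show ?thesis
    by (auto simp: characters_def pc_ext hom_def add_grp_def integer_group_def)
qed

text \<open>The factor group is unfolded once; from here on a class is an explicit set of translates
  of a dual vector.\<close>

lemma mem_G_iff:
  "X \<in> carrier G \<longleftrightarrow> (\<exists>x\<in>D. X = {x + l + p | l p. l \<in> L \<and> p \<in> perp B L})"
proof -
  have "{u + v | u v. u \<in> L \<and> v \<in> perp B L} #>\<^bsub>add_grp D\<^esub> x = {x + l + p | l p. l \<in> L \<and> p \<in> perp B L}" for x
    unfolding r_coset_def by (auto simp: add_grp_def add.commute[of _ x] add.assoc)
  then show ?thesis
    unfolding grading_group_def FactGroup_def RCOSETS_def by (auto simp: add_grp_def)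
qed

lemma perp_zero [simp]: "0 \<in> perp B L"
  by (simp add: perp_def)

lemma perp_add: "p \<in> perp B L \<Longrightarrow> q \<in> perp B L \<Longrightarrow> p + q \<in> perp B L"
  by (simp add: perp_def)

text \<open>Used in both directions: a second time with the opposite shifts \<open>- l\<close> and
  \<open>- p\<close>, it shows that every member of a class represents it.\<close>

lemma class_subset:
  assumes "l \<in> L" "p \<in> perp B L"
  shows "{(x + l + p) + l' + p' | l' p'. l' \<in> L \<and> p' \<in> perp B L} \<subseteq>
    {x + l' + p' | l' p'. l' \<in> L \<and> p' \<in> perp B L}"
proof
  fix z assume "z \<in> {(x + l + p) + l' + p' | l' p'. l' \<in> L \<and> p' \<in> perp B L}"
  then obtain l' p' where z: "z = (x + l + p) + l' + p'" "l' \<in> L" "p' \<in> perp B L" by blast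
  have "z = x + (l + l') + (p + p')" unfolding z(1) by (simp add: algebra_simps)
  then show "z \<in> {x + l' + p' | l' p'. l' \<in> L \<and> p' \<in> perp B L}"
    using L_add[OF assms(1) z(2)] perp_add[OF assms(2) z(3)] by blast
qed

lemma G_class_eq:
  assumes "X \<in> carrier G" "x \<in> X"
  shows "X = {x + l + p | l p. l \<in> L \<and> p \<in> perp B L}"
proof -
  obtain x0 where x0: "X = {x0 + l + p | l p. l \<in> L \<and> p \<in> perp B L}" using assms(1) mem_G_iff by blast
  obtain l p where x: "x = x0 + l + p" "l \<in> L" "p \<in> perp B L" using assms(2) unfolding x0 by blast
  have m: "- p \<in> perp B L" using x(3) by (simp add: perp_def)
  have e: "x + - l + - p = x0" unfolding x(1) by simp
  show ?thesis
  proof (rule equalityI)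
    show "{x + l + p | l p. l \<in> L \<and> p \<in> perp B L} \<subseteq> X"
      unfolding x0 unfolding x(1) by (rule class_subset[OF x(2,3)])
    show "X \<subseteq> {x + l + p | l p. l \<in> L \<and> p \<in> perp B L}"
      unfolding x0 using class_subset[OF L_minus[OF x(2)] m, of x] unfolding e .
  qed
qed

lemma G_class_dual: "X \<in> carrier G \<Longrightarrow> X \<subseteq> D"
  unfolding mem_G_iff by (auto intro!: dual_add intro: subsetD[OF L_dual] subsetD[OF perp_dual])

lemma class_self: "x \<in> {x + l + p | l p. l \<in> L \<and> p \<in> perp B L}"
proof -
  have "x = x + 0 + 0" by simp
  then show ?thesis using L_zero perp_zero by blast
qed

lemma G_class_mem:
  assumes "x \<in> D"
  shows "\<exists>X\<in>carrier G. x \<in> X"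
proof
  show "x \<in> {x + l + p | l p. l \<in> L \<and> p \<in> perp B L}" by (rule class_self)
  show "{x + l + p | l p. l \<in> L \<and> p \<in> perp B L} \<in> carrier G"
    unfolding mem_G_iff using assms by (rule bexI[rotated]) (rule refl)
qed

text \<open>Classes absorb \<open>perp B L\<close>, so a character determines its class. Hence the
  parts of a module for different classes involve disjoint sets of weights.\<close>

lemma G_class_disjoint:
  assumes "X \<in> carrier G" "Y \<in> carrier G" "x \<in> X" "y \<in> Y" "pc x = pc y"
  shows "X = Y"
proof -
  have d: "x \<in> D" "y \<in> D"
    using subsetD[OF G_class_dual[OF assms(1)] assms(3)] subsetD[OF G_class_dual[OF assms(2)] assms(4)] .
  then have p: "x - y \<in> perp B L" using assms(5) pc_eq_iff by simp
  have "x = y + 0 + (x - y)" by simp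
  then have "x \<in> Y" using G_class_eq[OF assms(2,4)] p L_zero by blast
  then show ?thesis using G_class_eq[OF assms(1,3)] G_class_eq[OF assms(2)] by simp
qed

lemma G_class_translate: "X \<in> carrier G \<Longrightarrow> x \<in> X \<Longrightarrow> l \<in> L \<Longrightarrow> x + l \<in> X"
proof -
  assume a: "X \<in> carrier G" "x \<in> X" "l \<in> L"
  have "x + l = x + l + 0" by simp
  then show "x + l \<in> X" using G_class_eq[OF a(1,2)] a(3) perp_zero by blast
qed

text \<open>The component in \<open>perp B L\<close> is invisible to \<open>pc\<close>, so lattice
  translations reach every character of the class. This later carries one non-zero weight space to
  all the others.\<close>

lemma pc_class_transitive:
  assumes "X \<in> carrier G" "x \<in> X" "x' \<in> X"
  shows "\<exists>l\<in>L. pc x' = pc (x + l)"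
proof -
  obtain l p where x': "x' = x + l + p" "l \<in> L" "p \<in> perp B L" using G_class_eq[OF assms(1,2)] assms(3) by blast
  have "x + l \<in> D" "x' \<in> D"
    using subsetD[OF G_class_dual[OF assms(1)]] G_class_translate[OF assms(1,2) x'(2)] assms(3) by simp_all
  then have "pc x' = pc (x + l)" using pc_eq_iff[of x' "x + l"] x' by simp
  then show ?thesis using x'(2) by blast
qed

text \<open>Replaces the orbit by the image of the class, the form in which weights are handled from
  here on.\<close>

lemma class_orbit_eq: "X \<in> carrier G \<Longrightarrow> class_orbit B L X = pc ` X"
proof -
  assume X: "X \<in> carrier G"
  have "lattice_orbit B L (pc x) = {pc (x + l) | l. l \<in> L}" if "x \<in> X" for x
  proof -
    have "(\<lambda>y\<in>L. pc l y + pc x y) = pc (x + l)" if "l \<in> L" for l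
      using pc_add[of l x] L_dual G_class_dual[OF X] \<open>x \<in> X\<close> that by (auto simp: add.commute)
    then show ?thesis unfolding lattice_orbit_def Setcompr_eq_image by (intro image_cong) simp_all
  qed
  then have "class_orbit B L X = (\<Union>x\<in>X. {pc (x + l) | l. l \<in> L})"
    unfolding class_orbit_def by simp
  also have "\<dots> = pc ` X"
  proof (intro equalityI subsetI)
    fix \<chi> assume "\<chi> \<in> pc ` X"
    then obtain x where "x \<in> X" "\<chi> = pc (x + 0)" by auto
    then show "\<chi> \<in> (\<Union>x\<in>X. {pc (x + l) | l. l \<in> L})" using L_zero by blast
  qed (use G_class_translate[OF X] in blast)
  finally show ?thesis .
qed

lemma G_mult_mem:
  assumes "X \<in> carrier G" "Y \<in> carrier G"
  shows "X \<otimes>\<^bsub>G\<^esub> Y \<in> carrier G" "x \<in> X \<Longrightarrow> y \<in> Y \<Longrightarrow> x + y \<in> X \<otimes>\<^bsub>G\<^esub> Y"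
proof -
  have m: "X \<otimes>\<^bsub>G\<^esub> Y = {x + y | x y. x \<in> X \<and> y \<in> Y}"
    by (auto simp: grading_group_def FactGroup_def set_mult_def add_grp_def)
  then show "x \<in> X \<Longrightarrow> y \<in> Y \<Longrightarrow> x + y \<in> X \<otimes>\<^bsub>G\<^esub> Y" by blast
  obtain x y where x: "x \<in> D" "X = {x + l + p | l p. l \<in> L \<and> p \<in> perp B L}"
    and y: "y \<in> D" "Y = {y + l + p | l p. l \<in> L \<and> p \<in> perp B L}"
    using assms unfolding mem_G_iff by blast
  have "X \<otimes>\<^bsub>G\<^esub> Y = {(x + y) + l + p | l p. l \<in> L \<and> p \<in> perp B L}"
  proof (intro equalityI subsetI)
    fix z assume "z \<in> X \<otimes>\<^bsub>G\<^esub> Y"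
    then obtain u v where z: "z = u + v" and u: "u \<in> X" and v: "v \<in> Y" unfolding m by blast
    obtain l p where u: "u = x + l + p" "l \<in> L" "p \<in> perp B L" using u unfolding x(2) by blast
    obtain l' p' where v: "v = y + l' + p'" "l' \<in> L" "p' \<in> perp B L" using v unfolding y(2) by blast
    have "z = (x + y) + (l + l') + (p + p')" unfolding z u v by (simp add: algebra_simps)
    then show "z \<in> {(x + y) + l + p | l p. l \<in> L \<and> p \<in> perp B L}"
      using L_add[OF u(2) v(2)] perp_add[OF u(3) v(3)] by blast
  next
    fix z assume "z \<in> {(x + y) + l + p | l p. l \<in> L \<and> p \<in> perp B L}"
    then obtain l p where z: "z = (x + y) + l + p" and l: "l \<in> L" "p \<in> perp B L" by blast
    have "z = (x + l + p) + y" unfolding z by (simp add: algebra_simps)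
    moreover have "x + l + p \<in> X" unfolding x(2) using l by blast
    moreover have "y \<in> Y" unfolding y(2) by (rule class_self)
    ultimately show "z \<in> X \<otimes>\<^bsub>G\<^esub> Y" unfolding m by blast
  qed
  then show "X \<otimes>\<^bsub>G\<^esub> Y \<in> carrier G" unfolding mem_G_iff using dual_add[OF x(1) y(1)]
    by (intro bexI[of _ "x + y"])
qed

end

section \<open>Spanning sets, and exponentials of operators with spanning eigenvectors\<close>

section \<open>Generating sets\<close>

text \<open>Weight vectors and pure tensors span without being chosen as a basis; properties are
  checked on them and extended by linearity, with no independence involved.\<close>

definition generates :: "(complex, 'v, 'z) module_scheme \<Rightarrow> 'v set \<Rightarrow> bool" where
  "generates V S \<longleftrightarrow> S \<subseteq> carrier V \<and> carrier V \<subseteq> lin_span V S"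

lemma generates_induct [consumes 2, case_names vector zero base add smult]:
  assumes "generates V S" "v \<in> carrier V"
    and V: "vector_sp V"
    and z: "P \<zero>\<^bsub>V\<^esub>" and b: "\<And>s. s \<in> S \<Longrightarrow> P s"
    and a: "\<And>v w. v \<in> carrier V \<Longrightarrow> w \<in> carrier V \<Longrightarrow> P v \<Longrightarrow> P w \<Longrightarrow> P (v \<oplus>\<^bsub>V\<^esub> w)"
    and s: "\<And>c v. v \<in> carrier V \<Longrightarrow> P v \<Longrightarrow> P (c \<odot>\<^bsub>V\<^esub> v)"
  shows "P v"
proof -
  interpret vector_sp V by fact
  have "submodule {v \<in> carrier V. P v} cfield V"
    by (rule subspaceI) (use z a s in auto)
  moreover have "S \<subseteq> {v \<in> carrier V. P v}" using assms(1) b by (auto simp: generates_def)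
  ultimately have "lin_span V S \<subseteq> {v \<in> carrier V. P v}" by (rule span_minimal)
  then show ?thesis using assms(1,2) by (auto simp: generates_def)
qed

lemma generates_mem: "generates V S \<Longrightarrow> s \<in> S \<Longrightarrow> s \<in> carrier V"
  by (auto simp: generates_def)

lemma generates_subspace:
  assumes "vector_sp V" "generates V S" "submodule W cfield V" "S \<subseteq> W"
  shows "carrier V \<subseteq> W"
  using vector_sp.span_minimal[OF assms(1,3,4)] assms(2) by (auto simp: generates_def)

lemma generatesI:
  assumes "vector_sp V" "S \<subseteq> carrier V" "\<And>W. submodule W cfield V \<Longrightarrow> S \<subseteq> W \<Longrightarrow> carrier V \<subseteq> W"
  shows "generates V S"
  unfolding generates_def
  using assms(2) assms(3)[OF vector_sp.subspace_span[OF assms(1,2)] vector_sp.span_superset[OF assms(1)]]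
  by simp

lemma generates_linear_eq:
  assumes "vector_sp V" "vector_sp W" "generates V S" "is_linear V W f" "is_linear V W g"
    "\<And>s. s \<in> S \<Longrightarrow> f s = g s" "v \<in> carrier V"
  shows "f v = g v"
  using assms(3,7)
proof (induction rule: generates_induct)
  case zero
  then show ?case using is_linear_zero[OF assms(1,2,4)] is_linear_zero[OF assms(1,2,5)] by simp
qed (simp_all add: assms(1,6) is_linearD[OF assms(4)] is_linearD[OF assms(5)])

lemma generates_linear_mem:
  assumes "vector_sp V" "vector_sp W" "generates V S" "is_linear V W f" "submodule Q cfield W"
    "\<And>s. s \<in> S \<Longrightarrow> f s \<in> Q" "v \<in> carrier V"
  shows "f v \<in> Q"
  using assms(3,7)
proof (induction rule: generates_induct)
  case zero
  then show ?case using is_linear_zero[OF assms(1,2,4)] vector_sp.subspaceD[OF assms(2,5)] by simp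
qed (simp_all add: assms(1,6) is_linearD[OF assms(4)] vector_sp.subspaceD[OF assms(2,5)])

lemma generates_image:
  assumes "vector_sp V" "vector_sp W" "generates V S" "is_linear V W f" "f ` carrier V = carrier W"
  shows "generates W (f ` S)"
proof (rule generatesI[OF assms(2)])
  show "f ` S \<subseteq> carrier W" using assms(3,5) by (auto simp: generates_def)
  fix Q assume Q: "submodule Q cfield W" "f ` S \<subseteq> Q"
  have "f v \<in> Q" if "v \<in> carrier V" for v
    by (rule generates_linear_mem[OF assms(1,2,3,4) Q(1) _ that]) (use Q(2) in auto)
  then show "carrier W \<subseteq> Q" unfolding assms(5)[symmetric] by auto
qed

lemma generates_mono:
  assumes "vector_sp V" "generates V S" "T \<subseteq> carrier V" "\<And>s. s \<in> S \<Longrightarrow> s \<in> lin_span V T"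
  shows "generates V T"
  unfolding generates_def
  using assms(3) generates_subspace[OF assms(1,2) vector_sp.subspace_span[OF assms(1,3)]] assms(4) by auto

text \<open>Linearity in the first factor, with a generator of \<open>N\<close> held fixed, comes
  before linearity in the second.\<close>

lemma (in tensor_pair) generates_tensor:
  assumes "generates M S" "generates N T"
  shows "generates (tensor_space M N) {tens M N s t | s t. s \<in> S \<and> t \<in> T}"
proof (rule generatesI[OF tensor_vector_sp])
  show "{tens M N s t | s t. s \<in> S \<and> t \<in> T} \<subseteq> carrier (tensor_space M N)"
    using assms by (auto dest: generates_mem)
  fix Q assume Q: "submodule Q cfield (tensor_space M N)" "{tens M N s t | s t. s \<in> S \<and> t \<in> T} \<subseteq> Q"
  have 1: "tens M N m t \<in> Q" if "m \<in> carrier M" "t \<in> T" for m t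
    by (rule generates_linear_mem[OF M.vector_sp_axioms tensor_vector_sp assms(1)
          is_bilinearD(1)[OF tens_bilinear generates_mem[OF assms(2) that(2)]] Q(1) _ that(1)])
      (use Q(2) that in blast)
  have 2: "tens M N m n \<in> Q" if "m \<in> carrier M" "n \<in> carrier N" for m n
    by (rule generates_linear_mem[OF N.vector_sp_axioms tensor_vector_sp assms(2)
          is_bilinearD(2)[OF tens_bilinear that(1)] Q(1) _ that(2)])
      (use 1 that in blast)
  show "carrier (tensor_space M N) \<subseteq> Q"
  proof
    fix t assume "t \<in> carrier (tensor_space M N)"
    then show "t \<in> Q"
      by (induction rule: tensor_induct) (simp_all add: 2 vector_sp.subspaceD[OF tensor_vector_sp Q(1)])
  qed
qed

text \<open>The definite description in \<open>lf_exp\<close> denotes at a vector only if some value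
  exists there. Eigenvectors have one, and so do sums and multiples of vectors that have one, so
  spanning eigenvectors suffice.\<close>

lemma (in vector_sp) has_exp_generates:
  assumes T: "is_linear V V T" and g: "generates V S" and e: "\<And>s. s \<in> S \<Longrightarrow> \<exists>l. T s = l \<odot> s"
    and v: "v \<in> carrier V"
  shows "has_exp V T v (lf_exp V T v)"
proof -
  have "\<exists>w. has_exp V T v w" using g v
  proof (induction rule: generates_induct)
    case vector show ?case by (rule vector_sp_axioms)
  next
    case zero
    have "T \<zero> = 0 \<odot> \<zero>" using is_linear_zero[OF vector_sp_axioms vector_sp_axioms T] by simp
    then show ?case using has_exp_eigen[OF T zero_closed] by blast
  next
    case (base s)
    then show ?case using e[OF base] has_exp_eigen[OF T generates_mem[OF g base]] by blast
  next
    case (add v w) then show ?case using has_exp_add[OF T] by blast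
  next
    case (smult c v) then show ?case using has_exp_smult[OF T] by blast
  qed
  then show ?thesis using lf_exp_eqI by metis
qed

text \<open>The sum of two values is a value at the sum, and values are unique; likewise for
  multiples.\<close>

lemma (in vector_sp) lf_exp_linear:
  assumes T: "is_linear V V T" and g: "generates V S" and e: "\<And>s. s \<in> S \<Longrightarrow> \<exists>l. T s = l \<odot> s"
  shows "is_linear V V (lf_exp V T)"
proof (rule is_linearI)
  have h: "has_exp V T v (lf_exp V T v)" if "v \<in> carrier V" for v
    by (rule has_exp_generates[OF T g _ that]) (rule e)
  fix v assume v: "v \<in> carrier V"
  show "lf_exp V T v \<in> carrier V" by (rule has_exp_closed[OF h[OF v]])
  show "lf_exp V T (v \<oplus> w) = lf_exp V T v \<oplus> lf_exp V T w" if w: "w \<in> carrier V" for w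
    by (rule lf_exp_eqI[OF has_exp_add[OF T v w h[OF v] h[OF w]]])
  show "lf_exp V T (c \<odot> v) = c \<odot> lf_exp V T v" for c
    by (rule lf_exp_eqI[OF has_exp_smult[OF T v h[OF v]]])
qed

lemma (in vector_sp) lf_exp_eigen:
  "is_linear V V T \<Longrightarrow> v \<in> carrier V \<Longrightarrow> T v = l \<odot> v \<Longrightarrow> lf_exp V T v = exp l \<odot> v"
  by (rule lf_exp_eqI[OF has_exp_eigen])

section \<open>Modules over the abelian Lie algebra, and transfer between records\<close>

section \<open>Modules\<close>

text \<open>\<open>tensor M N\<close> and \<open>tensor_space M N\<close> are different records with
  the same linear structure, as are \<open>tensor_over\<close> and the quotient inside it. This
  rule, \<open>killed_cong\<close> and \<open>submodule_cong\<close> move facts between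
  them.\<close>

lemma vector_sp_cong:
  assumes "vector_sp V" "carrier W = carrier V" "\<zero>\<^bsub>W\<^esub> = \<zero>\<^bsub>V\<^esub>"
    "\<And>x y. x \<oplus>\<^bsub>W\<^esub> y = x \<oplus>\<^bsub>V\<^esub> y" "\<And>c x. c \<odot>\<^bsub>W\<^esub> x = c \<odot>\<^bsub>V\<^esub> x"
  shows "vector_sp W"
proof -
  interpret vector_sp V by fact
  show ?thesis
    by (rule vector_spI) (simp_all add: assms a_ac smult_add_left smult_add_right)
qed

lemma hmodule_iff:
  "hmodule sc V \<longleftrightarrow> vector_sp V \<and> (\<forall>x. is_linear V V (act V x)) \<and>
     (\<forall>x y. \<forall>v\<in>carrier V. act V (x + y) v = act V x v \<oplus>\<^bsub>V\<^esub> act V y v) \<and>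
     (\<forall>c x. \<forall>v\<in>carrier V. act V (sc c x) v = c \<odot>\<^bsub>V\<^esub> act V x v) \<and>
     (\<forall>x y. \<forall>v\<in>carrier V. act V x (act V y v) = act V y (act V x v))"
  unfolding hmodule_def vector_sp_def is_linear_def by (intro iffI; elim conjE; simp)

lemma locally_finite_iff:
  assumes "hmodule sc V"
  shows "locally_finite V \<longleftrightarrow> (\<forall>x. \<forall>v\<in>carrier V. \<exists>ls. killed V (act V x) ls v)"
proof -
  have V: "vector_sp V" and l: "\<And>x. is_linear V V (act V x)" using assms by (simp_all add: hmodule_iff)
  show ?thesis
    unfolding locally_finite_def by (simp add: vector_sp.locally_finite_iff_killed[OF V l])
qed

lemma amodule_iff:
  "amodule sc A M \<longleftrightarrow> hmodule sc M \<and> locally_finite M \<and> is_bilinear A M M (lact M) \<and>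
     (\<forall>x. \<forall>a\<in>carrier A. \<forall>m\<in>carrier M.
        act M x (lact M a m) = lact M (act A x a) m \<oplus>\<^bsub>M\<^esub> lact M a (act M x m)) \<and>
     (\<forall>a\<in>carrier A. \<forall>b\<in>carrier A. \<forall>m\<in>carrier M.
        lact M (a \<otimes>\<^bsub>A\<^esub> b) m = lact M a (lact M b m)) \<and>
     (\<forall>m\<in>carrier M. lact M \<one>\<^bsub>A\<^esub> m = m)"
  unfolding amodule_def is_bilinear_def is_linear_def by (intro iffI; elim conjE; simp)

lemma hmodule_sum:
  assumes "hmodule sc V" "v \<in> carrier V" "finite I"
    "\<And>x y c. sc c (x + y) = sc c x + sc c y" "sc 0 0 = 0"
  shows "act V (\<Sum>i\<in>I. f i) v = (\<Oplus>\<^bsub>V\<^esub>i\<in>I. act V (f i) v)"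
proof -
  interpret vector_sp V using assms(1) by (simp add: hmodule_iff)
  have cl: "act V x v \<in> carrier V" for x
    using assms(1,2) by (simp add: hmodule_iff is_linear_def)
  have "act V (sc 0 0) v = 0 \<odot>\<^bsub>V\<^esub> act V 0 v" using assms(1,2) by (simp add: hmodule_iff)
  then have z: "act V 0 v = \<zero>\<^bsub>V\<^esub>" using cl assms(5) by simp
  show ?thesis using assms(3)
  proof (induction I)
    case (insert i I)
    have "act V (f i + (\<Sum>i\<in>I. f i)) v = act V (f i) v \<oplus>\<^bsub>V\<^esub> act V (\<Sum>i\<in>I. f i) v"
      using assms(1,2) by (simp add: hmodule_iff)
    then show ?case using insert cl by simp
  qed (simp add: z)
qed

lemma tensor_simps [simp]:
  "carrier (tensor M N) = carrier (tensor_space M N)"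
  "\<zero>\<^bsub>tensor M N\<^esub> = \<zero>\<^bsub>tensor_space M N\<^esub>"
  "x \<oplus>\<^bsub>tensor M N\<^esub> y = x \<oplus>\<^bsub>tensor_space M N\<^esub> y"
  "c \<odot>\<^bsub>tensor M N\<^esub> x = c \<odot>\<^bsub>tensor_space M N\<^esub> x"
  "act (tensor M N) = (\<lambda>x. tensor_lift M N (tensor_space M N)
       (\<lambda>m n. tens M N (act M x m) n \<oplus>\<^bsub>tensor_space M N\<^esub> tens M N m (act N x n)))"
  by (simp_all add: tensor_def module.defs hmod.defs)

lemma is_linear_from_tensor [simp]: "is_linear (tensor M N) P f \<longleftrightarrow> is_linear (tensor_space M N) P f"
  by (simp add: is_linear_def)

lemma is_linear_to_tensor [simp]: "is_linear P (tensor M N) f \<longleftrightarrow> is_linear P (tensor_space M N) f"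
  by (simp add: is_linear_def)

lemma killed_cong:
  assumes "\<zero>\<^bsub>W\<^esub> = \<zero>\<^bsub>V\<^esub>"
    "\<And>x y. x \<oplus>\<^bsub>W\<^esub> y = x \<oplus>\<^bsub>V\<^esub> y" "\<And>c x. c \<odot>\<^bsub>W\<^esub> x = c \<odot>\<^bsub>V\<^esub> x"
  shows "killed W T ls v \<longleftrightarrow> killed V T ls v"
  by (induction ls arbitrary: v) (simp_all add: assms)

lemma submodule_cong:
  assumes "vector_sp V" "vector_sp W" "carrier W = carrier V" "\<zero>\<^bsub>W\<^esub> = \<zero>\<^bsub>V\<^esub>"
    "\<And>x y. x \<oplus>\<^bsub>W\<^esub> y = x \<oplus>\<^bsub>V\<^esub> y" "\<And>c x. c \<odot>\<^bsub>W\<^esub> x = c \<odot>\<^bsub>V\<^esub> x"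
  shows "submodule Q cfield W \<longleftrightarrow> submodule Q cfield V"
proof
  note V = vector_sp.subspaceD[OF assms(1)] and W = vector_sp.subspaceD[OF assms(2)]
  show "submodule Q cfield V" if "submodule Q cfield W"
    by (rule vector_sp.subspaceI[OF assms(1)]) (use W[OF that] in \<open>auto simp: assms\<close>)
  show "submodule Q cfield W" if "submodule Q cfield V"
    by (rule vector_sp.subspaceI[OF assms(2)]) (use V[OF that] in \<open>auto simp: assms\<close>)
qed

text \<open>The construction reads only carrier, addition and scalar multiplication, on which the
  two records agree, so either may stand inside it.\<close>

lemma tensor_space_tensor [simp]:
  "tensor_space (tensor M N) P = tensor_space (tensor_space M N) P"
  "tensor_space P (tensor M N) = tensor_space P (tensor_space M N)"
  by (simp_all add: tensor_space_def tensor_kernel_def tensor_relations_def)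

lemma tens_tensor [simp]:
  "tens (tensor M N) P = tens (tensor_space M N) P"
  "tens P (tensor M N) = tens P (tensor_space M N)"
  by (simp_all add: tens_def tensor_kernel_def tensor_relations_def fun_eq_iff)

section \<open>Tensor products of locally finite modules\<close>

locale hmodule_pair =
  fixes sc :: "complex \<Rightarrow> 'h::ab_group_add \<Rightarrow> 'h"
    and M :: "('h, 'm, 'y) hmod_scheme" and N :: "('h, 'n, 'z) hmod_scheme"
  assumes M: "hmodule sc M" and N: "hmodule sc N"

sublocale hmodule_pair \<subseteq> tensor_pair M N
  using M N by (intro tensor_pair.intro) (simp_all add: hmodule_iff)

context hmodule_pair
begin

lemma act_linear: "is_linear M M (act M x)" "is_linear N N (act N x)"
  using M N by (simp_all add: hmodule_iff)

lemma tensor_act_bilinear: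
  "is_bilinear M N (tensor_space M N)
    (\<lambda>m n. tens M N (act M x m) n \<oplus>\<^bsub>tensor_space M N\<^esub> tens M N m (act N x n))"
  by (intro is_bilinear_add tensor_vector_sp is_bilinear_comp2[OF tens_bilinear]
      act_linear is_linear_id)

lemma tensor_act_linear: "is_linear (tensor_space M N) (tensor_space M N) (act (tensor M N) x)"
  using tensor_lift_linear[OF tensor_vector_sp tensor_act_bilinear] by simp

lemma tensor_act_tens:
  "m \<in> carrier M \<Longrightarrow> n \<in> carrier N \<Longrightarrow> act (tensor M N) x (tens M N m n) =
    tens M N (act M x m) n \<oplus>\<^bsub>tensor_space M N\<^esub> tens M N m (act N x n)"
  using tensor_lift_tens[OF tensor_vector_sp tensor_act_bilinear] by simp

lemma tensor_hmodule: "hmodule sc (tensor M N)"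
proof -
  interpret T: vector_sp "tensor_space M N" by (rule tensor_vector_sp)
  have Mp: "act M (x + y) m = act M x m \<oplus>\<^bsub>M\<^esub> act M y m" "act M (sc c x) m = c \<odot>\<^bsub>M\<^esub> act M x m"
    "act M x (act M y m) = act M y (act M x m)" if "m \<in> carrier M" for x y c m
    using M that by (auto simp: hmodule_iff)
  have Np: "act N (x + y) m = act N x m \<oplus>\<^bsub>N\<^esub> act N y m" "act N (sc c x) m = c \<odot>\<^bsub>N\<^esub> act N x m"
    "act N x (act N y m) = act N y (act N x m)" if "m \<in> carrier N" for x y c m
    using N that by (auto simp: hmodule_iff)
  note Ml = is_linearD[OF act_linear(1)] and Nl = is_linearD[OF act_linear(2)]
  note lin = tensor_act_linear is_linear_add[OF tensor_vector_sp] is_linear_smult[OF tensor_vector_sp]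
    is_linear_comp[OF tensor_act_linear tensor_act_linear]
  have "act (tensor M N) (x + y) t = act (tensor M N) x t \<oplus>\<^bsub>tensor_space M N\<^esub> act (tensor M N) y t"
    if "t \<in> carrier (tensor_space M N)" for x y t
    by (rule tensor_linear_eqI[OF tensor_vector_sp _ _ _ that])
      (auto intro!: lin simp: tensor_act_tens Mp Np Ml Nl tens_add_left tens_add_right T.a_ac simp del: tensor_simps)
  moreover have "act (tensor M N) (sc c x) t = c \<odot>\<^bsub>tensor_space M N\<^esub> act (tensor M N) x t"
    if "t \<in> carrier (tensor_space M N)" for x c t
    by (rule tensor_linear_eqI[OF tensor_vector_sp _ _ _ that])
      (auto intro!: lin simp: tensor_act_tens Mp Np Ml Nl tens_smult_left tens_smult_right
        T.smult_add_right simp del: tensor_simps)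
  moreover have "act (tensor M N) x (act (tensor M N) y t) = act (tensor M N) y (act (tensor M N) x t)"
    if "t \<in> carrier (tensor_space M N)" for x y t
    by (rule tensor_linear_eqI[OF tensor_vector_sp _ _ _ that])
      (auto intro!: lin simp: tensor_act_tens is_linearD[OF tensor_act_linear] Mp(3)[of _ x y] Np(3)[of _ x y]
        Ml Nl T.a_ac simp del: tensor_simps)
  moreover have "vector_sp (tensor M N)"
    by (rule vector_sp_cong[OF tensor_vector_sp]) simp_all
  ultimately show ?thesis
    unfolding hmodule_iff using tensor_act_linear by (simp del: tensor_simps(5))
qed

text \<open>If \<open>m\<close> and \<open>n\<close> are killed by products of \<open>x - l\<^sub>i\<close> and \<open>x - k\<^sub>j\<close>, then
  \<open>(x - l\<^sub>1 - k\<^sub>1) (m \<otimes> n)\<close> is a sum of two tensors with one shorter product each.\<close>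

lemma tensor_killed:
  "m \<in> carrier M \<Longrightarrow> n \<in> carrier N \<Longrightarrow> killed M (act M x) ls m \<Longrightarrow> killed N (act N x) ks n \<Longrightarrow>
    \<exists>js. killed (tensor_space M N) (act (tensor M N) x) js (tens M N m n)"
proof (induction "length ls + length ks" arbitrary: ls ks m n rule: less_induct)
  case less
  interpret T: vector_sp "tensor_space M N" by (rule tensor_vector_sp)
  note Ml = is_linearD[OF act_linear(1)] and Nl = is_linearD[OF act_linear(2)]
  note Tl = tensor_act_linear[of x]
  show ?case
  proof (cases "ls = [] \<or> ks = []")
    case True
    then have "tens M N m n = \<zero>\<^bsub>tensor_space M N\<^esub>"
      using less.prems tens_zero_left tens_zero_right by auto
    then have "killed (tensor_space M N) (act (tensor M N) x) [] (tens M N m n)" by simp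
    then show ?thesis by blast
  next
    case False
    then obtain l ls' k ks' where c: "ls = l # ls'" "ks = k # ks'" by (meson neq_Nil_conv)
    let ?m = "act M x m \<oplus>\<^bsub>M\<^esub> (- l) \<odot>\<^bsub>M\<^esub> m" and ?n = "act N x n \<oplus>\<^bsub>N\<^esub> (- k) \<odot>\<^bsub>N\<^esub> n"
    have cl: "?m \<in> carrier M" "?n \<in> carrier N" using less.prems Ml Nl by simp_all
    obtain js1 where 1: "killed (tensor_space M N) (act (tensor M N) x) js1 (tens M N ?m n)"
      using less.hyps[of ls' ks ?m n] less.prems cl c by auto
    obtain js2 where 2: "killed (tensor_space M N) (act (tensor M N) x) js2 (tens M N m ?n)"
      using less.hyps[of ls ks' m ?n] less.prems cl c by auto
    have "killed (tensor_space M N) (act (tensor M N) x) (js1 @ js2)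
        (tens M N ?m n \<oplus>\<^bsub>tensor_space M N\<^esub> tens M N m ?n)"
      using T.killed_add[OF Tl _ _ T.killed_append1[OF Tl _ 1] T.killed_append2[OF Tl _ 2]] cl less.prems by simp
    moreover have "tens M N ?m n \<oplus>\<^bsub>tensor_space M N\<^esub> tens M N m ?n =
        act (tensor M N) x (tens M N m n) \<oplus>\<^bsub>tensor_space M N\<^esub> (- (l + k)) \<odot>\<^bsub>tensor_space M N\<^esub> tens M N m n"
    proof -
      have "(- (l + k)) \<odot>\<^bsub>tensor_space M N\<^esub> tens M N m n =
          (- l) \<odot>\<^bsub>tensor_space M N\<^esub> tens M N m n \<oplus>\<^bsub>tensor_space M N\<^esub> (- k) \<odot>\<^bsub>tensor_space M N\<^esub> tens M N m n"
        using less.prems T.smult_add_left[of "tens M N m n" "- l" "- k"] by simp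
      then show ?thesis
        using less.prems Ml Nl
        by (simp add: tensor_act_tens tens_add_left tens_add_right tens_smult_left tens_smult_right T.a_ac
            del: tensor_simps)
    qed
    ultimately have "killed (tensor_space M N) (act (tensor M N) x) ((l + k) # (js1 @ js2)) (tens M N m n)"
      by simp
    then show ?thesis by blast
  qed
qed

text \<open>For each \<open>x\<close> the vectors killed by some list form a subspace, and
  \<open>tensor_killed\<close> puts all pure tensors into it.\<close>

lemma tensor_locally_finite:
  assumes "locally_finite M" "locally_finite N"
  shows "locally_finite (tensor M N)"
  unfolding locally_finite_iff[OF tensor_hmodule]
proof (intro allI ballI)
  fix x t
  note S = vector_sp.killed_subspace[OF tensor_vector_sp tensor_act_linear[of x]]
  assume "t \<in> carrier (tensor M N)"
  then have "t \<in> carrier (tensor_space M N)" by simp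
  then have "t \<in> {t \<in> carrier (tensor_space M N). \<exists>ls. killed (tensor_space M N) (act (tensor M N) x) ls t}"
  proof (induction rule: tensor_induct)
    case (tens m n)
    obtain ls ks where "killed M (act M x) ls m" "killed N (act N x) ks n"
      using assms tens locally_finite_iff[OF M] locally_finite_iff[OF N] by blast
    then show ?case using tensor_killed[OF tens] tens_closed[OF tens] by blast
  next
    case (add s t) then show ?case using vector_sp.subspaceD(3)[OF tensor_vector_sp S] by blast
  qed
  then show "\<exists>ls. killed (tensor M N) (act (tensor M N) x) ls t"
    using killed_cong[of "tensor M N" "tensor_space M N"] by simp
qed

end

section \<open>The lattice algebra and the invertibility of its basis vectors\<close>

section \<open>The lattice algebra and the Casimir element\<close>

lemma is_bilinear_finsum:
  assumes "vector_sp P" "finite I" "\<And>i. i \<in> I \<Longrightarrow> is_bilinear M N P (\<beta> i)"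
  shows "is_bilinear M N P (\<lambda>m n. \<Oplus>\<^bsub>P\<^esub>i\<in>I. \<beta> i m n)"
proof -
  interpret P: vector_sp P by fact
  note l = is_linearD[OF is_bilinearD(1)[OF assms(3)]] and r = is_linearD[OF is_bilinearD(2)[OF assms(3)]]
  have split: "(\<Oplus>\<^bsub>P\<^esub>i\<in>I. F i) = (\<Oplus>\<^bsub>P\<^esub>i\<in>I. G i) \<oplus>\<^bsub>P\<^esub> (\<Oplus>\<^bsub>P\<^esub>i\<in>I. H i)"
    if "\<And>i. i \<in> I \<Longrightarrow> G i \<in> carrier P" "\<And>i. i \<in> I \<Longrightarrow> H i \<in> carrier P"
      "\<And>i. i \<in> I \<Longrightarrow> F i = G i \<oplus>\<^bsub>P\<^esub> H i" for F G H
  proof -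
    have "(\<Oplus>\<^bsub>P\<^esub>i\<in>I. F i) = (\<Oplus>\<^bsub>P\<^esub>i\<in>I. G i \<oplus>\<^bsub>P\<^esub> H i)" by (rule P.finsum_cong') (use that in auto)
    also have "\<dots> = (\<Oplus>\<^bsub>P\<^esub>i\<in>I. G i) \<oplus>\<^bsub>P\<^esub> (\<Oplus>\<^bsub>P\<^esub>i\<in>I. H i)" by (rule P.finsum_addf) (use that in auto)
    finally show ?thesis .
  qed
  show ?thesis
  proof (rule is_bilinearI)
    fix m m' n n' c assume m: "m \<in> carrier M" and n: "n \<in> carrier N"
    show "(\<Oplus>\<^bsub>P\<^esub>i\<in>I. \<beta> i m n) \<in> carrier P"
      by (rule P.finsum_closed) (use l(1) m n in auto)
    show "(\<Oplus>\<^bsub>P\<^esub>i\<in>I. \<beta> i (c \<odot>\<^bsub>M\<^esub> m) n) = c \<odot>\<^bsub>P\<^esub> (\<Oplus>\<^bsub>P\<^esub>i\<in>I. \<beta> i m n)"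
      by (subst P.finsum_smult[OF assms(2)]) (use l m n in \<open>auto intro!: P.finsum_cong'\<close>)
    show "(\<Oplus>\<^bsub>P\<^esub>i\<in>I. \<beta> i m (c \<odot>\<^bsub>N\<^esub> n)) = c \<odot>\<^bsub>P\<^esub> (\<Oplus>\<^bsub>P\<^esub>i\<in>I. \<beta> i m n)"
      by (subst P.finsum_smult[OF assms(2)]) (use r m n in \<open>auto intro!: P.finsum_cong'\<close>)
    show "(\<Oplus>\<^bsub>P\<^esub>i\<in>I. \<beta> i (m \<oplus>\<^bsub>M\<^esub> m') n) = (\<Oplus>\<^bsub>P\<^esub>i\<in>I. \<beta> i m n) \<oplus>\<^bsub>P\<^esub> (\<Oplus>\<^bsub>P\<^esub>i\<in>I. \<beta> i m' n)"
      if "m' \<in> carrier M"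
      by (rule split) (use l m n that in auto)
    show "(\<Oplus>\<^bsub>P\<^esub>i\<in>I. \<beta> i m (n \<oplus>\<^bsub>N\<^esub> n')) = (\<Oplus>\<^bsub>P\<^esub>i\<in>I. \<beta> i m n) \<oplus>\<^bsub>P\<^esub> (\<Oplus>\<^bsub>P\<^esub>i\<in>I. \<beta> i m n')"
      if "n' \<in> carrier N"
      by (rule split) (use r m n that in auto)
  qed
qed

context even_lattice
begin

abbreviation A where "A \<equiv> lattice_algebra B L \<alpha>"
abbreviation e :: "'h \<Rightarrow> 'h \<Rightarrow>\<^sub>0 complex" where "e y \<equiv> Poly_Mapping.single y 1"

lemma A_simps [simp]:
  "carrier A = {p. Poly_Mapping.keys p \<subseteq> L}" "\<zero>\<^bsub>A\<^esub> = 0" "p \<oplus>\<^bsub>A\<^esub> q = p + q"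
  "c \<odot>\<^bsub>A\<^esub> p = Poly_Mapping.map ((*) c) p" "\<one>\<^bsub>A\<^esub> = e 0"
  by (simp_all add: lattice_algebra_def)

lemma A_vector_sp: "vector_sp A"
  by (rule free_like_vector_sp) simp_all

lemma e_closed: "y \<in> L \<Longrightarrow> e y \<in> carrier A"
  by simp

lemma A_generates: "generates A (e ` L)"
proof (rule generatesI[OF A_vector_sp])
  fix W assume W: "submodule W cfield A" "e ` L \<subseteq> W"
  note D = vector_sp.subspaceD[OF A_vector_sp W(1)]
  show "carrier A \<subseteq> W"
  proof
    fix p assume "p \<in> carrier A"
    then have "Poly_Mapping.keys p \<subseteq> L" by simp
    then show "p \<in> W"
    proof (rule free_induct)
      fix y c assume "y \<in> L"
      then show "Poly_Mapping.single y c \<in> W" using D(4)[of "e y" c] W(2) by auto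
    qed (use D(2,3) in simp_all)
  qed
qed auto

lemma A_mult_e: "e x \<otimes>\<^bsub>A\<^esub> e y = \<alpha> x y \<odot>\<^bsub>A\<^esub> e (x + y)"
  by (simp add: lattice_algebra_def)

lemma lookup_A_act: "Poly_Mapping.lookup (act A z p) x = B x z * Poly_Mapping.lookup p x"
  by (simp add: lattice_algebra_def lookup_sum lookup_single when_def in_keys_iff)

lemma A_act_linear: "is_linear A A (act A z)"
proof (rule is_linearI)
  fix p q c assume p: "p \<in> carrier A"
  show "act A z p \<in> carrier A"
    using p by (auto simp: in_keys_iff lookup_A_act)
  show "act A z (p \<oplus>\<^bsub>A\<^esub> q) = act A z p \<oplus>\<^bsub>A\<^esub> act A z q"
    by (rule poly_mapping_eqI) (simp add: lookup_A_act lookup_add distrib_left)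
  show "act A z (c \<odot>\<^bsub>A\<^esub> p) = c \<odot>\<^bsub>A\<^esub> act A z p"
    by (rule poly_mapping_eqI) (simp add: lookup_A_act)
qed

lemma A_act_e: "act A z (e x) = B x z \<odot>\<^bsub>A\<^esub> e x"
  by (rule poly_mapping_eqI) (simp add: lookup_A_act lookup_single when_def)

lemma A_mult_closed:
  assumes "p \<in> carrier A" "q \<in> carrier A"
  shows "p \<otimes>\<^bsub>A\<^esub> q \<in> carrier A"
proof -
  have "Poly_Mapping.keys (p \<otimes>\<^bsub>A\<^esub> q) \<subseteq> (\<Union>x\<in>Poly_Mapping.keys p. \<Union>y\<in>Poly_Mapping.keys q.
      Poly_Mapping.keys (Poly_Mapping.single (x + y) (Poly_Mapping.lookup p x * Poly_Mapping.lookup q y * \<alpha> x y)))"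
    unfolding lattice_algebra_def
    by (simp only: monoid.simps) (rule order_trans[OF keys_sum UN_mono[OF order_refl keys_sum]])
  also have "\<dots> \<subseteq> L" using assms by (auto split: if_splits)
  finally show ?thesis by simp
qed

lemma \<alpha>_nonzero: "x \<in> L \<Longrightarrow> y \<in> L \<Longrightarrow> \<alpha> x y \<noteq> 0"
  using cocycle by (simp add: normalised_cocycle_def)

lemma \<alpha>_swap: "x \<in> L \<Longrightarrow> y \<in> L \<Longrightarrow> \<alpha> x y = exp (complex_of_real pi * \<i> * B x y) * \<alpha> y x"
proof -
  assume x: "x \<in> L" and y: "y \<in> L"
  then have "\<alpha> x y * inverse (\<alpha> y x) = exp (complex_of_real pi * \<i> * B x y)" using \<alpha>_comm by simp
  then show ?thesis using \<alpha>_nonzero[OF y x] by (simp add: field_simps)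
qed

lemma amoduleD:
  assumes "amodule sc A M"
  shows "hmodule sc M" "locally_finite M" "is_bilinear A M M (lact M)" "vector_sp M"
    "\<And>x. is_linear M M (act M x)"
    "\<And>x a m. a \<in> carrier A \<Longrightarrow> m \<in> carrier M \<Longrightarrow>
        act M x (lact M a m) = lact M (act A x a) m \<oplus>\<^bsub>M\<^esub> lact M a (act M x m)"
    "\<And>a b m. a \<in> carrier A \<Longrightarrow> b \<in> carrier A \<Longrightarrow> m \<in> carrier M \<Longrightarrow>
        lact M (a \<otimes>\<^bsub>A\<^esub> b) m = lact M a (lact M b m)"
    "\<And>m. m \<in> carrier M \<Longrightarrow> lact M (e 0) m = m"
  using assms by (simp_all add: amodule_iff hmodule_iff)

lemma lact_e_linear: "amodule sc A M \<Longrightarrow> y \<in> L \<Longrightarrow> is_linear M M (lact M (e y))"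
  using is_bilinearD(2)[OF amoduleD(3) e_closed] .

lemma lact_e_e:
  assumes "amodule sc A M" "x \<in> L" "y \<in> L" "m \<in> carrier M"
  shows "lact M (e x) (lact M (e y) m) = \<alpha> x y \<odot>\<^bsub>M\<^esub> lact M (e (x + y)) m"
proof -
  have "lact M (e x) (lact M (e y) m) = lact M (\<alpha> x y \<odot>\<^bsub>A\<^esub> e (x + y)) m"
    using amoduleD(7)[OF assms(1) e_closed[OF assms(2)] e_closed[OF assms(3)] assms(4)]
    by (simp only: A_mult_e)
  also have "\<dots> = \<alpha> x y \<odot>\<^bsub>M\<^esub> lact M (e (x + y)) m"
    by (rule is_linearD(3)[OF is_bilinearD(1)[OF amoduleD(3)[OF assms(1)] assms(4)] e_closed[OF L_add[OF assms(2,3)]]])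
  finally show ?thesis .
qed

text \<open>Acting by e_(-y) after e_y is multiplication by \<alpha>(-y, y), because e_0 is the
  unit, and this scalar is non-zero.\<close>

lemma lact_e_inj:
  assumes "amodule sc A M" "y \<in> L" "m \<in> carrier M" "m' \<in> carrier M" "lact M (e y) m = lact M (e y) m'"
  shows "m = m'"
proof -
  interpret vector_sp M by (rule amoduleD(4)[OF assms(1)])
  have "lact M (e (- y)) (lact M (e y) m) = \<alpha> (- y) y \<odot>\<^bsub>M\<^esub> m" if "m \<in> carrier M" for m
    using lact_e_e[OF assms(1) L_minus[OF assms(2)] assms(2) that] amoduleD(8)[OF assms(1) that] by simp
  then have eq: "\<alpha> (- y) y \<odot>\<^bsub>M\<^esub> m = \<alpha> (- y) y \<odot>\<^bsub>M\<^esub> m'" using assms(3-5) by metis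
  have "m = inverse (\<alpha> (- y) y) \<odot>\<^bsub>M\<^esub> (\<alpha> (- y) y \<odot>\<^bsub>M\<^esub> m)"
    using \<alpha>_nonzero[OF L_minus[OF assms(2)] assms(2)] assms(3) by simp
  also have "\<dots> = m'"
    unfolding eq using \<alpha>_nonzero[OF L_minus[OF assms(2)] assms(2)] assms(4) by simp
  finally show ?thesis .
qed

lemma act_sum:
  assumes "hmodule sc M" "m \<in> carrier M"
  shows "(\<Oplus>\<^bsub>M\<^esub>u\<in>U. B y u \<odot>\<^bsub>M\<^esub> act M u m) = act M y m"
proof -
  interpret vector_sp M using assms(1) by (simp add: hmodule_iff)
  have l: "is_linear M M (act M x)" for x using assms(1) by (simp add: hmodule_iff)
  have "act M y m = act M (\<Sum>u\<in>U. sc (B u y) u) m" by (simp flip: onb_expand)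
  also have "\<dots> = (\<Oplus>\<^bsub>M\<^esub>u\<in>U. act M (sc (B u y) u) m)"
    by (rule hmodule_sum[OF assms finite_U]) (simp_all add: h.scale_right_distrib)
  also have "\<dots> = (\<Oplus>\<^bsub>M\<^esub>u\<in>U. B y u \<odot>\<^bsub>M\<^esub> act M u m)"
    by (rule finsum_cong') (use assms is_linearD(1)[OF l] in \<open>auto simp: hmodule_iff B_sym[of y]\<close>)
  finally show ?thesis by simp
qed

end

section \<open>The Casimir element on the tensor product of the lattice algebra with a
  module\<close>

locale lattice_hmodule = even_lattice sc Bs B L \<alpha>
  for sc :: "complex \<Rightarrow> 'h::ab_group_add \<Rightarrow> 'h" and Bs B L \<alpha> +
  fixes M :: "('h, 'v, 'z) hmod_scheme" (structure)
  assumes M_hmodule: "hmodule sc M"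

sublocale lattice_hmodule \<subseteq> AM: tensor_pair A M
  using M_hmodule A_vector_sp by (intro tensor_pair.intro) (simp_all add: hmodule_iff)

context lattice_hmodule
begin

interpretation AMs: vector_sp "tensor_space A M" by (rule AM.tensor_vector_sp)

lemma M_act_linear: "is_linear M M (act M x)"
  using M_hmodule by (simp add: hmodule_iff)

lemma Omega_bilinear:
  "is_bilinear A M (tensor_space A M) (\<lambda>a m. \<Oplus>\<^bsub>tensor_space A M\<^esub>u\<in>U. tens A M (act A u a) (act M u m))"
  by (intro is_bilinear_finsum AM.tensor_vector_sp finite_U is_bilinear_comp2[OF AM.tens_bilinear]
      A_act_linear M_act_linear)

lemma Omega_linear: "is_linear (tensor_space A M) (tensor_space A M) (Omega U A M)"
  unfolding Omega_def by (rule AM.tensor_lift_linear[OF AM.tensor_vector_sp Omega_bilinear])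

lemma Omega_e:
  assumes y: "y \<in> L" and m: "m \<in> carrier M"
  shows "Omega U A M (tens A M (e y) m) = tens A M (e y) (act M y m)"
proof -
  note tl = is_bilinearD(2)[OF AM.tens_bilinear e_closed[OF y]]
  have cl: "act M u m \<in> carrier M" for u using is_linearD(1)[OF M_act_linear m] .
  have "Omega U A M (tens A M (e y) m) = (\<Oplus>\<^bsub>tensor_space A M\<^esub>u\<in>U. tens A M (act A u (e y)) (act M u m))"
    unfolding Omega_def by (rule AM.tensor_lift_tens[OF AM.tensor_vector_sp Omega_bilinear e_closed[OF y] m])
  \<comment> \<open>The eigenvalue (y, u) of u on e_y crosses to the second factor, where
    \<open>act_sum\<close> reassembles y from its coordinates.\<close>
  also have "\<dots> = (\<Oplus>\<^bsub>tensor_space A M\<^esub>u\<in>U. tens A M (e y) (B y u \<odot> act M u m))"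
  proof (rule AMs.finsum_cong')
    fix u
    show "tens A M (act A u (e y)) (act M u m) = tens A M (e y) (B y u \<odot> act M u m)"
      unfolding A_act_e AM.tens_smult_left[OF cl e_closed[OF y]] AM.tens_smult_right[OF e_closed[OF y] cl] ..
  qed (use cl y in \<open>auto intro!: AM.tens_closed\<close>)
  also have "\<dots> = tens A M (e y) (\<Oplus>u\<in>U. B y u \<odot> act M u m)"
    by (rule is_linear_finsum[OF AM.N.vector_sp_axioms AM.tensor_vector_sp tl finite_U, symmetric]) (use cl in auto)
  also have "\<dots> = tens A M (e y) (act M y m)" by (simp only: act_sum[OF M_hmodule m])
  finally show ?thesis .
qed

abbreviation cOmega where "cOmega c t \<equiv> c \<odot>\<^bsub>tensor_space A M\<^esub> Omega U A M t"

lemma cOmega_linear: "is_linear (tensor_space A M) (tensor_space A M) (cOmega c)"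
  by (rule is_linear_smult[OF AM.tensor_vector_sp Omega_linear])

lemma weight_space_subspace: "submodule (weight_space M L \<chi>) cfield M"
  by (rule AM.N.subspaceI)
    (auto simp: weight_space_def is_linearD[OF M_act_linear] AM.N.smult_add_right mult.commute
      is_linear_zero[OF AM.N.vector_sp_axioms AM.N.vector_sp_axioms M_act_linear])

lemma weight_spaceD: "m \<in> weight_space M L \<chi> \<Longrightarrow> m \<in> carrier M"
  "m \<in> weight_space M L \<chi> \<Longrightarrow> y \<in> L \<Longrightarrow> act M y m = of_int (\<chi> y) \<odot> m"
  by (auto simp: weight_space_def)

abbreviation weights :: "('h \<Rightarrow> int) set \<Rightarrow> 'v set" where
  "weights \<Xi> \<equiv> (\<Union>\<chi>\<in>\<Xi>. weight_space M L \<chi>)"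

context
  fixes \<Xi>
  assumes gen: "generates M (weights \<Xi>)"
begin

lemma AM_generates:
  "generates (tensor_space A M) {tens A M s t | s t. s \<in> e ` L \<and> t \<in> weights \<Xi>}"
  by (rule AM.generates_tensor[OF A_generates gen])

lemma cOmega_weight:
  assumes "y \<in> L" "m \<in> weight_space M L \<chi>"
  shows "cOmega c (tens A M (e y) m) = (c * of_int (\<chi> y)) \<odot>\<^bsub>tensor_space A M\<^esub> tens A M (e y) m"
proof -
  note m = weight_spaceD(1)[OF assms(2)]
  have "cOmega c (tens A M (e y) m) = c \<odot>\<^bsub>tensor_space A M\<^esub> tens A M (e y) (of_int (\<chi> y) \<odot> m)"
    using Omega_e[OF assms(1) m] weight_spaceD(2)[OF assms(2,1)] by simp
  also have "\<dots> = c \<odot>\<^bsub>tensor_space A M\<^esub> (of_int (\<chi> y) \<odot>\<^bsub>tensor_space A M\<^esub> tens A M (e y) m)"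
    by (simp only: AM.tens_smult_right[OF e_closed[OF assms(1)] m])
  also have "\<dots> = (c * of_int (\<chi> y)) \<odot>\<^bsub>tensor_space A M\<^esub> tens A M (e y) m"
    by (rule AMs.smult_smult[OF AM.tens_closed[OF e_closed[OF assms(1)] m]])
  finally show ?thesis .
qed

lemma cOmega_eigen:
  "s \<in> {tens A M s t | s t. s \<in> e ` L \<and> t \<in> weights \<Xi>} \<Longrightarrow>
    \<exists>l. cOmega c s = l \<odot>\<^bsub>tensor_space A M\<^esub> s"
  using cOmega_weight by blast

text \<open>On e_y \<otimes> m with m a weight vector the operator is a scalar, and these tensors
  span. The braiding is the lift of a map built from this exponential, and that map is bilinear only
  because of this.\<close>

lemma exp_Omega_linear: "is_linear (tensor_space A M) (tensor_space A M) (exp_Omega U A M c)"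
  unfolding exp_Omega_def by (rule AMs.lf_exp_linear[OF cOmega_linear AM_generates cOmega_eigen])

lemma exp_Omega_weight:
  assumes "y \<in> L" "m \<in> weight_space M L \<chi>"
  shows "exp_Omega U A M c (tens A M (e y) m) =
    exp (c * of_int (\<chi> y)) \<odot>\<^bsub>tensor_space A M\<^esub> tens A M (e y) m"
  unfolding exp_Omega_def
  by (rule AMs.lf_exp_eigen[OF cOmega_linear AM.tens_closed[OF e_closed[OF assms(1)] weight_spaceD(1)[OF assms(2)]]
        cOmega_weight[OF assms]])

end

text \<open>Available before anything is known about generation by weights. The operator c Omega has
  the Jordan chain e_y \<otimes> v, e_y \<otimes> c z with eigenvalue c l; the scalar in front of z
  appears because Omega is scaled before it is exponentiated.\<close>

lemma exp_Omega_jordan: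
  assumes y: "y \<in> L" and v: "v \<in> carrier M" and z: "z \<in> carrier M"
    and yv: "act M y v = l \<odot> v \<oplus> z" and yz: "act M y z = l \<odot> z"
  shows "exp_Omega U A M c (tens A M (e y) v) =
    tens A M (e y) (exp (c * l) \<odot> (v \<oplus> c \<odot> z))"
proof -
  let ?T = "tensor_space A M"
  note ey = e_closed[OF y]
  have t: "is_linear M ?T (tens A M (e y))" by (rule is_bilinearD(2)[OF AM.tens_bilinear ey])
  note tD = is_linearD[OF t]
  let ?t = "tens A M (e y) v" and ?w = "c \<odot>\<^bsub>?T\<^esub> tens A M (e y) z"
  have cl: "?t \<in> carrier ?T" "tens A M (e y) z \<in> carrier ?T" using tD(1) v z by auto
  have 1: "cOmega c ?t = (c * l) \<odot>\<^bsub>?T\<^esub> ?t \<oplus>\<^bsub>?T\<^esub> ?w"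
    unfolding Omega_e[OF y v] yv using v z cl by (simp add: tD AMs.smult_add_right)
  have 2: "cOmega c ?w = (c * l) \<odot>\<^bsub>?T\<^esub> ?w"
    unfolding is_linearD(3)[OF Omega_linear cl(2)] Omega_e[OF y z] yz using z cl by (simp add: tD mult_ac)
  have w: "?w \<in> carrier ?T" using cl by simp
  have "exp_Omega U A M c ?t = exp (c * l) \<odot>\<^bsub>?T\<^esub> ?t \<oplus>\<^bsub>?T\<^esub> exp (c * l) \<odot>\<^bsub>?T\<^esub> ?w"
    unfolding exp_Omega_def
    by (rule AMs.lf_exp_eqI[OF AMs.has_exp_jordan[OF cOmega_linear cl(1) w 1 2]])
  also have "\<dots> = tens A M (e y) (exp (c * l) \<odot> (v \<oplus> c \<odot> z))"
    using v z cl by (simp add: tD AM.N.smult_add_right)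
  finally show ?thesis .
qed

end

text \<open>The modulus of the exponential forces \<open>l\<close> to be real; then the real part of
  the exponential is a cosine, which is 1 only at integers.\<close>

lemma exp_2pi_int_iff: "exp (2 * complex_of_real pi * \<i> * l) = 1 \<longleftrightarrow> l \<in> \<int>"
proof
  assume a: "exp (2 * complex_of_real pi * \<i> * l) = 1"
  have "norm (exp (2 * complex_of_real pi * \<i> * l)) = exp (- 2 * pi * Im l)" by (simp add: norm_exp_eq_Re)
  then have im: "Im l = 0" using a by simp
  have "Re (exp (2 * complex_of_real pi * \<i> * l)) = cos (2 * pi * Re l)" using im by (simp add: Re_exp)
  then have "cos (2 * pi * Re l) = 1" using a by simp
  then obtain n :: int where "2 * pi * Re l = of_int n * 2 * pi" using cos_one_2pi_int by blast
  then have "l = of_int n" using im by (simp add: complex_eq_iff)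
  then show "l \<in> \<int>" by simp
next
  assume "l \<in> \<int>"
  then obtain n where "l = of_int n" by (rule Ints_cases)
  moreover have "exp (2 * complex_of_real pi * \<i> * of_int n) = cis (2 * pi * of_int n)"
    by (simp add: cis_conv_exp mult_ac)
  ultimately show "exp (2 * complex_of_real pi * \<i> * l) = 1" by simp
qed

section \<open>Diagonalisation of a locally finite operator, and spans of weight spaces\<close>

section \<open>Weights of local modules\<close>

text \<open>The inductive step writes
  \<open>(T - l) v = (T - l) u + z\<close> with \<open>u\<close> in the span of the eigenvectors and \<open>(T - l) z = 0\<close>.\<close>

lemma (in vector_sp) integral_eigen_span:
  assumes T: "is_linear V V T" and W: "submodule W cfield V" "\<And>w. w \<in> W \<Longrightarrow> T w \<in> W"
    and int: "\<And>l v. v \<in> W \<Longrightarrow> v \<noteq> \<zero> \<Longrightarrow> T v = l \<odot> v \<Longrightarrow> l \<in> \<int>"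
    and ss: "\<And>l v z. v \<in> W \<Longrightarrow> z \<in> W \<Longrightarrow> T v = l \<odot> v \<oplus> z \<Longrightarrow> T z = l \<odot> z \<Longrightarrow> z = \<zero>"
  shows "killed V T ls v \<Longrightarrow> v \<in> W \<Longrightarrow> v \<in> lin_span V {w \<in> W. \<exists>n::int. T w = of_int n \<odot> w}"
proof (induction ls arbitrary: v)
  let ?E = "{w \<in> W. \<exists>n::int. T w = of_int n \<odot> w}"
  note WD = subspaceD[OF W(1)] and TD = is_linearD[OF T]
  have E: "?E \<subseteq> carrier V" using WD(1) by blast
  note S = subspace_span[OF E] and SD = subspaceD[OF subspace_span[OF E]]
  {
    case Nil
    then show ?case using SD(2) by simp
  next
    case (Cons l ls)
    have vW: "v \<in> W" by fact
    have v: "v \<in> carrier V" using WD(5) vW .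
    have kW: "T v \<oplus> (- l) \<odot> v \<in> W" using W(2) WD(3,4) vW by simp
    define Q where "Q = {w \<in> carrier V. \<exists>u z. u \<in> lin_span V ?E \<and> u \<in> W \<and> z \<in> W \<and> T z = l \<odot> z \<and>
        w = (T u \<oplus> (- l) \<odot> u) \<oplus> z}"
    have Q: "submodule Q cfield V"
    proof (rule subspaceI)
      show "\<zero> \<in> Q"
        unfolding Q_def using SD(2) WD(2) is_linear_zero[OF vector_sp_axioms vector_sp_axioms T]
        by (auto intro!: exI[of _ \<zero>])
    next
      fix a b assume "a \<in> Q" "b \<in> Q"
      then obtain u z u' z' where 1: "u \<in> lin_span V ?E" "u \<in> W" "z \<in> W" "T z = l \<odot> z"
          "a = (T u \<oplus> (- l) \<odot> u) \<oplus> z"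
        and 2: "u' \<in> lin_span V ?E" "u' \<in> W" "z' \<in> W" "T z' = l \<odot> z'" "b = (T u' \<oplus> (- l) \<odot> u') \<oplus> z'"
        and ab: "a \<in> carrier V" "b \<in> carrier V"
        unfolding Q_def by blast
      note cl = WD(5)[OF 1(2)] WD(5)[OF 1(3)] WD(5)[OF 2(2)] WD(5)[OF 2(3)]
      have "T (z \<oplus> z') = l \<odot> (z \<oplus> z')" using cl 1(4) 2(4) by (simp add: TD smult_add_right)
      moreover have "a \<oplus> b = (T (u \<oplus> u') \<oplus> (- l) \<odot> (u \<oplus> u')) \<oplus> (z \<oplus> z')"
        unfolding 1(5) 2(5) using cl by (simp add: TD smult_add_right a_ac)
      ultimately show "a \<oplus> b \<in> Q"
        unfolding Q_def using ab SD(3)[OF 1(1) 2(1)] WD(3)[OF 1(2) 2(2)] WD(3)[OF 1(3) 2(3)] by blast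
    next
      fix c a assume "a \<in> Q"
      then obtain u z where 1: "u \<in> lin_span V ?E" "u \<in> W" "z \<in> W" "T z = l \<odot> z"
          "a = (T u \<oplus> (- l) \<odot> u) \<oplus> z" and a: "a \<in> carrier V"
        unfolding Q_def by blast
      note cl = WD(5)[OF 1(2)] WD(5)[OF 1(3)]
      have "T (c \<odot> z) = l \<odot> (c \<odot> z)" using cl 1(4) by (simp add: TD mult.commute)
      moreover have "c \<odot> a = (T (c \<odot> u) \<oplus> (- l) \<odot> (c \<odot> u)) \<oplus> c \<odot> z"
        unfolding 1(5) using cl by (simp add: TD smult_add_right mult.commute)
      ultimately show "c \<odot> a \<in> Q"
        unfolding Q_def using a SD(4)[OF 1(1)] WD(4)[OF 1(2)] WD(4)[OF 1(3)] by blast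
    qed (auto simp: Q_def)
    have "?E \<subseteq> Q"
    proof
      fix w assume w: "w \<in> ?E"
      then obtain n :: int where n: "T w = of_int n \<odot> w" by blast
      have wW: "w \<in> W" and wV: "w \<in> carrier V" using w WD(5) by auto
      show "w \<in> Q"
      proof (cases "of_int n = l")
        case True
        then have "T w = l \<odot> w" using n by simp
        moreover have "w = (T \<zero> \<oplus> (- l) \<odot> \<zero>) \<oplus> w"
          using wV is_linear_zero[OF vector_sp_axioms vector_sp_axioms T] by simp
        ultimately show ?thesis unfolding Q_def using wW wV SD(2) WD(2) by blast
      next
        case False
        \<comment> \<open>On an eigenvector of eigenvalue n different from l the operator T - l is
          the non-zero scalar n - l, so a preimage is obtained by dividing.\<close>
        let ?u = "inverse (of_int n - l) \<odot> w"
        have "T ?u \<oplus> (- l) \<odot> ?u = (inverse (of_int n - l) * of_int n + (- l) * inverse (of_int n - l)) \<odot> w"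
          using wV n by (simp add: TD add_smult_self mult.commute)
        also have "inverse (of_int n - l) * of_int n + (- l) * inverse (of_int n - l) = 1"
        proof -
          have "inverse (of_int n - l) * of_int n + (- l) * inverse (of_int n - l) =
              inverse (of_int n - l) * (of_int n - l)" by (simp add: right_diff_distrib)
          also have "\<dots> = 1" using False by simp
          finally show ?thesis .
        qed
        finally have "T ?u \<oplus> (- l) \<odot> ?u = w" using wV by (simp only: smult_one)
        then have 1: "w = (T ?u \<oplus> (- l) \<odot> ?u) \<oplus> \<zero>" using wV by (simp only: r_zero)
        have 2: "?u \<in> lin_span V ?E" by (rule SD(4)[OF subsetD[OF span_superset w]])
        have 3: "T \<zero> = l \<odot> \<zero>" using is_linear_zero[OF vector_sp_axioms vector_sp_axioms T] by simp
        show ?thesis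
          unfolding Q_def mem_Collect_eq
          by (intro conjI exI[of _ ?u] exI[of _ \<zero>]) (fact wV 2 WD(4)[OF wW] WD(2) 3 1)+
      qed
    qed
    then have "lin_span V ?E \<subseteq> Q" by (rule span_minimal[OF Q])
    moreover have "T v \<oplus> (- l) \<odot> v \<in> lin_span V ?E"
      using Cons.IH[OF _ kW] Cons.prems(1) by simp
    ultimately obtain u z where u: "u \<in> lin_span V ?E" "u \<in> W" and z: "z \<in> W" "T z = l \<odot> z"
      and eq: "T v \<oplus> (- l) \<odot> v = (T u \<oplus> (- l) \<odot> u) \<oplus> z"
      unfolding Q_def by blast
    note cl = v WD(5)[OF u(2)] WD(5)[OF z(1)] TD(1)[OF v] TD(1)[OF WD(5)[OF u(2)]]
    \<comment> \<open>Subtracting u leaves a vector with (T - l) d = z and (T - l) z = 0, a chain of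
      the kind that \<open>ss\<close> rules out; so d is an eigenvector or zero.\<close>
    let ?d = "v \<oplus> (-1) \<odot> u"
    have dW: "?d \<in> W" using vW u(2) WD(3,4) by simp
    have "T ?d = l \<odot> ?d \<oplus> z"
    proof -
      have "T v = l \<odot> v \<oplus> (T v \<oplus> (- l) \<odot> v)"
        using cl add_smult_self[OF v, of l "- l"] by (simp add: a_lcomm)
      also have "\<dots> = l \<odot> v \<oplus> (T u \<oplus> (- l) \<odot> u \<oplus> z)" by (simp only: eq)
      finally have "T ?d = l \<odot> v \<oplus> (T u \<oplus> (- l) \<odot> u \<oplus> z) \<oplus> (-1) \<odot> T u"
        using cl by (simp add: TD)
      also have "\<dots> = (T u \<oplus> (-1) \<odot> T u) \<oplus> (l \<odot> v \<oplus> (- l) \<odot> u \<oplus> z)" using cl by (simp add: a_ac)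
      also have "T u \<oplus> (-1) \<odot> T u = \<zero>" using cl by (simp only: add_eq_zero_iff)
      also have "\<zero> \<oplus> (l \<odot> v \<oplus> (- l) \<odot> u \<oplus> z) = l \<odot> ?d \<oplus> z" using cl by (simp add: smult_add_right)
      finally show ?thesis .
    qed
    moreover from this have "z = \<zero>" by (rule ss[OF dW z(1) _ z(2)])
    ultimately have Td: "T ?d = l \<odot> ?d" using cl by simp
    have "?d \<in> lin_span V ?E"
    proof (cases "?d = \<zero>")
      case True then show ?thesis using SD(2) by simp
    next
      case False
      then have "l \<in> \<int>" by (rule int[OF dW _ Td])
      then obtain n where "l = of_int n" by (rule Ints_cases)
      then have "T ?d = of_int n \<odot> ?d" using Td by (simp only:)
      then have "?d \<in> ?E" using dW by blast
      then show ?thesis by (rule subsetD[OF span_superset])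
    qed
    then have "?d \<oplus> u \<in> lin_span V ?E" by (rule SD(3)[OF _ u(1)])
    moreover have "?d \<oplus> u = v"
    proof -
      have "?d \<oplus> u = v \<oplus> (u \<oplus> (-1) \<odot> u)" using cl by (simp add: a_ac)
      moreover have "u \<oplus> (-1) \<odot> u = \<zero>" using cl by (simp only: add_eq_zero_iff)
      ultimately show ?thesis using cl by simp
    qed
    ultimately show ?case by simp
  }
qed

lemma complex_vector_space: "vector_space ((*) :: complex \<Rightarrow> complex \<Rightarrow> complex)"
  by unfold_locales (simp_all add: algebra_simps)

context lattice_hmodule
begin

text \<open>Eigenvalues on an independent set extend to a linear functional on \<open>'h\<close>,
  which the form represents by a vector x. Since the action is linear in the Lie algebra, x then
  gives the eigenvalues on the whole span.\<close>

lemma joint_eigenvector: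
  assumes v: "v \<in> carrier M" and C: "h.independent C" "L \<subseteq> h.span C"
    and f: "\<And>c. c \<in> C \<Longrightarrow> act M c v = f c \<odot> v"
  shows "\<exists>x. \<forall>y\<in>L. act M y v = B x y \<odot> v"
proof -
  interpret c: vector_space "(*) :: complex \<Rightarrow> complex \<Rightarrow> complex" by (rule complex_vector_space)
  interpret hc: vector_space_pair sc "(*) :: complex \<Rightarrow> complex \<Rightarrow> complex" ..
  obtain g where g: "Vector_Spaces.linear sc (*) g" "\<forall>c\<in>C. g c = f c"
    using hc.linear_independent_extend[OF C(1)] by blast
  obtain x where x: "\<And>y. g y = B x y" using functional_rep[OF g(1)] by blast
  have "act M y v = B x y \<odot> v" if "y \<in> h.span C" for y
    using that
  proof (induction rule: h.span_induct_alt)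
    case base
    have "act M (sc 0 0) v = 0 \<odot> act M 0 v"
      using M_hmodule v unfolding hmodule_iff by blast
    then show ?case using v is_linearD(1)[OF M_act_linear v] by simp
  next
    case (step c y z)
    have "act M (sc c y + z) v = c \<odot> act M y v \<oplus> act M z v"
      using M_hmodule v by (simp add: hmodule_iff)
    then show ?case
      using step f[OF step(1)] g(2) x v by (simp add: AM.N.smult_add_left)
  qed
  then show ?thesis using C(2) by blast
qed

text \<open>For \<chi> different from \<psi> take y with \<chi>(y) different from \<psi>(y). The
  operator y - \<psi>(y) kills the \<psi>-term and multiplies each other term by a scalar, so the
  shorter sum falls under the induction hypothesis; the scalar at \<chi> is not 0.\<close>

lemma weight_independent:
  assumes "finite J" "J \<subseteq> extensional L" "\<And>\<chi>. \<chi> \<in> J \<Longrightarrow> f \<chi> \<in> weight_space M L \<chi>"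
    "(\<Oplus>\<chi>\<in>J. f \<chi>) = \<zero>"
  shows "\<forall>\<chi>\<in>J. f \<chi> = \<zero>"
  using assms
proof (induction J arbitrary: f)
  case empty show ?case by simp
next
  case (insert \<psi> J)
  have fc: "f \<chi> \<in> carrier M" if "\<chi> \<in> insert \<psi> J" for \<chi>
    using insert.prems(2)[OF that] weight_spaceD(1) by blast
  have fJ: "f \<in> J \<rightarrow> carrier M" and f\<psi>: "f \<psi> \<in> carrier M" using fc by auto
  have sum: "f \<psi> \<oplus> (\<Oplus>\<chi>\<in>J. f \<chi>) = \<zero>"
    using insert.prems(3) insert.hyps fJ f\<psi> by simp
  have J0: "f \<chi> = \<zero>" if \<chi>: "\<chi> \<in> J" for \<chi>
  proof -
    have "\<chi> \<noteq> \<psi>" using insert.hyps(2) \<chi> by blast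
    \<comment> \<open>Extensionality makes distinct functions differ already at a point of
      \<open>L\<close>.\<close>
    moreover have "\<chi> \<in> extensional L" "\<psi> \<in> extensional L" using insert.prems(1) \<chi> by auto
    ultimately obtain y where y: "y \<in> L" "\<chi> y \<noteq> \<psi> y" by (metis extensionalityI)
    let ?d = "\<lambda>\<chi>. of_int (\<chi> y) + (- of_int (\<psi> y)) :: complex"
    have lin: "is_linear M M (\<lambda>m. act M y m \<oplus> (- of_int (\<psi> y)) \<odot> m)"
      by (rule AM.N.shift_linear[OF M_act_linear])
    have ev: "act M y (f \<chi>) \<oplus> (- of_int (\<psi> y)) \<odot> f \<chi> = ?d \<chi> \<odot> f \<chi>"
      if "\<chi> \<in> insert \<psi> J" for \<chi>
      unfolding weight_spaceD(2)[OF insert.prems(2)[OF that] y(1)] by (rule AM.N.add_smult_self[OF fc[OF that]])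
    have "(\<Oplus>\<chi>\<in>insert \<psi> J. ?d \<chi> \<odot> f \<chi>) =
        (\<Oplus>\<chi>\<in>insert \<psi> J. act M y (f \<chi>) \<oplus> (- of_int (\<psi> y)) \<odot> f \<chi>)"
      by (rule AM.N.finsum_cong') (use ev fc is_linearD(1)[OF lin] in auto)
    also have "\<dots> = act M y (\<Oplus>\<chi>\<in>insert \<psi> J. f \<chi>) \<oplus>
        (- of_int (\<psi> y)) \<odot> (\<Oplus>\<chi>\<in>insert \<psi> J. f \<chi>)"
      by (rule is_linear_finsum[OF AM.N.vector_sp_axioms AM.N.vector_sp_axioms lin, symmetric])
        (use insert.hyps fc in auto)
    also have "\<dots> = \<zero>"
      unfolding insert.prems(3)
      using is_linear_zero[OF AM.N.vector_sp_axioms AM.N.vector_sp_axioms M_act_linear] by simp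
    finally have "(\<Oplus>\<chi>\<in>insert \<psi> J. ?d \<chi> \<odot> f \<chi>) = \<zero>" .
    then have "(\<Oplus>\<chi>\<in>J. ?d \<chi> \<odot> f \<chi>) = \<zero>"
    proof -
      have cl: "(\<lambda>\<chi>. ?d \<chi> \<odot> f \<chi>) \<in> J \<rightarrow> carrier M" using fJ by auto
      have "(\<Oplus>\<chi>\<in>insert \<psi> J. ?d \<chi> \<odot> f \<chi>) =
          ?d \<psi> \<odot> f \<psi> \<oplus> (\<Oplus>\<chi>\<in>J. ?d \<chi> \<odot> f \<chi>)"
        by (rule AM.N.finsum_insert[OF insert.hyps(1,2) cl]) (use f\<psi> in simp)
      also have "\<dots> = (\<Oplus>\<chi>\<in>J. ?d \<chi> \<odot> f \<chi>)"
        using f\<psi> AM.N.finsum_closed[OF cl] by simp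
      finally show ?thesis using \<open>(\<Oplus>\<chi>\<in>insert \<psi> J. ?d \<chi> \<odot> f \<chi>) = \<zero>\<close> by simp
    qed
    moreover have "?d \<chi> \<odot> f \<chi> \<in> weight_space M L \<chi>" if "\<chi> \<in> J" for \<chi>
      using AM.N.subspaceD(4)[OF weight_space_subspace insert.prems(2)] that by blast
    moreover have "J \<subseteq> extensional L" using insert.prems(1) by blast
    ultimately have "\<forall>\<chi>\<in>J. ?d \<chi> \<odot> f \<chi> = \<zero>" by (intro insert.IH)
    then have "?d \<chi> \<odot> f \<chi> = \<zero>" using \<chi> by blast
    moreover have "?d \<chi> \<noteq> 0" using y(2) by simp
    ultimately show ?thesis using AM.N.smult_eq_zero[OF fc, of \<chi> "?d \<chi>"] \<chi> by simp
  qed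
  have "(\<Oplus>\<chi>\<in>J. f \<chi>) = \<zero>" by (rule AM.N.add.finprod_one_eqI) (rule J0)
  then have "f \<psi> = \<zero>" using sum f\<psi> by simp
  then show ?case using J0 by simp
qed

abbreviation wspan :: "('h \<Rightarrow> int) set \<Rightarrow> 'v set" where
  "wspan \<Xi> \<equiv> lin_span M (weights \<Xi>)"

lemma weights_subset: "weights \<Xi> \<subseteq> carrier M"
  using weight_spaceD(1) by blast

lemmas wspan_subspace = AM.N.subspace_span[OF weights_subset]

lemma wspan_base: "\<chi> \<in> \<Xi> \<Longrightarrow> v \<in> weight_space M L \<chi> \<Longrightarrow> v \<in> wspan \<Xi>"
  using AM.N.span_superset[of "weights \<Xi>"] by blast

lemma wspan_mono: "\<Xi> \<subseteq> \<Xi>' \<Longrightarrow> wspan \<Xi> \<subseteq> wspan \<Xi>'"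
  by (rule AM.N.span_minimal[OF wspan_subspace]) (use wspan_base in blast)

text \<open>Each character occurs once in the sum, which is the form needed for
  \<open>weight_independent\<close>.\<close>

lemma wspan_rep:
  assumes "v \<in> wspan \<Xi>"
  shows "\<exists>K f. finite K \<and> K \<subseteq> \<Xi> \<and> (\<forall>\<chi>\<in>K. f \<chi> \<in> weight_space M L \<chi>) \<and> v = (\<Oplus>\<chi>\<in>K. f \<chi>)"
proof -
  let ?Q = "{v. \<exists>K f. finite K \<and> K \<subseteq> \<Xi> \<and> (\<forall>\<chi>\<in>K. f \<chi> \<in> weight_space M L \<chi>) \<and> v = (\<Oplus>\<chi>\<in>K. f \<chi>)}"
  note wD = AM.N.subspaceD[OF weight_space_subspace]
  have "submodule ?Q cfield M"
  proof (rule AM.N.subspaceI)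
    show "?Q \<subseteq> carrier M" using weight_spaceD(1) by (auto intro!: AM.N.finsum_closed)
    show "\<zero> \<in> ?Q" by (auto intro!: exI[of _ "{}"])
  next
    fix v w assume "v \<in> ?Q" "w \<in> ?Q"
    then obtain K f K' f' where
      1: "finite K" "K \<subseteq> \<Xi>" "\<And>\<chi>. \<chi> \<in> K \<Longrightarrow> f \<chi> \<in> weight_space M L \<chi>" "v = (\<Oplus>\<chi>\<in>K. f \<chi>)" and
      2: "finite K'" "K' \<subseteq> \<Xi>" "\<And>\<chi>. \<chi> \<in> K' \<Longrightarrow> f' \<chi> \<in> weight_space M L \<chi>" "w = (\<Oplus>\<chi>\<in>K'. f' \<chi>)"
      by blast
    \<comment> \<open>Both families are padded by zero, so that they can be added over the union of
      their index sets.\<close>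
    define g where "g \<chi> = (if \<chi> \<in> K then f \<chi> else \<zero>)" for \<chi>
    define g' where "g' \<chi> = (if \<chi> \<in> K' then f' \<chi> else \<zero>)" for \<chi>
    have g: "g \<chi> \<in> weight_space M L \<chi>" "g' \<chi> \<in> weight_space M L \<chi>" for \<chi>
      using 1(3) 2(3) wD(2) by (simp_all add: g_def g'_def)
    have gc: "g \<in> I \<rightarrow> carrier M" "g' \<in> I \<rightarrow> carrier M" for I using weight_spaceD(1)[OF g(1)] weight_spaceD(1)[OF g(2)] by auto
    have "v = (\<Oplus>\<chi>\<in>K \<union> K'. g \<chi>)" unfolding 1(4)
      by (rule AM.N.add.finprod_mono_neutral_cong_left)
        (use 1(1) 2(1) weight_spaceD(1)[OF g(1)] in \<open>auto simp: g_def\<close>)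
    moreover have "w = (\<Oplus>\<chi>\<in>K \<union> K'. g' \<chi>)" unfolding 2(4)
      by (rule AM.N.add.finprod_mono_neutral_cong_left)
        (use 1(1) 2(1) weight_spaceD(1)[OF g(2)] in \<open>auto simp: g'_def\<close>)
    ultimately have "v \<oplus> w = (\<Oplus>\<chi>\<in>K \<union> K'. g \<chi> \<oplus> g' \<chi>)"
      using AM.N.finsum_addf[OF gc] by simp
    moreover have "\<forall>\<chi>\<in>K \<union> K'. g \<chi> \<oplus> g' \<chi> \<in> weight_space M L \<chi>" using wD(3)[OF g] by blast
    ultimately show "v \<oplus> w \<in> ?Q"
      using 1(1,2) 2(1,2) by (intro CollectI exI[of _ "K \<union> K'"] exI[of _ "\<lambda>\<chi>. g \<chi> \<oplus> g' \<chi>"]) simp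
  next
    fix c v assume "v \<in> ?Q"
    then obtain K f where
      1: "finite K" "K \<subseteq> \<Xi>" "\<And>\<chi>. \<chi> \<in> K \<Longrightarrow> f \<chi> \<in> weight_space M L \<chi>" "v = (\<Oplus>\<chi>\<in>K. f \<chi>)" by blast
    have "c \<odot> v = (\<Oplus>\<chi>\<in>K. c \<odot> f \<chi>)"
      unfolding 1(4) by (rule AM.N.finsum_smult[OF 1(1)]) (use 1(3) weight_spaceD(1) in blast)
    then show "c \<odot> v \<in> ?Q"
      using 1(1-3) wD(4) by (intro CollectI exI[of _ K] exI[of _ "\<lambda>\<chi>. c \<odot> f \<chi>"]) simp
  qed
  moreover have "weights \<Xi> \<subseteq> ?Q"
  proof
    fix v assume "v \<in> weights \<Xi>"
    then obtain \<chi> where "\<chi> \<in> \<Xi>" "v \<in> weight_space M L \<chi>" by blast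
    then show "v \<in> ?Q"
      using weight_spaceD(1) by (intro CollectI exI[of _ "{\<chi>}"] exI[of _ "\<lambda>_. v"]) simp
  qed
  ultimately have "wspan \<Xi> \<subseteq> ?Q" by (rule AM.N.span_minimal)
  then show ?thesis using assms by blast
qed

text \<open>Subtracting the two expansions of v gives a vanishing sum over distinct characters, all
  of whose terms must be zero.\<close>

lemma wspan_disjoint:
  assumes "\<Xi> \<subseteq> extensional L" "\<Xi>' \<subseteq> extensional L" "\<Xi> \<inter> \<Xi>' = {}" "v \<in> wspan \<Xi>" "v \<in> wspan \<Xi>'"
  shows "v = \<zero>"
proof -
  obtain K f where 1: "finite K" "K \<subseteq> \<Xi>" "\<And>\<chi>. \<chi> \<in> K \<Longrightarrow> f \<chi> \<in> weight_space M L \<chi>"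
    "v = (\<Oplus>\<chi>\<in>K. f \<chi>)" using wspan_rep[OF assms(4)] by blast
  obtain K' f' where 2: "finite K'" "K' \<subseteq> \<Xi>'" "\<And>\<chi>. \<chi> \<in> K' \<Longrightarrow> f' \<chi> \<in> weight_space M L \<chi>"
    "v = (\<Oplus>\<chi>\<in>K'. f' \<chi>)" using wspan_rep[OF assms(5)] by blast
  note wD = AM.N.subspaceD[OF weight_space_subspace]
  define g where "g \<chi> = (if \<chi> \<in> K then f \<chi> else (-1) \<odot> f' \<chi>)" for \<chi>
  have dj: "K \<inter> K' = {}" using 1(2) 2(2) assms(3) by blast
  have fc: "f \<in> K \<rightarrow> carrier M" "f' \<in> K' \<rightarrow> carrier M" using 1(3) 2(3) weight_spaceD(1) by blast+
  have gK: "(\<Oplus>\<chi>\<in>K. g \<chi>) = v" unfolding 1(4)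
    by (rule AM.N.finsum_cong') (use fc in \<open>auto simp: g_def\<close>)
  have "(\<Oplus>\<chi>\<in>K'. g \<chi>) = (\<Oplus>\<chi>\<in>K'. (-1) \<odot> f' \<chi>)"
    by (rule AM.N.finsum_cong') (use dj fc in \<open>auto simp: g_def\<close>)
  also have "\<dots> = (-1) \<odot> v" unfolding 2(4) by (rule AM.N.finsum_smult[OF 2(1) fc(2), symmetric])
  finally have gK': "(\<Oplus>\<chi>\<in>K'. g \<chi>) = (-1) \<odot> v" .
  have gc: "g \<in> K \<rightarrow> carrier M" "g \<in> K' \<rightarrow> carrier M" using fc dj by (auto simp: g_def Pi_iff)
  have vc: "v \<in> carrier M" unfolding 1(4) by (rule AM.N.finsum_closed[OF fc(1)])
  have "(\<Oplus>\<chi>\<in>K \<union> K'. g \<chi>) = v \<oplus> (-1) \<odot> v"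
    using AM.N.finsum_Un_disjoint[OF 1(1) 2(1) dj gc] gK gK' by simp
  also have "\<dots> = \<zero>" using vc by (simp only: AM.N.add_eq_zero_iff)
  finally have z: "(\<Oplus>\<chi>\<in>K \<union> K'. g \<chi>) = \<zero>" .
  have gw: "g \<chi> \<in> weight_space M L \<chi>" if "\<chi> \<in> K \<union> K'" for \<chi>
    using that 1(3) 2(3) wD(4) by (auto simp: g_def)
  have "\<forall>\<chi>\<in>K \<union> K'. g \<chi> = \<zero>"
    by (rule weight_independent[OF _ _ gw z]) (use 1(1,2) 2(1,2) assms(1,2) in auto)
  then have "(\<Oplus>\<chi>\<in>K. g \<chi>) = \<zero>" by (intro AM.N.add.finprod_one_eqI) blast
  then show ?thesis using gK by simp
qed

end

section \<open>What locality says about weights\<close>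

locale lattice_amodule = even_lattice sc Bs B L \<alpha>
  for sc :: "complex \<Rightarrow> 'h::ab_group_add \<Rightarrow> 'h" and Bs B L \<alpha> +
  fixes M :: "('h, 'h \<Rightarrow>\<^sub>0 complex, 'v) amod" (structure)
  assumes M_amodule: "amodule sc A M"

sublocale lattice_amodule \<subseteq> lattice_hmodule sc Bs B L \<alpha> M
  by unfold_locales (rule amoduleD(1)[OF M_amodule])

context lattice_amodule
begin

interpretation AMs: vector_sp "tensor_space A M" by (rule AM.tensor_vector_sp)

lemma nu_linear: "is_linear (tensor_space A M) M (nu A M)"
  unfolding nu_def by (rule AM.tensor_lift_linear[OF AM.N.vector_sp_axioms amoduleD(3)[OF M_amodule]])

lemma nu_tens: "a \<in> carrier A \<Longrightarrow> m \<in> carrier M \<Longrightarrow> nu A M (tens A M a m) = lact M a m"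
  unfolding nu_def by (rule AM.tensor_lift_tens[OF AM.N.vector_sp_axioms amoduleD(3)[OF M_amodule]])

text \<open>The Leibniz rule adds weights, and e_y itself has weight \<open>pc y\<close>.\<close>

lemma lact_e_weight:
  assumes "y \<in> L" "v \<in> weight_space M L \<chi>"
  shows "lact M (e y) v \<in> weight_space M L (\<lambda>z\<in>L. \<chi> z + pc y z)"
proof -
  note v = weight_spaceD(1)[OF assms(2)]
  note l = is_linearD[OF lact_e_linear[OF M_amodule assms(1)]]
  have "act M z (lact M (e y) v) = of_int (\<chi> z + pc y z) \<odot> lact M (e y) v" if z: "z \<in> L" for z
  proof -
    have "act M z (lact M (e y) v) = lact M (B y z \<odot>\<^bsub>A\<^esub> e y) v \<oplus> lact M (e y) (of_int (\<chi> z) \<odot> v)"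
      using amoduleD(6)[OF M_amodule e_closed[OF assms(1)] v, of z] weight_spaceD(2)[OF assms(2) z]
      by (simp only: A_act_e)
    also have "lact M (B y z \<odot>\<^bsub>A\<^esub> e y) v = B y z \<odot> lact M (e y) v"
      by (rule is_linearD(3)[OF is_bilinearD(1)[OF amoduleD(3)[OF M_amodule] v] e_closed[OF assms(1)]])
    also have "B y z = of_int (pc y z)" by (rule of_int_pc[OF subsetD[OF L_dual assms(1)] z, symmetric])
    finally show ?thesis by (simp add: l v AM.N.smult_add_left AM.N.a_comm)
  qed
  then show ?thesis using l(1)[OF v] by (simp add: weight_space_def)
qed

text \<open>Integral weights make e^(2 pi i \<chi>(y)) equal to 1, so the exponential in the
  definition of locality fixes a spanning set. Components and tensor products obtain their locality
  here.\<close>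

lemma weights_local:
  assumes gen: "generates M (weights \<Xi>)"
  shows "M \<in> local_modules sc U A"
proof -
  let ?E = "exp_Omega U A M (2 * complex_of_real pi * \<i>)"
  have "nu A M (?E t) = nu A M t" if "t \<in> carrier (tensor_space A M)" for t
  proof (rule generates_linear_eq[OF AM.tensor_vector_sp AM.N.vector_sp_axioms AM_generates[OF gen]
        is_linear_comp[OF exp_Omega_linear[OF gen] nu_linear] nu_linear _ that])
    fix s assume "s \<in> {tens A M s t |s t. s \<in> e ` L \<and> t \<in> weights \<Xi>}"
    then obtain y v \<chi> where s: "s = tens A M (e y) v" "y \<in> L" "v \<in> weight_space M L \<chi>" by blast
    have "?E s = exp (2 * complex_of_real pi * \<i> * of_int (\<chi> y)) \<odot>\<^bsub>tensor_space A M\<^esub> s"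
      unfolding s(1) by (rule exp_Omega_weight[OF gen s(2,3)])
    also have "exp (2 * complex_of_real pi * \<i> * of_int (\<chi> y)) = 1" by (simp add: exp_2pi_int_iff)
    finally show "nu A M (?E s) = nu A M s"
      using AM.tens_closed[OF e_closed[OF s(2)] weight_spaceD(1)[OF s(3)]] s(1) by simp
  qed
  then show ?thesis
    unfolding local_modules_def using M_amodule nu_tens AM.tens_closed by simp
qed

text \<open>Locality at e_y and v equates e_y applied to the explicit exponential with e_y applied
  to v; then e_y is cancelled.\<close>

lemma local_jordan:
  assumes loc: "M \<in> local_modules sc U A" and y: "y \<in> L" and v: "v \<in> carrier M" and z: "z \<in> carrier M"
    and yv: "act M y v = l \<odot> v \<oplus> z" and yz: "act M y z = l \<odot> z"
  shows "v = exp (2 * complex_of_real pi * \<i> * l) \<odot> (v \<oplus> (2 * complex_of_real pi * \<i>) \<odot> z)"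
proof -
  let ?c = "2 * complex_of_real pi * \<i>"
  let ?v = "exp (?c * l) \<odot> (v \<oplus> ?c \<odot> z)"
  have vc: "?v \<in> carrier M" using v z by simp
  have "lact M (e y) ?v = nu A M (exp_Omega U A M ?c (tens A M (e y) v))"
    unfolding exp_Omega_jordan[OF y v z yv yz] by (rule nu_tens[OF e_closed[OF y] vc, symmetric])
  also have "\<dots> = lact M (e y) v"
    using loc e_closed[OF y] v unfolding local_modules_def by blast
  finally show ?thesis using lact_e_inj[OF M_amodule y v vc] by simp
qed

lemma local_eigenvalue:
  assumes "M \<in> local_modules sc U A" "y \<in> L" "v \<in> carrier M" "v \<noteq> \<zero>" "act M y v = l \<odot> v"
  shows "l \<in> \<int>"
proof -
  let ?q = "exp (2 * complex_of_real pi * \<i> * l)"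
  have "act M y v = l \<odot> v \<oplus> \<zero>" "act M y \<zero> = l \<odot> \<zero>"
    using assms(3,5) is_linear_zero[OF AM.N.vector_sp_axioms AM.N.vector_sp_axioms M_act_linear] by simp_all
  from local_jordan[OF assms(1-3) AM.N.zero_closed this]
  have "?q \<odot> v = 1 \<odot> v" using assms(3) by simp
  then have "?q = 1" by (rule AM.N.smult_right_cancel[OF assms(3,4)])
  then show ?thesis by (simp only: exp_2pi_int_iff)
qed

text \<open>The tail z of the chain would be an eigenvector, so l is integral and the exponential
  factor in \<open>local_jordan\<close> is 1. What remains is v + 2 pi i z = v.\<close>

lemma local_semisimple:
  assumes loc: "M \<in> local_modules sc U A" and y: "y \<in> L" and v: "v \<in> carrier M" and z: "z \<in> carrier M"
    and yv: "act M y v = l \<odot> v \<oplus> z" and yz: "act M y z = l \<odot> z"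
  shows "z = \<zero>"
proof (rule ccontr)
  assume nz: "z \<noteq> \<zero>"
  let ?c = "2 * complex_of_real pi * \<i>"
  have "l \<in> \<int>" by (rule local_eigenvalue[OF loc y z nz yz])
  then have "exp (?c * l) = 1" by (simp only: exp_2pi_int_iff)
  then have "v \<oplus> ?c \<odot> z = v" using local_jordan[OF loc y v z yv yz] v z by simp
  then have "?c \<odot> z = \<zero>" using v z AM.N.add.r_cancel_one by simp
  then show False using AM.N.smult_eq_zero[OF z, of ?c] nz by simp
qed

text \<open>Simultaneous diagonalisation of commuting operators, one lattice element at a
  time.\<close>

lemma local_joint_span:
  assumes loc: "M \<in> local_modules sc U A" and "finite S" "S \<subseteq> L"
  shows "carrier M \<subseteq> lin_span M {v \<in> carrier M. \<forall>s\<in>S. \<exists>n::int. act M s v = of_int n \<odot> v}"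
  using assms(2,3)
proof (induction S)
  case empty
  then show ?case using AM.N.span_superset[of "carrier M"] by simp
next
  case (insert y S)
  let ?J = "\<lambda>S. {v \<in> carrier M. \<forall>s\<in>S. \<exists>n::int. act M s v = of_int n \<odot> v}"
  have y: "y \<in> L" using insert.prems by blast
  have JS: "submodule (lin_span M (?J (insert y S))) cfield M" by (rule AM.N.subspace_span) auto
  have "?J S \<subseteq> lin_span M (?J (insert y S))"
  proof
    fix v assume v: "v \<in> ?J S"
    then obtain n :: "'h \<Rightarrow> int" where n: "\<forall>s\<in>S. act M s v = of_int (n s) \<odot> v" by simp metis
    \<comment> \<open>The joint eigenspace of \<open>S\<close> with the eigenvalues of v. The new
      operator commutes with the old ones and so preserves it; splitting v inside it keeps the
      eigenvalues already found.\<close>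
    let ?W = "{w \<in> carrier M. \<forall>s\<in>S. act M s w = of_int (n s) \<odot> w}"
    have W: "submodule ?W cfield M"
      by (rule AM.N.subspaceI)
        (auto simp: is_linearD[OF M_act_linear] AM.N.smult_add_right mult.commute
          is_linear_zero[OF AM.N.vector_sp_axioms AM.N.vector_sp_axioms M_act_linear])
    have Wy: "act M y w \<in> ?W" if "w \<in> ?W" for w
    proof -
      have w: "w \<in> carrier M" using that by blast
      have "act M s (act M y w) = act M y (act M s w)" for s
        using M_hmodule w by (auto simp: hmodule_iff)
      then show ?thesis using that by (auto simp: is_linearD[OF M_act_linear])
    qed
    obtain ls where ls: "killed M (act M y) ls v"
      using amoduleD(2)[OF M_amodule] v unfolding locally_finite_iff[OF M_hmodule] by blast
    have vW: "v \<in> ?W" using v n by blast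
    have "v \<in> lin_span M {w \<in> ?W. \<exists>n::int. act M y w = of_int n \<odot> w}"
    proof (rule AM.N.integral_eigen_span[OF M_act_linear W Wy _ _ ls vW])
      show "l \<in> \<int>" if "v \<in> ?W" "v \<noteq> \<zero>" "act M y v = l \<odot> v" for l v
        using local_eigenvalue[OF loc y _ that(2,3)] that(1) by blast
      show "z = \<zero>" if "v \<in> ?W" "z \<in> ?W" "act M y v = l \<odot> v \<oplus> z" "act M y z = l \<odot> z" for l v z
        using local_semisimple[OF loc y _ _ that(3,4)] that(1,2) by blast
    qed
    moreover have "{w \<in> ?W. \<exists>n::int. act M y w = of_int n \<odot> w} \<subseteq> lin_span M (?J (insert y S))"
      using AM.N.span_superset[of "?J (insert y S)"] by (auto simp: subset_iff)
    ultimately show "v \<in> lin_span M (?J (insert y S))" using AM.N.span_minimal[OF JS] by blast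
  qed
  then have "lin_span M (?J S) \<subseteq> lin_span M (?J (insert y S))" by (rule AM.N.span_minimal[OF JS])
  then show ?case using insert.IH insert.prems by blast
qed

text \<open>Only the finite set \<open>C\<close> has to be diagonalised jointly;
  \<open>joint_eigenvector\<close> supplies the eigenvalues of all other elements of
  \<open>L\<close>.\<close>

lemma local_generates:
  assumes loc: "M \<in> local_modules sc U A"
  shows "generates M (weights (pc ` D))"
proof -
  obtain C where C: "C \<subseteq> L" "h.independent C" "L \<subseteq> h.span C" by (rule h.maximal_independent_subset)
  have fin: "finite C" by (rule h.finiteI_independent[OF C(2)])
  let ?J = "{v \<in> carrier M. \<forall>s\<in>C. \<exists>n::int. act M s v = of_int n \<odot> v}"
  have "?J \<subseteq> wspan (pc ` D)"
  proof
    fix v assume v: "v \<in> ?J"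
    then have vc: "v \<in> carrier M" by blast
    obtain n :: "'h \<Rightarrow> int" where n: "\<And>s. s \<in> C \<Longrightarrow> act M s v = of_int (n s) \<odot> v" using v by simp metis
    show "v \<in> wspan (pc ` D)"
    proof (cases "v = \<zero>")
      case True show ?thesis unfolding True by (rule AM.N.subspaceD(2)[OF wspan_subspace])
    next
      case False
      obtain x where x: "\<forall>y\<in>L. act M y v = B x y \<odot> v"
        using joint_eigenvector[OF vc C(2,3) n] by blast
      \<comment> \<open>Membership in the dual lattice concerns all of \<open>L\<close> and not only
        \<open>C\<close>; it holds because the non-zero v is an eigenvector of every lattice
        element.\<close>
      then have "x \<in> D" using local_eigenvalue[OF loc _ vc False] by (simp add: dual_lattice_def)
      moreover have "v \<in> weight_space M L (pc x)"
        using x vc of_int_pc[OF \<open>x \<in> D\<close>] by (simp add: weight_space_def)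
      ultimately show ?thesis using wspan_base by blast
    qed
  qed
  then have "lin_span M ?J \<subseteq> wspan (pc ` D)" by (rule AM.N.span_minimal[OF wspan_subspace])
  then show ?thesis
    unfolding generates_def using local_joint_span[OF loc fin C(1)] weights_subset by blast
qed

text \<open>The two conditions agree because weight spans over disjoint sets meet in zero, and
  because the e_l move any weight vector through its whole class. The zero module is generated by
  zero vectors for every \<open>X\<close>, in line with the second alternative in
  \<open>local_modules_graded\<close>.\<close>

lemma graded_iff:
  assumes X: "X \<in> carrier G"
  shows "M \<in> local_modules_graded sc B L A X \<longleftrightarrow> generates M (weights (pc ` X))"
proof
  have ext: "pc ` Y \<subseteq> extensional L" for Y using pc_ext by blast
  have XD: "pc ` X \<subseteq> pc ` D" using G_class_dual[OF X] by blast
  {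
    assume "M \<in> local_modules_graded sc B L A X"
    then have loc: "M \<in> local_modules sc U A"
      and s: "supp L M = pc ` X \<or> carrier M = {\<zero>}"
      by (simp_all add: local_modules_graded_def class_orbit_eq[OF X])
    have zX: "\<zero> \<in> wspan (pc ` X)" by (rule AM.N.subspaceD(2)[OF wspan_subspace])
    have "carrier M \<subseteq> wspan (pc ` X)"
    proof (cases "carrier M = {\<zero>}")
      case True then show ?thesis using zX by (simp only: insert_subset empty_subsetI)
    next
      case False
      then have s: "supp L M = pc ` X" using s by blast
      have "weights (pc ` D) \<subseteq> wspan (pc ` X)"
      proof
        fix v assume "v \<in> weights (pc ` D)"
        then obtain x where x: "x \<in> D" "v \<in> weight_space M L (pc x)" by blast
        show "v \<in> wspan (pc ` X)"
        proof (cases "v = \<zero>")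
          case True show ?thesis unfolding True by (rule zX)
        next
          case False
          then have "pc x \<in> supp L M" using pc_character[OF x(1)] x(2) by (auto simp: supp_def)
          then have "pc x \<in> pc ` X" by (simp only: s)
          then show ?thesis by (rule wspan_base[OF _ x(2)])
        qed
      qed
      then show ?thesis by (rule generates_subspace[OF AM.N.vector_sp_axioms local_generates[OF loc] wspan_subspace])
    qed
    then show "generates M (weights (pc ` X))" using weights_subset by (simp only: generates_def simp_thms)
  next
    assume gen: "generates M (weights (pc ` X))"
    have "supp L M = pc ` X" if nz: "carrier M \<noteq> {\<zero>}"
    proof (intro equalityI subsetI)
      fix \<chi> assume "\<chi> \<in> supp L M"
      then have c: "\<chi> \<in> extensional L" and "weight_space M L \<chi> \<noteq> {\<zero>}"
        by (auto simp: supp_def characters_def)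
      then obtain v where v: "v \<in> weight_space M L \<chi>" "v \<noteq> \<zero>"
        using AM.N.subspaceD(2)[OF weight_space_subspace] by blast
      show "\<chi> \<in> pc ` X"
      proof (rule ccontr)
        assume n: "\<chi> \<notin> pc ` X"
        have 1: "v \<in> wspan (pc ` X)" using weight_spaceD(1)[OF v(1)] gen by (auto simp: generates_def)
        have 2: "v \<in> wspan {\<chi>}" by (rule wspan_base[OF singletonI v(1)])
        \<comment> \<open>A weight outside the class would put v into two spans over disjoint sets
          of weights.\<close>
        have "v = \<zero>" by (rule wspan_disjoint[OF ext _ _ 1 2]) (use c n in auto)
        then show False using v(2) by blast
      qed
    next
      \<comment> \<open>Otherwise the generators all vanish, and so does the module.\<close>
      have "\<exists>v\<in>weights (pc ` X). v \<noteq> \<zero>"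
      proof (rule ccontr)
        assume "\<not> ?thesis"
        then have "weights (pc ` X) \<subseteq> {\<zero>}" by blast
        moreover have "submodule {\<zero>} cfield M" by (rule AM.N.subspaceI) auto
        ultimately have "carrier M \<subseteq> {\<zero>}"
          using generates_subspace[OF AM.N.vector_sp_axioms gen] by blast
        then show False using nz AM.N.zero_closed by blast
      qed
      then obtain v x where x: "x \<in> X" "v \<in> weight_space M L (pc x)" "v \<noteq> \<zero>" by blast
      fix \<chi> assume "\<chi> \<in> pc ` X"
      then obtain x' where x': "x' \<in> X" "\<chi> = pc x'" by blast
      \<comment> \<open>Every weight of the class arises from that of v by a lattice translation,
        and the injective e_l realises it by a non-zero vector.\<close>
      obtain l where l: "l \<in> L" "pc x' = pc (x + l)" using pc_class_transitive[OF X x(1) x'(1)] by blast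
      have d: "x \<in> D" "l \<in> D" using G_class_dual[OF X] x(1) L_dual l(1) by auto
      have w: "lact M (e l) v \<in> weight_space M L \<chi>"
        using lact_e_weight[OF l(1) x(2)] pc_add[OF d] l(2) x'(2) by simp
      note vc = weight_spaceD(1)[OF x(2)]
      have "lact M (e l) v \<noteq> \<zero>"
      proof
        assume "lact M (e l) v = \<zero>"
        then have "lact M (e l) v = lact M (e l) \<zero>"
          using is_linear_zero[OF AM.N.vector_sp_axioms AM.N.vector_sp_axioms lact_e_linear[OF M_amodule l(1)]] by simp
        then show False using lact_e_inj[OF M_amodule l(1) vc AM.N.zero_closed] x(3) by blast
      qed
      moreover have "\<chi> \<in> characters L" using pc_character G_class_dual[OF X] x' by blast
      ultimately show "\<chi> \<in> supp L M" using w unfolding supp_def by blast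
    qed
    then show "M \<in> local_modules_graded sc B L A X"
      using weights_local[OF gen] unfolding local_modules_graded_def class_orbit_eq[OF X] by blast
  }
qed

end

section \<open>The coequaliser over the lattice algebra, as a module with weights\<close>

section \<open>Tensor products over the lattice algebra\<close>

lemma image_subspace:
  assumes "vector_sp V" "vector_sp W" "is_linear V W f"
  shows "submodule (f ` carrier V) cfield W"
proof -
  interpret V: vector_sp V by fact
  interpret W: vector_sp W by fact
  note fD = is_linearD[OF assms(3)]
  show ?thesis
  proof (rule W.subspaceI)
    show "\<zero>\<^bsub>W\<^esub> \<in> f ` carrier V"
      using is_linear_zero[OF assms] by (metis V.zero_closed imageI)
    fix a b assume "a \<in> f ` carrier V" "b \<in> f ` carrier V"
    then obtain v w where "a = f v" "v \<in> carrier V" "b = f w" "w \<in> carrier V" by blast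
    then have "a \<oplus>\<^bsub>W\<^esub> b = f (v \<oplus>\<^bsub>V\<^esub> w)" "v \<oplus>\<^bsub>V\<^esub> w \<in> carrier V" by (simp_all add: fD)
    then show "a \<oplus>\<^bsub>W\<^esub> b \<in> f ` carrier V" by blast
  next
    fix c a assume "a \<in> f ` carrier V"
    then obtain v where "a = f v" "v \<in> carrier V" by blast
    then have "c \<odot>\<^bsub>W\<^esub> a = f (c \<odot>\<^bsub>V\<^esub> v)" "c \<odot>\<^bsub>V\<^esub> v \<in> carrier V" by (simp_all add: fD)
    then show "c \<odot>\<^bsub>W\<^esub> a \<in> f ` carrier V" by blast
  qed (use fD(1) in blast)
qed

text \<open>Formulated for any record \<open>Q\<close> with the operations of the quotient, because
  \<open>tensor_over\<close> is assembled by extending records.\<close>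

lemma amodule_quotient:
  fixes V :: "('h::ab_group_add, 'v, 'z) hmod_scheme" and A :: "('h, 'a, 'x) hmod_scheme"
    and Q :: "('h, 'a, 'v set, 'y) amod_scheme"
  assumes V: "hmodule sc V" "locally_finite V" and l: "is_bilinear A V V l"
    and leibniz: "\<And>x a v. a \<in> carrier A \<Longrightarrow> v \<in> carrier V \<Longrightarrow>
        act V x (l a v) = l (act A x a) v \<oplus>\<^bsub>V\<^esub> l a (act V x v)"
    and assoc: "\<And>a b v. a \<in> carrier A \<Longrightarrow> b \<in> carrier A \<Longrightarrow> v \<in> carrier V \<Longrightarrow>
        l (a \<otimes>\<^bsub>A\<^esub> b) v = l a (l b v)"
    and unit: "\<And>v. v \<in> carrier V \<Longrightarrow> l \<one>\<^bsub>A\<^esub> v = v"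
    and A: "\<And>x a. a \<in> carrier A \<Longrightarrow> act A x a \<in> carrier A"
      "\<And>a b. a \<in> carrier A \<Longrightarrow> b \<in> carrier A \<Longrightarrow> a \<otimes>\<^bsub>A\<^esub> b \<in> carrier A" "\<one>\<^bsub>A\<^esub> \<in> carrier A"
      "\<And>a b. a \<in> carrier A \<Longrightarrow> b \<in> carrier A \<Longrightarrow> a \<oplus>\<^bsub>A\<^esub> b \<in> carrier A"
      "\<And>c a. a \<in> carrier A \<Longrightarrow> c \<odot>\<^bsub>A\<^esub> a \<in> carrier A"
    and R: "submodule R cfield V" "\<And>x r. r \<in> R \<Longrightarrow> act V x r \<in> R"
      "\<And>a r. a \<in> carrier A \<Longrightarrow> r \<in> R \<Longrightarrow> l a r \<in> R"
    and Q: "carrier Q = carrier (quot_space V R)" "\<zero>\<^bsub>Q\<^esub> = \<zero>\<^bsub>quot_space V R\<^esub>"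
      "\<And>X Y. X \<oplus>\<^bsub>Q\<^esub> Y = X \<oplus>\<^bsub>quot_space V R\<^esub> Y" "\<And>c X. c \<odot>\<^bsub>Q\<^esub> X = c \<odot>\<^bsub>quot_space V R\<^esub> X"
      "\<And>x. act Q x = quot_map V R (act V x)" "\<And>a. lact Q a = quot_map V R (l a)"
  shows "amodule sc A Q"
proof -
  interpret V: vector_sp V using V(1) by (simp add: hmodule_iff)
  have actl: "is_linear V V (act V x)" for x using V(1) by (simp add: hmodule_iff)
  note actD = is_linearD[OF actl]
  note lr = is_bilinearD(2)[OF l] and ll = is_bilinearD(1)[OF l]
  note lD = is_linearD[OF lr] is_linearD[OF ll]
  let ?q = "\<lambda>v. R +>\<^bsub>V\<^esub> v"
  have carrier: "carrier Q = ?q ` carrier V" unfolding Q(1) V.quot_carrier[OF R(1)] ..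
  have add: "?q v \<oplus>\<^bsub>Q\<^esub> ?q w = ?q (v \<oplus>\<^bsub>V\<^esub> w)" if "v \<in> carrier V" "w \<in> carrier V" for v w
    unfolding Q(3) by (rule V.quot_add[OF R(1) that])
  have smult: "c \<odot>\<^bsub>Q\<^esub> ?q v = ?q (c \<odot>\<^bsub>V\<^esub> v)" if "v \<in> carrier V" for c v
    unfolding Q(4) by (rule V.quot_smult[OF R(1) that])
  have act: "act Q x (?q v) = ?q (act V x v)" if "v \<in> carrier V" for x v
    unfolding Q(5) by (rule V.quot_map_coset[OF R(1) actl R(2) that])
  have lact: "lact Q a (?q v) = ?q (l a v)" if "a \<in> carrier A" "v \<in> carrier V" for a v
    unfolding Q(6) by (rule V.quot_map_coset[OF R(1) lr[OF that(1)] R(3)[OF that(1)] that(2)])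
  have Qv: "vector_sp Q" by (rule vector_sp_cong[OF V.quot_vector_sp[OF R(1)]]) (simp_all add: Q)
  have "is_linear Q Q (act Q x)" for x
    by (rule is_linearI) (auto simp: carrier add smult act actD)
  moreover have ac: "act V (x + y) v = act V x v \<oplus>\<^bsub>V\<^esub> act V y v" "act V (sc c x) v = c \<odot>\<^bsub>V\<^esub> act V x v"
    "act V x (act V y v) = act V y (act V x v)" if "v \<in> carrier V" for x y c v
    using V(1) that by (auto simp: hmodule_iff)
  ultimately have hQ: "hmodule sc Q"
    unfolding hmodule_iff using Qv by (auto simp: carrier act actD add smult ac ac(3)[symmetric])
  have lf: "locally_finite Q"
    unfolding locally_finite_iff[OF hQ]
  proof (intro allI ballI)
    fix x X assume "X \<in> carrier Q"
    then obtain v where v: "v \<in> carrier V" "X = ?q v" unfolding carrier by blast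
    obtain ls where "killed V (act V x) ls v"
      using V(2) v(1) unfolding locally_finite_iff[OF V(1)] by blast
    \<comment> \<open>Local finiteness descends with the same list of factors, since the projection
      intertwines the actions.\<close>
    then have "killed (quot_space V R) (act Q x) ls (?q v)"
      by (intro killed_linear[OF V.vector_sp_axioms V.quot_vector_sp[OF R(1)] actl V.quot_proj_linear[OF R(1)] _ v(1)])
        (simp_all add: act)
    then show "\<exists>ls. killed Q (act Q x) ls X"
      unfolding v(2) using killed_cong[of Q "quot_space V R"] Q by metis
  qed
  have "is_bilinear A Q Q (lact Q)"
    by (rule is_bilinearI) (auto simp: carrier lact lD add smult A)
  then show ?thesis
    unfolding amodule_iff using hQ lf
    by (auto simp: carrier lact act lD actD add A leibniz assoc unit)
qed

text \<open>The braiding of \<open>M\<close> past \<open>A\<close> is an exponential on A \<otimes>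
  M, hence the assumption that weight vectors generate \<open>M\<close>: it makes the exponential
  exist, linear and explicit.\<close>

locale lattice_amodule_pair = even_lattice sc Bs B L \<alpha>
  for sc :: "complex \<Rightarrow> 'h::ab_group_add \<Rightarrow> 'h" and Bs B L \<alpha> +
  fixes M :: "('h, 'h \<Rightarrow>\<^sub>0 complex, 'm) amod" and N :: "('h, 'h \<Rightarrow>\<^sub>0 complex, 'n) amod"
    and \<Xi> :: "('h \<Rightarrow> int) set"
  assumes M_am: "amodule sc A M" and N_am: "amodule sc A N"
    and M_gen: "generates M (\<Union>\<chi>\<in>\<Xi>. weight_space M L \<chi>)"

sublocale lattice_amodule_pair \<subseteq> m: lattice_amodule sc Bs B L \<alpha> M
  by unfold_locales (rule M_am)

sublocale lattice_amodule_pair \<subseteq> n: lattice_amodule sc Bs B L \<alpha> N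
  by unfold_locales (rule N_am)

sublocale lattice_amodule_pair \<subseteq> MN: hmodule_pair sc M N
  by (rule hmodule_pair.intro[OF amoduleD(1)[OF M_am] amoduleD(1)[OF N_am]])

sublocale lattice_amodule_pair \<subseteq> MA: tensor_pair M A
  by (rule tensor_pair.intro[OF amoduleD(4)[OF M_am] A_vector_sp])

sublocale lattice_amodule_pair \<subseteq> MA_N: tensor_pair "tensor_space M A" N
  by (rule tensor_pair.intro[OF MA.tensor_vector_sp amoduleD(4)[OF N_am]])

context lattice_amodule_pair
begin

interpretation T: vector_sp "tensor_space M N" by (rule MN.tensor_vector_sp)
interpretation AMs: vector_sp "tensor_space A M" by (rule m.AM.tensor_vector_sp)

lemma tensor_record_vector_sp: "vector_sp (tensor M A)" "vector_sp (tensor A M)" "vector_sp (tensor A N)"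
  "vector_sp (tensor M N)"
  by (rule vector_sp_cong[OF MA.tensor_vector_sp], simp_all)
    (rule vector_sp_cong[OF m.AM.tensor_vector_sp], simp_all,
     rule vector_sp_cong[OF n.AM.tensor_vector_sp], simp_all,
     rule vector_sp_cong[OF MN.tensor_vector_sp], simp_all)

lemma braiding_bilinear:
  "is_bilinear M A (tensor_space A M) (\<lambda>m a. exp_Omega U A M (complex_of_real pi * \<i>) (tens A M a m))"
proof -
  have "is_bilinear M A (tensor_space A M) (\<lambda>m a. tens A M a m)"
    using m.AM.tens_bilinear unfolding is_bilinear_def by simp
  from is_bilinear_comp[OF this m.exp_Omega_linear[OF M_gen]] show ?thesis .
qed

lemma braiding_linear: "is_linear (tensor M A) (tensor A M) (braiding U M A)"
  using MA.tensor_lift_linear[OF m.AM.tensor_vector_sp braiding_bilinear] by (simp add: braiding_def)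

lemma braiding_weight:
  assumes "z \<in> L" "v \<in> weight_space M L \<chi>"
  shows "braiding U M A (tens M A v (e z)) =
    exp (complex_of_real pi * \<i> * of_int (\<chi> z)) \<odot>\<^bsub>tensor_space A M\<^esub> tens A M (e z) v"
  unfolding braiding_def
  by (subst MA.tensor_lift_tens[OF m.AM.tensor_vector_sp braiding_bilinear m.weight_spaceD(1)[OF assms(2)] e_closed[OF assms(1)]])
    (rule m.exp_Omega_weight[OF M_gen assms])

lemma balancing_left_props:
  shows "is_linear (tensor_space (tensor_space M A) N) (tensor_space M N) (balancing_left U A M N)"
    and "z \<in> L \<Longrightarrow> v \<in> weight_space M L \<chi> \<Longrightarrow> w \<in> carrier N \<Longrightarrow>
      balancing_left U A M N (tens (tensor_space M A) N (tens M A v (e z)) w) =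
        exp (complex_of_real pi * \<i> * of_int (\<chi> z)) \<odot>\<^bsub>tensor_space M N\<^esub> tens M N (lact M (e z) v) w"
proof -
  note Nv = amoduleD(4)[OF N_am] and Mv = amoduleD(4)[OF M_am]
  have nl: "is_linear (tensor A M) M (nu A M)" using m.nu_linear by simp
  note p1 = tensor_map_props[OF tensor_record_vector_sp(1) Nv tensor_record_vector_sp(2) Nv braiding_linear is_linear_id]
  note p2 = tensor_map_props[OF tensor_record_vector_sp(2) Nv Mv Nv nl is_linear_id]
  show "is_linear (tensor_space (tensor_space M A) N) (tensor_space M N) (balancing_left U A M N)"
    using is_linear_comp[OF p1(1) p2(1)] unfolding balancing_left_def by simp
  assume z: "z \<in> L" and v: "v \<in> weight_space M L \<chi>" and w: "w \<in> carrier N"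
  note vc = m.weight_spaceD(1)[OF v] and ez = e_closed[OF z]
  let ?E = "exp (complex_of_real pi * \<i> * of_int (\<chi> z))"
  have t: "tens A M (e z) v \<in> carrier (tensor_space A M)" by (rule m.AM.tens_closed[OF ez vc])
  have t': "tens M A v (e z) \<in> carrier (tensor_space M A)" by (rule MA.tens_closed[OF vc ez])
  have 1: "tensor_map (tensor M A) N (tensor A M) N (braiding U M A) (\<lambda>n. n)
      (tens (tensor_space M A) N (tens M A v (e z)) w) =
      tens (tensor_space A M) N (?E \<odot>\<^bsub>tensor_space A M\<^esub> tens A M (e z) v) w"
    using p1(2)[of "tens M A v (e z)" w] t' w braiding_weight[OF z v] by simp
  have 2: "?E \<odot>\<^bsub>tensor_space A M\<^esub> tens A M (e z) v \<in> carrier (tensor_space A M)" using t by simp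
  have "tensor_map (tensor A M) N M N (nu A M) (\<lambda>n. n)
      (tens (tensor_space A M) N (?E \<odot>\<^bsub>tensor_space A M\<^esub> tens A M (e z) v) w) =
      tens M N (nu A M (?E \<odot>\<^bsub>tensor_space A M\<^esub> tens A M (e z) v)) w"
    using p2(2)[of "?E \<odot>\<^bsub>tensor_space A M\<^esub> tens A M (e z) v" w] 2 w by simp
  also have "nu A M (?E \<odot>\<^bsub>tensor_space A M\<^esub> tens A M (e z) v) = ?E \<odot>\<^bsub>M\<^esub> lact M (e z) v"
    by (simp only: is_linearD(3)[OF m.nu_linear t] m.nu_tens[OF ez vc])
  also have "tens M N (?E \<odot>\<^bsub>M\<^esub> lact M (e z) v) w = ?E \<odot>\<^bsub>tensor_space M N\<^esub> tens M N (lact M (e z) v) w"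
    by (rule MN.tens_smult_left[OF w is_linearD(1)[OF lact_e_linear[OF M_am z] vc]])
  finally show "balancing_left U A M N (tens (tensor_space M A) N (tens M A v (e z)) w) =
        ?E \<odot>\<^bsub>tensor_space M N\<^esub> tens M N (lact M (e z) v) w"
    unfolding balancing_left_def 1 .
qed

lemma balancing_right_props:
  shows "is_linear (tensor_space (tensor_space M A) N) (tensor_space M N) (balancing_right A M N)"
    and "z \<in> L \<Longrightarrow> v \<in> carrier M \<Longrightarrow> w \<in> carrier N \<Longrightarrow>
      balancing_right A M N (tens (tensor_space M A) N (tens M A v (e z)) w) =
        tens M N v (lact N (e z) w)"
proof -
  note Nv = amoduleD(4)[OF N_am] and Mv = amoduleD(4)[OF M_am]
  have nl: "is_linear (tensor A N) N (nu A N)" using n.nu_linear by simp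
  note p1 = tensor_assoc_props[OF Mv A_vector_sp Nv]
  note p2 = tensor_map_props[OF Mv tensor_record_vector_sp(3) Mv Nv is_linear_id nl]
  show "is_linear (tensor_space (tensor_space M A) N) (tensor_space M N) (balancing_right A M N)"
    using is_linear_comp[OF p1(1) p2(1)[simplified]] unfolding balancing_right_def by simp
  assume z: "z \<in> L" and v: "v \<in> carrier M" and w: "w \<in> carrier N"
  note ez = e_closed[OF z]
  show "balancing_right A M N (tens (tensor_space M A) N (tens M A v (e z)) w) =
        tens M N v (lact N (e z) w)"
    unfolding balancing_right_def p1(2)[OF v ez w]
    using p2(2)[of v "tens A N (e z) w"] v n.AM.tens_closed[OF ez w] n.nu_tens[OF ez w] by simp
qed

definition bal where
  "bal t = balancing_left U A M N t \<oplus>\<^bsub>tensor_space M N\<^esub> (-1) \<odot>\<^bsub>tensor_space M N\<^esub> balancing_right A M N t"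

lemma bal_linear: "is_linear (tensor_space (tensor_space M A) N) (tensor_space M N) bal"
  unfolding bal_def
  by (rule is_linear_add[OF MN.tensor_vector_sp balancing_left_props(1)
        is_linear_smult[OF MN.tensor_vector_sp balancing_right_props(1)]])

lemma bal_weight:
  assumes "z \<in> L" "v \<in> weight_space M L \<chi>" "w \<in> carrier N"
  shows "bal (tens (tensor_space M A) N (tens M A v (e z)) w) =
    exp (complex_of_real pi * \<i> * of_int (\<chi> z)) \<odot>\<^bsub>tensor_space M N\<^esub> tens M N (lact M (e z) v) w
      \<oplus>\<^bsub>tensor_space M N\<^esub> (-1) \<odot>\<^bsub>tensor_space M N\<^esub> tens M N v (lact N (e z) w)"
  unfolding bal_def balancing_left_props(2)[OF assms]
    balancing_right_props(2)[OF assms(1) m.weight_spaceD(1)[OF assms(2)] assms(3)] ..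

abbreviation R where "R \<equiv> balancing_image U A M N"

text \<open>As the range of one linear map the set of differences is visibly a subspace, which the
  quotient construction requires.\<close>

lemma balancing_image_eq: "R = bal ` carrier (tensor_space (tensor_space M A) N)"
proof -
  interpret Tr: vector_sp "tensor M N" by (rule tensor_record_vector_sp(4))
  have "balancing_left U A M N t \<ominus>\<^bsub>tensor M N\<^esub> balancing_right A M N t = bal t"
    if "t \<in> carrier (tensor_space (tensor_space M A) N)" for t
    using that Tr.minus_eq_smult is_linearD(1)[OF balancing_left_props(1)] is_linearD(1)[OF balancing_right_props(1)]
    by (simp add: bal_def)
  then show ?thesis unfolding balancing_image_def by (auto simp: image_def)
qed

lemma R_subspace: "submodule R cfield (tensor_space M N)"
  unfolding balancing_image_eq by (rule image_subspace[OF MA_N.tensor_vector_sp MN.tensor_vector_sp bal_linear])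

lemma bal_mem:
  assumes "z \<in> L" "v \<in> weight_space M L \<chi>" "w \<in> carrier N"
  shows "bal (tens (tensor_space M A) N (tens M A v (e z)) w) \<in> R"
  unfolding balancing_image_eq
  by (rule imageI[OF MA_N.tens_closed[OF MA.tens_closed[OF m.weight_spaceD(1)[OF assms(2)] e_closed[OF assms(1)]] assms(3)]])

text \<open>Stability under \<open>f\<close> can be tested on v \<otimes> e_z \<otimes> w with v a
  weight vector, where \<open>bal\<close> is explicit, because these generate the source of
  \<open>bal\<close>.\<close>

lemma R_stable:
  assumes f: "is_linear (tensor_space M N) (tensor_space M N) f"
    and "\<And>z v \<chi> w. z \<in> L \<Longrightarrow> v \<in> weight_space M L \<chi> \<Longrightarrow> w \<in> carrier N \<Longrightarrow>
      f (bal (tens (tensor_space M A) N (tens M A v (e z)) w)) \<in> R"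
    and r: "r \<in> R"
  shows "f r \<in> R"
proof -
  obtain t where t: "t \<in> carrier (tensor_space (tensor_space M A) N)" "r = bal t"
    using r unfolding balancing_image_eq by blast
  have "generates N (carrier N)"
    unfolding generates_def using n.AM.N.span_superset by blast
  note g = MA_N.generates_tensor[OF MA.generates_tensor[OF M_gen A_generates] this]
  show ?thesis
    unfolding t(2)
    by (rule generates_linear_mem[OF MA_N.tensor_vector_sp MN.tensor_vector_sp g is_linear_comp[OF bal_linear f] R_subspace _ t(1)])
      (use assms(2) in blast)
qed

lemma R_act:
  assumes "r \<in> R"
  shows "act (tensor M N) x r \<in> R"
proof (rule R_stable[OF MN.tensor_act_linear _ assms])
  fix z v \<chi> w assume z: "z \<in> L" and v: "v \<in> weight_space M L \<chi>" and w: "w \<in> carrier N"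
  let ?T = "tensor_space M N" and ?g = "\<lambda>v w. tens (tensor_space M A) N (tens M A v (e z)) w"
  let ?E = "exp (complex_of_real pi * \<i> * of_int (\<chi> z))"
  note vc = m.weight_spaceD(1)[OF v] and ez = e_closed[OF z]
  note lM = is_linearD[OF lact_e_linear[OF M_am z]] and lN = is_linearD[OF lact_e_linear[OF N_am z]]
  note aM = is_linearD[OF m.M_act_linear] and aN = is_linearD[OF n.M_act_linear]
  have v': "act M x v \<in> weight_space M L \<chi>"
  proof -
    have "act M y (act M x v) = act M x (act M y v)" for y
      using amoduleD(1)[OF M_am] vc by (auto simp: hmodule_iff)
    then show ?thesis using v aM by (simp add: weight_space_def)
  qed
  have w': "act N x w \<in> carrier N" using aN(1) w .
  note vc' = m.weight_spaceD(1)[OF v']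
  have xM: "act M x (lact M (e z) v) = B z x \<odot>\<^bsub>M\<^esub> lact M (e z) v \<oplus>\<^bsub>M\<^esub> lact M (e z) (act M x v)"
    using amoduleD(6)[OF M_am ez vc, of x] is_linearD(3)[OF is_bilinearD(1)[OF amoduleD(3)[OF M_am] vc] ez]
    by (simp only: A_act_e)
  have xN: "act N x (lact N (e z) w) = B z x \<odot>\<^bsub>N\<^esub> lact N (e z) w \<oplus>\<^bsub>N\<^esub> lact N (e z) (act N x w)"
    using amoduleD(6)[OF N_am ez w, of x] is_linearD(3)[OF is_bilinearD(1)[OF amoduleD(3)[OF N_am] w] ez]
    by (simp only: A_act_e)
  note cl = lM(1)[OF vc] lM(1)[OF vc'] lN(1)[OF w] lN(1)[OF w'] vc vc' w w'
  note tcl = MN.tens_closed[OF cl(1) w] MN.tens_closed[OF cl(2) w] MN.tens_closed[OF cl(1) w']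
    MN.tens_closed[OF vc cl(3)] MN.tens_closed[OF vc' cl(3)] MN.tens_closed[OF vc cl(4)]
  \<comment> \<open>The Leibniz rule in both halves: e_z contributes the scalar (z, x), and since x
    v has the same weight as v, the exponential factor does not change.\<close>
  have "act (tensor M N) x (bal (?g v w)) =
      B z x \<odot>\<^bsub>?T\<^esub> bal (?g v w) \<oplus>\<^bsub>?T\<^esub> bal (?g (act M x v) w) \<oplus>\<^bsub>?T\<^esub> bal (?g v (act N x w))"
    unfolding bal_weight[OF z v w] bal_weight[OF z v' w] bal_weight[OF z v w']
    using cl tcl
    by (simp add: is_linearD[OF MN.tensor_act_linear] MN.tensor_act_tens xM xN MN.tens_add_left MN.tens_add_right
        MN.tens_smult_left MN.tens_smult_right T.smult_add_right T.a_ac mult_ac del: tensor_simps)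
  also have "\<dots> \<in> R"
    using T.subspaceD(3)[OF R_subspace] T.subspaceD(4)[OF R_subspace]
      bal_mem[OF z v w] bal_mem[OF z v' w] bal_mem[OF z v w'] by simp
  finally show "act (tensor M N) x (bal (?g v w)) \<in> R" .
qed

abbreviation lT where "lT a \<equiv> tensor_map M N M N (lact M a) (\<lambda>n. n)"

lemma lT_linear: "a \<in> carrier A \<Longrightarrow> is_linear (tensor_space M N) (tensor_space M N) (lT a)"
  by (rule tensor_map_props(1)[OF amoduleD(4)[OF M_am] amoduleD(4)[OF N_am] amoduleD(4)[OF M_am] amoduleD(4)[OF N_am]
        is_bilinearD(2)[OF amoduleD(3)[OF M_am]] is_linear_id])

lemma lT_tens:
  "a \<in> carrier A \<Longrightarrow> v \<in> carrier M \<Longrightarrow> w \<in> carrier N \<Longrightarrow> lT a (tens M N v w) = tens M N (lact M a v) w"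
  by (rule tensor_map_props(2)[OF amoduleD(4)[OF M_am] amoduleD(4)[OF N_am] amoduleD(4)[OF M_am] amoduleD(4)[OF N_am]
        is_bilinearD(2)[OF amoduleD(3)[OF M_am]] is_linear_id])

lemma A_closed:
  "a \<in> carrier A \<Longrightarrow> b \<in> carrier A \<Longrightarrow> a \<oplus>\<^bsub>A\<^esub> b \<in> carrier A"
  "a \<in> carrier A \<Longrightarrow> c \<odot>\<^bsub>A\<^esub> a \<in> carrier A"
  using abelian_groupE(1)[OF Module.module.axioms(2)[OF vector_sp.is_module[OF A_vector_sp]]]
    vector_sp.smult_closed[OF A_vector_sp] by blast+

text \<open>For fixed \<open>a\<close> linearity comes with \<open>tensor_map\<close>; in
  \<open>a\<close> it must be verified on pure tensors, as the map is a definite description for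
  each \<open>a\<close> separately.\<close>

lemma lT_bilinear: "is_bilinear A (tensor_space M N) (tensor_space M N) lT"
proof (rule is_bilinearI)
  note lact = amoduleD(3)[OF M_am]
  note lD = is_linearD[OF is_bilinearD(1)[OF lact]]
  fix a b c s t assume a: "a \<in> carrier A" and t: "t \<in> carrier (tensor_space M N)"
  show "lT a t \<in> carrier (tensor_space M N)" "lT a (c \<odot>\<^bsub>tensor_space M N\<^esub> t) = c \<odot>\<^bsub>tensor_space M N\<^esub> lT a t"
    using is_linearD[OF lT_linear[OF a]] t by auto
  show "lT a (t \<oplus>\<^bsub>tensor_space M N\<^esub> s) = lT a t \<oplus>\<^bsub>tensor_space M N\<^esub> lT a s" if "s \<in> carrier (tensor_space M N)"
    using is_linearD(2)[OF lT_linear[OF a] t that] .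
  show "lT (c \<odot>\<^bsub>A\<^esub> a) t = c \<odot>\<^bsub>tensor_space M N\<^esub> lT a t"
    by (rule MN.tensor_linear_eqI[OF MN.tensor_vector_sp lT_linear[OF A_closed(2)[OF a]]
          is_linear_smult[OF MN.tensor_vector_sp lT_linear[OF a]] _ t])
      (simp only: lT_tens[OF A_closed(2)[OF a]] lT_tens[OF a] lD[OF _ a] MN.tens_smult_left)
  show "lT (a \<oplus>\<^bsub>A\<^esub> b) t = lT a t \<oplus>\<^bsub>tensor_space M N\<^esub> lT b t" if b: "b \<in> carrier A"
    by (rule MN.tensor_linear_eqI[OF MN.tensor_vector_sp lT_linear[OF A_closed(1)[OF a b]]
          is_linear_add[OF MN.tensor_vector_sp lT_linear[OF a] lT_linear[OF b]] _ t])
      (simp only: lT_tens[OF A_closed(1)[OF a b]] lT_tens[OF a] lT_tens[OF b] lD(2)[OF _ a b] lD(1)[OF _ a] lD(1)[OF _ b]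
        MN.tens_add_left)
qed

text \<open>Acting by e_y sends the relation for v to the relation for e_y v. The weight of e_y v
  exceeds that of v by (y, -), which multiplies the braiding factor by e^(pi i (y, z)); exchanging
  e_y with e_z costs \<alpha>(y, z) / \<alpha>(z, y), and this is the same number.\<close>

lemma R_lT:
  assumes a: "a \<in> carrier A" and r: "r \<in> R"
  shows "lT a r \<in> R"
proof -
  have rc: "r \<in> carrier (tensor_space M N)" using T.subspaceD(5)[OF R_subspace r] .
  have "lT (e y) r \<in> R" if y: "y \<in> L" for y
  proof (rule R_stable[OF lT_linear[OF e_closed[OF y]] _ r])
    fix z v \<chi> w assume z: "z \<in> L" and v: "v \<in> weight_space M L \<chi>" and w: "w \<in> carrier N"
    let ?T = "tensor_space M N"
    let ?E = "exp (complex_of_real pi * \<i> * of_int (\<chi> z))"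
    let ?\<chi>' = "\<lambda>z\<in>L. \<chi> z + pc y z"
    note vc = m.weight_spaceD(1)[OF v] and ez = e_closed[OF z] and ey = e_closed[OF y]
    note lz = is_linearD[OF lact_e_linear[OF M_am z]] and ly = is_linearD[OF lact_e_linear[OF M_am y]]
      and lN = is_linearD[OF lact_e_linear[OF N_am z]]
    have v': "lact M (e y) v \<in> weight_space M L ?\<chi>'" by (rule m.lact_e_weight[OF y v])
    note cl = lz(1)[OF vc] ly(1)[OF vc] lN(1)[OF w] ly(1)[OF lz(1)[OF vc]] lz(1)[OF ly(1)[OF vc]]
    have zy: "lact M (e (z + y)) v \<in> carrier M"
      by (rule is_linearD(1)[OF lact_e_linear[OF M_am L_add[OF z y]] vc])
    have pcB: "of_int (pc y z) = B y z" by (rule of_int_pc[OF subsetD[OF L_dual y] z])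
    have "exp (complex_of_real pi * \<i> * of_int (?\<chi>' z)) \<odot>\<^bsub>M\<^esub> lact M (e z) (lact M (e y) v) =
        ?E \<odot>\<^bsub>M\<^esub> lact M (e y) (lact M (e z) v)"
    proof -
      have "exp (complex_of_real pi * \<i> * of_int (?\<chi>' z)) = ?E * exp (complex_of_real pi * \<i> * B y z)"
        using z by (simp add: pcB distrib_left exp_add)
      moreover have "lact M (e z) (lact M (e y) v) = \<alpha> z y \<odot>\<^bsub>M\<^esub> lact M (e (z + y)) v"
        by (rule lact_e_e[OF M_am z y vc])
      moreover have "lact M (e y) (lact M (e z) v) = (exp (complex_of_real pi * \<i> * B y z) * \<alpha> z y) \<odot>\<^bsub>M\<^esub> lact M (e (z + y)) v"
        unfolding lact_e_e[OF M_am y z vc] \<alpha>_swap[OF y z] by (simp only: add.commute[of y z])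
      ultimately show ?thesis using zy by (simp add: mult.assoc)
    qed
    then have "exp (complex_of_real pi * \<i> * of_int (?\<chi>' z)) \<odot>\<^bsub>?T\<^esub> tens M N (lact M (e z) (lact M (e y) v)) w =
        ?E \<odot>\<^bsub>?T\<^esub> tens M N (lact M (e y) (lact M (e z) v)) w"
      using MN.tens_smult_left[OF w cl(5)] MN.tens_smult_left[OF w cl(4)] by metis
    then have "bal (tens (tensor_space M A) N (tens M A (lact M (e y) v) (e z)) w) =
        lT (e y) (bal (tens (tensor_space M A) N (tens M A v (e z)) w))"
      unfolding bal_weight[OF z v w] bal_weight[OF z v' w]
      using cl w vc MN.tens_closed
      by (simp add: is_linearD[OF lT_linear[OF ey]] lT_tens[OF ey] del: A_simps)
    then show "lT (e y) (bal (tens (tensor_space M A) N (tens M A v (e z)) w)) \<in> R"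
      using bal_mem[OF z v' w] by simp
  qed
  \<comment> \<open>For fixed r the action is linear in \<open>a\<close> and \<open>R\<close> is a
    subspace, so the basis vectors e_y suffice.\<close>
  then show ?thesis
    by (intro generates_linear_mem[OF A_vector_sp MN.tensor_vector_sp A_generates is_bilinearD(1)[OF lT_bilinear rc]
          R_subspace _ a]) blast
qed

lemma tensor_over_simps:
  "carrier (tensor_over U A M N) = carrier (quot_space (tensor M N) R)"
  "\<zero>\<^bsub>tensor_over U A M N\<^esub> = \<zero>\<^bsub>quot_space (tensor M N) R\<^esub>"
  "X \<oplus>\<^bsub>tensor_over U A M N\<^esub> Y = X \<oplus>\<^bsub>quot_space (tensor M N) R\<^esub> Y"
  "c \<odot>\<^bsub>tensor_over U A M N\<^esub> X = c \<odot>\<^bsub>quot_space (tensor M N) R\<^esub> X"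
  "act (tensor_over U A M N) x = quot_map (tensor M N) R (act (tensor M N) x)"
  "lact (tensor_over U A M N) a = quot_map (tensor M N) R (lT a)"
  by (simp_all add: tensor_over_def Let_def module.defs hmod.defs amod.defs)

lemma R_record_subspace: "submodule R cfield (tensor M N)"
  by (subst submodule_cong[OF MN.tensor_vector_sp tensor_record_vector_sp(4)]) (simp_all add: R_subspace)

lemma tensor_over_amodule: "amodule sc A (tensor_over U A M N)"
proof (rule amodule_quotient[OF MN.tensor_hmodule MN.tensor_locally_finite[OF amoduleD(2)[OF M_am] amoduleD(2)[OF N_am]],
      where l = lT and R = R])
  show "is_bilinear A (tensor M N) (tensor M N) lT"
    using lT_bilinear by (simp add: is_bilinear_def is_linear_def del: A_simps)
  show "act (tensor M N) x r \<in> R" if "r \<in> R" for x r by (rule R_act[OF that])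
  show "lT a r \<in> R" if "a \<in> carrier A" "r \<in> R" for a r by (rule R_lT[OF that])
  show "submodule R cfield (tensor M N)" by (rule R_record_subspace)
  show "\<one>\<^bsub>A\<^esub> \<in> carrier A" by simp
  show Aact: "act A x a \<in> carrier A" if "a \<in> carrier A" for x a by (rule is_linearD(1)[OF A_act_linear that])
  show "a \<otimes>\<^bsub>A\<^esub> b \<in> carrier A" if "a \<in> carrier A" "b \<in> carrier A" for a b by (rule A_mult_closed[OF that])
  show "a \<oplus>\<^bsub>A\<^esub> b \<in> carrier A" if "a \<in> carrier A" "b \<in> carrier A" for a b by (rule A_closed(1)[OF that])
  show "c \<odot>\<^bsub>A\<^esub> a \<in> carrier A" if "a \<in> carrier A" for c a by (rule A_closed(2)[OF that])
  note lc = is_bilinearD(3)[OF amoduleD(3)[OF M_am]]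
  note lT_c = is_linearD[OF lT_linear] and aT = is_linearD[OF MN.tensor_act_linear]
  note aM = is_linearD[OF m.M_act_linear] and aN = is_linearD[OF n.M_act_linear]
  fix a t assume a: "a \<in> carrier A" and "t \<in> carrier (tensor M N)"
  then have t: "t \<in> carrier (tensor_space M N)" by simp
  show "act (tensor M N) x (lT a t) = lT (act A x a) t \<oplus>\<^bsub>tensor M N\<^esub> lT a (act (tensor M N) x t)" for x
    unfolding tensor_simps(3)
  proof (rule MN.tensor_linear_eqI[OF MN.tensor_vector_sp is_linear_comp[OF lT_linear[OF a] MN.tensor_act_linear]
        is_linear_add[OF MN.tensor_vector_sp lT_linear[OF Aact[OF a]] is_linear_comp[OF MN.tensor_act_linear lT_linear[OF a]]] _ t])
    fix v w assume v: "v \<in> carrier M" and w: "w \<in> carrier N"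
    have c: "lact M a v \<in> carrier M" "lact M (act A x a) v \<in> carrier M" "lact M a (act M x v) \<in> carrier M"
      "act M x v \<in> carrier M" "act N x w \<in> carrier N"
      using lc[OF a] lc[OF Aact[OF a]] v w aM(1) aN(1) by simp_all
    show "act (tensor M N) x (lT a (tens M N v w)) =
        lT (act A x a) (tens M N v w) \<oplus>\<^bsub>tensor_space M N\<^esub> lT a (act (tensor M N) x (tens M N v w))"
      unfolding lT_tens[OF a v w] lT_tens[OF Aact[OF a] v w] MN.tensor_act_tens[OF v w] MN.tensor_act_tens[OF c(1) w]
        lT_c(2)[OF a MN.tens_closed[OF c(4) w] MN.tens_closed[OF v c(5)]]
        lT_tens[OF a c(4) w] lT_tens[OF a v c(5)] amoduleD(6)[OF M_am a v] MN.tens_add_left[OF w c(2,3)]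
      by (rule T.a_assoc) (use c w in auto)
  qed
  show "lT (a \<otimes>\<^bsub>A\<^esub> b) t = lT a (lT b t)" if b: "b \<in> carrier A" for b
  proof (rule MN.tensor_linear_eqI[OF MN.tensor_vector_sp lT_linear[OF A_mult_closed[OF a b]]
        is_linear_comp[OF lT_linear[OF b] lT_linear[OF a]] _ t])
    fix v w assume v: "v \<in> carrier M" and w: "w \<in> carrier N"
    show "lT (a \<otimes>\<^bsub>A\<^esub> b) (tens M N v w) = lT a (lT b (tens M N v w))"
      unfolding lT_tens[OF A_mult_closed[OF a b] v w] lT_tens[OF b v w] lT_tens[OF a lc[OF b v] w]
        amoduleD(7)[OF M_am a b v] ..
  qed
next
  fix t assume "t \<in> carrier (tensor M N)"
  then have t: "t \<in> carrier (tensor_space M N)" by simp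
  have o: "\<one>\<^bsub>A\<^esub> \<in> carrier A" by simp
  show "lT \<one>\<^bsub>A\<^esub> t = t"
    by (rule MN.tensor_linear_eqI[OF MN.tensor_vector_sp lT_linear[OF o] is_linear_id _ t])
      (use lT_tens[OF o] amoduleD(8)[OF M_am] in simp)
qed (fact tensor_over_simps)+

lemma tensor_weight:
  assumes v: "v \<in> weight_space M L \<chi>" and w: "w \<in> weight_space N L \<psi>"
  shows "tens M N v w \<in> weight_space (tensor M N) L (\<lambda>y\<in>L. \<chi> y + \<psi> y)"
proof -
  note vc = m.weight_spaceD(1)[OF v] and wc = n.weight_spaceD(1)[OF w]
  have "act (tensor M N) y (tens M N v w) = of_int (\<chi> y + \<psi> y) \<odot>\<^bsub>tensor_space M N\<^esub> tens M N v w" if y: "y \<in> L" for y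
    unfolding MN.tensor_act_tens[OF vc wc] m.weight_spaceD(2)[OF v y] n.weight_spaceD(2)[OF w y]
      MN.tens_smult_left[OF wc vc] MN.tens_smult_right[OF vc wc] T.add_smult_self[OF MN.tens_closed[OF vc wc]] by simp
  then show ?thesis using MN.tens_closed[OF vc wc] by (simp add: weight_space_def del: tensor_simps(5))
qed

text \<open>Tensors of weight vectors span M \<otimes> N, and the projection is onto and respects
  the action, so their images span the quotient and keep their weights, even if some become
  zero.\<close>

lemma tensor_over_generates:
  assumes N_gen: "generates N (\<Union>\<psi>\<in>\<Psi>. weight_space N L \<psi>)"
    and add: "\<And>\<chi> \<psi>. \<chi> \<in> \<Xi> \<Longrightarrow> \<psi> \<in> \<Psi> \<Longrightarrow> (\<lambda>y\<in>L. \<chi> y + \<psi> y) \<in> \<Theta>"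
  shows "generates (tensor_over U A M N) (\<Union>\<theta>\<in>\<Theta>. weight_space (tensor_over U A M N) L \<theta>)"
proof -
  interpret Tr: vector_sp "tensor M N" by (rule tensor_record_vector_sp(4))
  let ?Q = "tensor_over U A M N" and ?q = "\<lambda>t. R +>\<^bsub>tensor M N\<^esub> t"
  have Qv: "vector_sp ?Q" by (rule amoduleD(4)[OF tensor_over_amodule])
  interpret Q: vector_sp ?Q by (rule Qv)
  have ql: "is_linear (tensor M N) ?Q ?q"
    using Tr.quot_proj_linear[OF R_record_subspace] by (simp add: is_linear_def tensor_over_simps del: tensor_simps)
  have qs: "?q ` carrier (tensor M N) = carrier ?Q"
    unfolding tensor_over_simps Tr.quot_carrier[OF R_record_subspace] ..
  have Tg: "generates (tensor M N) {tens M N v w | v w. v \<in> (\<Union>\<chi>\<in>\<Xi>. weight_space M L \<chi>) \<and> w \<in> (\<Union>\<psi>\<in>\<Psi>. weight_space N L \<psi>)}"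
    using MN.generates_tensor[OF M_gen N_gen] generates_subspace[OF MN.tensor_vector_sp MN.generates_tensor[OF M_gen N_gen]]
      submodule_cong[OF MN.tensor_vector_sp tensor_record_vector_sp(4)]
    by (intro generatesI[OF tensor_record_vector_sp(4)]) (simp_all add: generates_def)
  note g = generates_image[OF Tr.vector_sp_axioms Qv Tg ql qs]
  have sub: "(\<Union>\<theta>\<in>\<Theta>. weight_space ?Q L \<theta>) \<subseteq> carrier ?Q" by (auto simp: weight_space_def)
  have act: "act ?Q x (?q t) = ?q (act (tensor M N) x t)" if "t \<in> carrier (tensor M N)" for x t
    unfolding tensor_over_simps
    by (rule Tr.quot_map_coset[OF R_record_subspace _ R_act that]) (simp add: MN.tensor_act_linear del: tensor_simps)
  show ?thesis
  proof (rule generates_mono[OF Qv g sub])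
    fix s assume "s \<in> ?q ` {tens M N v w | v w. v \<in> (\<Union>\<chi>\<in>\<Xi>. weight_space M L \<chi>) \<and> w \<in> (\<Union>\<psi>\<in>\<Psi>. weight_space N L \<psi>)}"
    then obtain v w \<chi> \<psi> where s: "s = ?q (tens M N v w)" "v \<in> weight_space M L \<chi>" "w \<in> weight_space N L \<psi>"
      "\<chi> \<in> \<Xi>" "\<psi> \<in> \<Psi>" by blast
    note tw = tensor_weight[OF s(2,3)]
    have tc: "tens M N v w \<in> carrier (tensor M N)" using tw unfolding weight_space_def by blast
    have "s \<in> weight_space ?Q L (\<lambda>y\<in>L. \<chi> y + \<psi> y)"
      unfolding s(1) weight_space_def
    proof (intro CollectI conjI ballI)
      show "?q (tens M N v w) \<in> carrier ?Q" using qs tc by blast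
      fix y assume y: "y \<in> L"
      have "act (tensor M N) y (tens M N v w) = of_int ((\<lambda>y\<in>L. \<chi> y + \<psi> y) y) \<odot>\<^bsub>tensor M N\<^esub> tens M N v w"
        using tw y unfolding weight_space_def by blast
      then show "act ?Q y (?q (tens M N v w)) = of_int ((\<lambda>y\<in>L. \<chi> y + \<psi> y) y) \<odot>\<^bsub>?Q\<^esub> ?q (tens M N v w)"
        unfolding act[OF tc] by (simp only: is_linearD(3)[OF ql tc])
    qed
    then show "s \<in> lin_span ?Q (\<Union>\<theta>\<in>\<Theta>. weight_space ?Q L \<theta>)"
      using Q.span_superset add[OF s(4,5)] by blast
  qed
qed

end

text \<open>Going through \<open>graded_iff\<close> in both directions, only generation by weights
  has to be tracked; locality of the product, its support and the case where it is zero all come out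
  of the criterion.\<close>

lemma (in even_lattice) tensor_over_graded:
  assumes X: "X \<in> carrier G" and Y: "Y \<in> carrier G"
    and M: "M \<in> local_modules_graded sc B L A X" and N: "N \<in> local_modules_graded sc B L A Y"
  shows "tensor_over U A M N \<in> local_modules_graded sc B L A (X \<otimes>\<^bsub>G\<^esub> Y)"
proof -
  have am: "amodule sc A M" "amodule sc A N"
    using M N by (simp_all add: local_modules_graded_def local_modules_def)
  interpret m: lattice_amodule sc Bs B L \<alpha> M by unfold_locales (rule am)
  interpret n: lattice_amodule sc Bs B L \<alpha> N by unfold_locales (rule am)
  interpret lattice_amodule_pair sc Bs B L \<alpha> M N "pc ` X"
    by unfold_locales (use am m.graded_iff[OF X] M in blast)+
  interpret q: lattice_amodule sc Bs B L \<alpha> "tensor_over U A M N"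
    by unfold_locales (rule tensor_over_amodule)
  have "generates N (\<Union>\<psi>\<in>pc ` Y. weight_space N L \<psi>)" using n.graded_iff[OF Y] N by blast
  then have "generates (tensor_over U A M N) (\<Union>\<theta>\<in>pc ` (X \<otimes>\<^bsub>G\<^esub> Y). weight_space (tensor_over U A M N) L \<theta>)"
  proof (rule tensor_over_generates)
    fix \<chi> \<psi> assume "\<chi> \<in> pc ` X" "\<psi> \<in> pc ` Y"
    then obtain x y where xy: "\<chi> = pc x" "x \<in> X" "\<psi> = pc y" "y \<in> Y" by blast
    have d: "x \<in> D" "y \<in> D" using G_class_dual[OF X] G_class_dual[OF Y] xy by auto
    show "(\<lambda>z\<in>L. \<chi> z + \<psi> z) \<in> pc ` (X \<otimes>\<^bsub>G\<^esub> Y)"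
      unfolding xy(1,3) pc_add[OF d] by (rule imageI[OF G_mult_mem(2)[OF X Y xy(2,4)]])
  qed
  then show ?thesis using q.graded_iff[OF G_mult_mem(1)[OF X Y]] by blast
qed

section \<open>Splitting a local module over the classes, and morphisms between different
  degrees\<close>

section \<open>Decomposition of the category\<close>

text \<open>The projection onto \<open>S\<close> along \<open>S'\<close>. Its uniqueness clause
  yields linearity here, and later both the values of the projection and its commutation with the
  actions.\<close>

lemma (in vector_sp) complement_projection:
  assumes S: "submodule S cfield V" and S': "submodule S' cfield V"
    and disj: "\<And>v. v \<in> S \<Longrightarrow> v \<in> S' \<Longrightarrow> v = \<zero>"
    and ex: "\<And>v. v \<in> carrier V \<Longrightarrow> \<exists>a\<in>S. v \<oplus> (-1) \<odot> a \<in> S'"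
  shows "\<exists>p. is_linear V V p \<and> (\<forall>v\<in>carrier V. p v \<in> S \<and> v \<oplus> (-1) \<odot> p v \<in> S') \<and>
    (\<forall>v\<in>carrier V. \<forall>a\<in>S. v \<oplus> (-1) \<odot> a \<in> S' \<longrightarrow> p v = a)"
proof -
  note SD = subspaceD[OF S] and SD' = subspaceD[OF S']
  obtain p where p: "\<forall>v\<in>carrier V. p v \<in> S \<and> v \<oplus> (-1) \<odot> p v \<in> S'"
    using bchoice[of "carrier V" "\<lambda>v a. a \<in> S \<and> v \<oplus> (-1) \<odot> a \<in> S'"] ex by blast
  have u: "p v = a" if v: "v \<in> carrier V" and a: "a \<in> S" "v \<oplus> (-1) \<odot> a \<in> S'" for v a
  proof -
    have pv: "p v \<in> S" "v \<oplus> (-1) \<odot> p v \<in> S'" using p v by auto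
    note cl = v SD(5)[OF a(1)] SD(5)[OF pv(1)]
    have "(v \<oplus> (-1) \<odot> a) \<oplus> (-1) \<odot> (v \<oplus> (-1) \<odot> p v) = (v \<oplus> (-1) \<odot> v) \<oplus> (p v \<oplus> (-1) \<odot> a)"
      using cl by (simp add: smult_add_right a_ac)
    also have "\<dots> = p v \<oplus> (-1) \<odot> a" using cl by (simp add: add_eq_zero_iff[THEN iffD2])
    finally have "p v \<oplus> (-1) \<odot> a \<in> S'" using SD'(3)[OF a(2) SD'(4)[OF pv(2)]] by metis
    moreover have "p v \<oplus> (-1) \<odot> a \<in> S" using SD(3,4) a(1) pv(1) by blast
    ultimately have "p v \<oplus> (-1) \<odot> a = \<zero>" by (intro disj)
    then show ?thesis using add_eq_zero_iff cl by blast
  qed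
  have "is_linear V V p"
  proof (rule is_linearI)
    fix v assume v: "v \<in> carrier V"
    then have pv: "p v \<in> S" "v \<oplus> (-1) \<odot> p v \<in> S'" using p by auto
    show "p v \<in> carrier V" by (rule SD(5)[OF pv(1)])
    show "p (c \<odot> v) = c \<odot> p v" for c
    proof (rule u[OF smult_closed[OF v] SD(4)[OF pv(1)]])
      have "c \<odot> v \<oplus> (-1) \<odot> (c \<odot> p v) = c \<odot> (v \<oplus> (-1) \<odot> p v)"
        using v SD(5)[OF pv(1)] by (simp add: smult_add_right mult.commute)
      then show "c \<odot> v \<oplus> (-1) \<odot> (c \<odot> p v) \<in> S'" using SD'(4)[OF pv(2)] by simp
    qed
    show "p (v \<oplus> w) = p v \<oplus> p w" if w: "w \<in> carrier V" for w
    proof -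
      have pw: "p w \<in> S" "w \<oplus> (-1) \<odot> p w \<in> S'" using p w by auto
      have "(v \<oplus> w) \<oplus> (-1) \<odot> (p v \<oplus> p w) = (v \<oplus> (-1) \<odot> p v) \<oplus> (w \<oplus> (-1) \<odot> p w)"
        using v w SD(5)[OF pv(1)] SD(5)[OF pw(1)] by (simp add: smult_add_right a_ac)
      then show ?thesis using u[OF a_closed[OF v w] SD(3)[OF pv(1) pw(1)]] SD'(3)[OF pv(2) pw(2)] by simp
    qed
  qed
  then show ?thesis using p u by blast
qed

lemma amodule_submodule:
  fixes M :: "('h::ab_group_add, 'a, 'v) amod"
  assumes M: "amodule sc A M" and W: "submodule W cfield M"
    "\<And>x w. w \<in> W \<Longrightarrow> act M x w \<in> W" "\<And>a w. a \<in> carrier A \<Longrightarrow> w \<in> W \<Longrightarrow> lact M a w \<in> W"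
  shows "amodule sc A (M\<lparr>carrier := W\<rparr>)"
proof -
  have hM: "hmodule sc M" and lf: "locally_finite M" and l: "is_bilinear A M M (lact M)"
    using M by (simp_all add: amodule_iff)
  interpret vector_sp M using hM by (simp add: hmodule_iff)
  have c: "w \<in> carrier M" if "w \<in> W" for w using subspaceD(5)[OF W(1) that] .
  have hW: "hmodule sc (M\<lparr>carrier := W\<rparr>)"
    using hM subspace_vector_sp[OF W(1)] W(2) c by (auto simp: hmodule_iff is_linear_def)
  have "locally_finite (M\<lparr>carrier := W\<rparr>)"
    unfolding locally_finite_iff[OF hW]
    using lf[unfolded locally_finite_iff[OF hM]] c killed_cong[of "M\<lparr>carrier := W\<rparr>" M] by simp
  then show ?thesis
    using M hW W(3) c by (auto simp: amodule_iff is_bilinear_def is_linear_def)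
qed

context lattice_amodule
begin

lemma wspan_linear_stable:
  assumes f: "is_linear M M f" and "\<And>v \<chi>. \<chi> \<in> \<Xi> \<Longrightarrow> v \<in> weight_space M L \<chi> \<Longrightarrow> f v \<in> wspan \<Xi>'"
    and "w \<in> wspan \<Xi>"
  shows "f w \<in> wspan \<Xi>'"
proof -
  note D = AM.N.subspaceD[OF wspan_subspace] and fD = is_linearD[OF f]
  have "submodule {w \<in> carrier M. f w \<in> wspan \<Xi>'} cfield M"
    by (rule AM.N.subspaceI)
      (auto simp only: mem_Collect_eq fD D AM.N.zero_closed AM.N.a_closed AM.N.smult_closed
        is_linear_zero[OF AM.N.vector_sp_axioms AM.N.vector_sp_axioms f])
  moreover have "weights \<Xi> \<subseteq> {w \<in> carrier M. f w \<in> wspan \<Xi>'}"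
    using assms(2) weight_spaceD(1) by blast
  ultimately have "wspan \<Xi> \<subseteq> {w \<in> carrier M. f w \<in> wspan \<Xi>'}" by (rule AM.N.span_minimal)
  then show ?thesis using assms(3) by blast
qed

lemma wspan_act: "w \<in> wspan \<Xi> \<Longrightarrow> act M x w \<in> wspan \<Xi>"
proof (rule wspan_linear_stable[OF M_act_linear])
  fix v \<chi> assume \<chi>: "\<chi> \<in> \<Xi>" and v: "v \<in> weight_space M L \<chi>"
  have "act M y (act M x v) = act M x (act M y v)" for y
    using M_hmodule weight_spaceD(1)[OF v] by (auto simp: hmodule_iff)
  then have "act M x v \<in> weight_space M L \<chi>"
    using v is_linearD[OF M_act_linear] by (simp add: weight_space_def)
  then show "act M x v \<in> wspan \<Xi>" by (rule wspan_base[OF \<chi>])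
qed

lemma wspan_lact:
  assumes \<Xi>: "\<Xi> \<subseteq> pc ` D" "\<And>x y. x \<in> D \<Longrightarrow> pc x \<in> \<Xi> \<Longrightarrow> y \<in> L \<Longrightarrow> pc (x + y) \<in> \<Xi>"
    and a: "a \<in> carrier A" and w: "w \<in> wspan \<Xi>"
  shows "lact M a w \<in> wspan \<Xi>"
proof -
  have wc: "w \<in> carrier M" by (rule AM.N.subspaceD(5)[OF wspan_subspace w])
  have "lact M (e y) w \<in> wspan \<Xi>" if y: "y \<in> L" for y
  proof (rule wspan_linear_stable[OF lact_e_linear[OF M_amodule y] _ w])
    fix v \<chi> assume \<chi>: "\<chi> \<in> \<Xi>" and v: "v \<in> weight_space M L \<chi>"
    obtain x where x: "x \<in> D" "\<chi> = pc x" using \<chi> \<Xi>(1) by blast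
    have yD: "y \<in> D" by (rule subsetD[OF L_dual y])
    have "lact M (e y) v \<in> weight_space M L (pc (x + y))"
      using lact_e_weight[OF y v] unfolding x(2) pc_add[OF x(1) yD] .
    moreover have "pc (x + y) \<in> \<Xi>" by (rule \<Xi>(2)[OF x(1) _ y]) (use \<chi> x(2) in simp)
    ultimately show "lact M (e y) v \<in> wspan \<Xi>" by (intro wspan_base)
  qed
  then show ?thesis
    by (intro generates_linear_mem[OF A_vector_sp AM.N.vector_sp_axioms A_generates
          is_bilinearD(1)[OF amoduleD(3)[OF M_amodule] wc] wspan_subspace _ a]) blast
qed

text \<open>Translation by \<open>L\<close> can be undone, so the characters of a class and the dual
  characters outside it are both closed under it. Hence both summands of the splitting for one class
  are stable under \<open>A\<close>.\<close>

lemma pc_shift: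
  assumes "X \<in> carrier G" "x \<in> D" "y \<in> L"
  shows "pc (x + y) \<in> pc ` X \<longleftrightarrow> pc x \<in> pc ` X"
proof -
  obtain X' where X': "X' \<in> carrier G" "x \<in> X'" using G_class_mem[OF assms(2)] by blast
  have xy: "x + y \<in> X'" by (rule G_class_translate[OF X' assms(3)])
  have "X' = X" if "pc (x + y) \<in> pc ` X"
    using that G_class_disjoint[OF X'(1) assms(1) xy] by blast
  moreover have "X' = X" if "pc x \<in> pc ` X"
    using that G_class_disjoint[OF X'(1) assms(1) X'(2)] by blast
  ultimately show ?thesis using xy X'(2) by blast
qed

definition component :: "'h set \<Rightarrow> ('h, 'h \<Rightarrow>\<^sub>0 complex, 'v) amod" where
  "component X = M\<lparr>carrier := wspan (pc ` X)\<rparr>"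

lemma class_lact:
  "X \<in> carrier G \<Longrightarrow> a \<in> carrier A \<Longrightarrow> w \<in> wspan (pc ` X) \<Longrightarrow> lact M a w \<in> wspan (pc ` X)"
  by (rule wspan_lact[OF image_mono[OF G_class_dual]]) (simp_all only: pc_shift)

lemma coclass_lact:
  "X \<in> carrier G \<Longrightarrow> a \<in> carrier A \<Longrightarrow> w \<in> wspan (pc ` D - pc ` X) \<Longrightarrow> lact M a w \<in> wspan (pc ` D - pc ` X)"
proof (rule wspan_lact[OF Diff_subset])
  fix x y assume X: "X \<in> carrier G" and x: "x \<in> D" "pc x \<in> pc ` D - pc ` X" and y: "y \<in> L"
  have "x + y \<in> D" by (rule dual_add[OF x(1) subsetD[OF L_dual y]])
  then show "pc (x + y) \<in> pc ` D - pc ` X" using pc_shift[OF X x(1) y] x(2) by blast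
qed

lemma component_graded:
  assumes X: "X \<in> carrier G"
  shows "component X \<in> local_modules_graded sc B L A X"
proof -
  have "amodule sc A (component X)"
    unfolding component_def
    by (rule amodule_submodule[OF M_amodule wspan_subspace wspan_act class_lact[OF X]])
  then interpret c: lattice_amodule sc Bs B L \<alpha> "component X" by unfold_locales
  have "generates (component X) (c.weights (pc ` X))"
  \<comment> \<open>Spans refer to the record, so generation has to be shown again inside the
    smaller carrier, by comparing subspaces of the two.\<close>
  proof (rule generatesI[OF c.AM.N.vector_sp_axioms c.weights_subset])
    fix W assume W: "submodule W cfield (component X)" "c.weights (pc ` X) \<subseteq> W"
    note D = c.AM.N.subspaceD[OF W(1)]
    have "carrier (component X) = wspan (pc ` X)" by (simp add: component_def)
    then have "W \<subseteq> carrier M" using D(1) AM.N.subspaceD(1)[OF wspan_subspace[of "pc ` X"]] by (simp only:)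
    then have "submodule W cfield M"
      by (rule AM.N.subspaceI) (use D(2-4) in \<open>simp_all add: component_def\<close>)
    moreover have "weights (pc ` X) \<subseteq> W"
    proof
      fix v assume "v \<in> weights (pc ` X)"
      then obtain \<chi> where \<chi>: "\<chi> \<in> pc ` X" "v \<in> weight_space M L \<chi>" by blast
      then have "v \<in> weight_space (component X) L \<chi>"
        using wspan_base[OF \<chi>] by (simp add: weight_space_def component_def)
      then show "v \<in> W" using W(2) \<chi>(1) by blast
    qed
    ultimately have "wspan (pc ` X) \<subseteq> W" by (rule AM.N.span_minimal)
    then show "carrier (component X) \<subseteq> W" by (simp add: component_def)
  qed
  then show ?thesis using c.graded_iff[OF X] by blast
qed

text \<open>For a single class the complement is the span of all remaining weights, so each
  projection exists without reference to the infinite direct sum. The isomorphism collects all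
  projections; \<open>recon\<close> provides finite support and recovers m.\<close>

lemma local_decomposition:
  assumes loc: "M \<in> local_modules sc U A"
  shows "amod_iso A M (direct_sum (carrier G) component)"
proof -
  let ?I = "carrier G" and ?S = "\<lambda>X. wspan (pc ` X)" and ?S' = "\<lambda>X. wspan (pc ` D - pc ` X)"
  note gen = local_generates[OF loc]
  note D = AM.N.subspaceD[OF wspan_subspace]
  have ext: "pc ` Z \<subseteq> extensional L" for Z using pc_ext by blast
  \<comment> \<open>Packs what is known of one projection, so that a family over all classes can be
    chosen at once.\<close>
  define proj where "proj X p \<longleftrightarrow> is_linear M M p \<and>
    (\<forall>v\<in>carrier M. p v \<in> ?S X \<and> v \<oplus> (-1) \<odot> p v \<in> ?S' X) \<and>
    (\<forall>v\<in>carrier M. \<forall>a\<in>?S X. v \<oplus> (-1) \<odot> a \<in> ?S' X \<longrightarrow> p v = a)" for X p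
  have ex: "\<exists>p. proj X p" if X: "X \<in> ?I" for X
    unfolding proj_def
  proof (rule AM.N.complement_projection[OF wspan_subspace wspan_subspace])
    show "v = \<zero>" if "v \<in> ?S X" "v \<in> ?S' X" for v
      by (rule wspan_disjoint[OF ext _ _ that]) (use ext in blast)+
    show "\<exists>a\<in>?S X. v \<oplus> (-1) \<odot> a \<in> ?S' X" if "v \<in> carrier M" for v
      using gen that
    proof (induction rule: generates_induct)
      case vector show ?case by (rule AM.N.vector_sp_axioms)
    next
      case zero
      have eq: "\<zero> \<oplus> (-1) \<odot> \<zero> = \<zero>" by simp
      have "\<zero> \<oplus> (-1) \<odot> \<zero> \<in> ?S' X" unfolding eq by (rule D(2))
      then show ?case by (rule bexI[OF _ D(2)])
    next
      case (base v)
      then obtain \<chi> where \<chi>: "\<chi> \<in> pc ` D" "v \<in> weight_space M L \<chi>" by blast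
      note vc = weight_spaceD(1)[OF \<chi>(2)]
      show ?case
      proof (cases "\<chi> \<in> pc ` X")
        case True
        have eq: "v \<oplus> (-1) \<odot> v = \<zero>" using vc by (simp only: AM.N.add_eq_zero_iff)
        have "v \<oplus> (-1) \<odot> v \<in> ?S' X" unfolding eq by (rule D(2))
        then show ?thesis by (rule bexI[OF _ wspan_base[OF True \<chi>(2)]])
      next
        case False
        have eq: "v \<oplus> (-1) \<odot> \<zero> = v" using vc by simp
        have "v \<oplus> (-1) \<odot> \<zero> \<in> ?S' X"
          unfolding eq by (rule wspan_base[OF DiffI[OF \<chi>(1) False] \<chi>(2)])
        then show ?thesis by (rule bexI[OF _ D(2)])
      qed
    next
      case (add v w)
      then obtain a b where ab: "a \<in> ?S X" "v \<oplus> (-1) \<odot> a \<in> ?S' X"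
        "b \<in> ?S X" "w \<oplus> (-1) \<odot> b \<in> ?S' X" by blast
      have "(v \<oplus> w) \<oplus> (-1) \<odot> (a \<oplus> b) =
          (v \<oplus> (-1) \<odot> a) \<oplus> (w \<oplus> (-1) \<odot> b)"
        using add(1,2) D(5)[OF ab(1)] D(5)[OF ab(3)] by (simp add: AM.N.smult_add_right AM.N.a_ac)
      also have "\<dots> \<in> ?S' X" by (rule D(3)[OF ab(2,4)])
      finally show ?case using D(3)[OF ab(1,3)] by blast
    next
      case (smult c v)
      then obtain a where a: "a \<in> ?S X" "v \<oplus> (-1) \<odot> a \<in> ?S' X" by blast
      have "c \<odot> v \<oplus> (-1) \<odot> (c \<odot> a) = c \<odot> (v \<oplus> (-1) \<odot> a)"
        using smult(1) D(5)[OF a(1)] by (simp add: AM.N.smult_add_right mult.commute)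
      also have "\<dots> \<in> ?S' X" by (rule D(4)[OF a(2)])
      finally show ?case using D(4)[OF a(1)] by blast
    qed
  qed
  obtain p where p: "\<forall>X\<in>?I. proj X (p X)"
    using bchoice[of ?I proj] ex by blast
  note p = p[unfolded proj_def]
  have pl: "is_linear M M (p X)" if "X \<in> ?I" for X by (rule conjunct1[OF bspec[OF p that]])
  note pD = is_linearD[OF pl]
  have pS: "p X v \<in> ?S X" "v \<oplus> (-1) \<odot> p X v \<in> ?S' X" if "X \<in> ?I" "v \<in> carrier M" for X v
  proof -
    note q = bspec[OF conjunct1[OF conjunct2[OF bspec[OF p that(1)]]] that(2)]
    show "p X v \<in> ?S X" by (rule conjunct1[OF q])
    show "v \<oplus> (-1) \<odot> p X v \<in> ?S' X" by (rule conjunct2[OF q])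
  qed
  have pu: "p X v = a" if "X \<in> ?I" "v \<in> carrier M" "a \<in> ?S X" "v \<oplus> (-1) \<odot> a \<in> ?S' X" for X v a
    by (rule mp[OF bspec[OF bspec[OF conjunct2[OF conjunct2[OF bspec[OF p that(1)]]] that(2)] that(3)] that(4)])
  have p_same: "p X v = v" if X: "X \<in> ?I" and v: "v \<in> ?S X" for X v
  proof (rule pu[OF X D(5)[OF v] v])
    have eq: "v \<oplus> (-1) \<odot> v = \<zero>" using D(5)[OF v] by (simp only: AM.N.add_eq_zero_iff)
    show "v \<oplus> (-1) \<odot> v \<in> ?S' X" unfolding eq by (rule D(2))
  qed
  \<comment> \<open>The characters of \<open>Y\<close> avoid those of \<open>X\<close>, so v lies in
    the complement for \<open>X\<close>, and zero plus v is its splitting.\<close>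
  have p_other: "p X v = \<zero>" if X: "X \<in> ?I" and Y: "Y \<in> ?I" "Y \<noteq> X" and v: "v \<in> ?S Y" for X Y v
  proof (rule pu[OF X D(5)[OF v] D(2)])
    have "pc y \<notin> pc ` X" if "y \<in> Y" for y
      using G_class_disjoint[OF X Y(1) _ that] Y(2) by force
    then have "pc ` Y \<subseteq> pc ` D - pc ` X" using G_class_dual[OF Y(1)] by auto
    then have v': "v \<in> ?S' X" by (rule subsetD[OF wspan_mono v])
    have eq: "v \<oplus> (-1) \<odot> \<zero> = v" using D(5)[OF v] by simp
    show "v \<oplus> (-1) \<odot> \<zero> \<in> ?S' X" unfolding eq by (rule v')
  qed
  \<comment> \<open>Applying f to the two parts of v gives an admissible splitting of f v, and there
    is only one.\<close>
  have p_commute: "p X (f v) = f (p X v)"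
    if f: "is_linear M M f" "\<And>w. w \<in> ?S X \<Longrightarrow> f w \<in> ?S X" "\<And>w. w \<in> ?S' X \<Longrightarrow> f w \<in> ?S' X"
      and X: "X \<in> ?I" and v: "v \<in> carrier M" for f X v
  proof (rule pu[OF X is_linearD(1)[OF f(1) v] f(2)[OF pS(1)[OF X v]]])
    have eq: "f v \<oplus> (-1) \<odot> f (p X v) = f (v \<oplus> (-1) \<odot> p X v)"
      using v pD(1)[OF X v] by (simp add: is_linearD[OF f(1)])
    show "f v \<oplus> (-1) \<odot> f (p X v) \<in> ?S' X" unfolding eq by (rule f(3)[OF pS(2)[OF X v]])
  qed
  have weight_class: "\<exists>X\<in>?I. v \<in> ?S X" if "v \<in> weights (pc ` D)" for v
  proof -
    obtain x where x: "x \<in> D" "v \<in> weight_space M L (pc x)" using \<open>v \<in> weights (pc ` D)\<close> by blast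
    obtain X where X: "X \<in> ?I" "x \<in> X" using G_class_mem[OF x(1)] by blast
    have "pc x \<in> pc ` X" using X(2) by (rule imageI)
    from wspan_base[OF this x(2)] show ?thesis using X(1) by (rule bexI)
  qed
  \<comment> \<open>\<open>K\<close> bounds the classes in which m has a non-zero part. Demanding
    the reconstruction over every finite \<open>J\<close> above \<open>K\<close> lets two vectors
    with different bounds be added or compared over the union.\<close>
  define good where "good m K \<longleftrightarrow> finite K \<and> K \<subseteq> ?I \<and> (\<forall>X\<in>?I - K. p X m = \<zero>) \<and>
      (\<forall>J. finite J \<longrightarrow> K \<subseteq> J \<longrightarrow> J \<subseteq> ?I \<longrightarrow> m = (\<Oplus>X\<in>J. p X m))" for m K
  have goodI: "good m K" if "finite K" "K \<subseteq> ?I" "\<And>X. X \<in> ?I - K \<Longrightarrow> p X m = \<zero>"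
    "\<And>J. finite J \<Longrightarrow> K \<subseteq> J \<Longrightarrow> J \<subseteq> ?I \<Longrightarrow> m = (\<Oplus>X\<in>J. p X m)" for m K
    unfolding good_def by (intro conjI ballI allI impI) (fact that)+
  have goodD: "finite K" "K \<subseteq> ?I" "\<And>X. X \<in> ?I - K \<Longrightarrow> p X m = \<zero>"
    "\<And>J. finite J \<Longrightarrow> K \<subseteq> J \<Longrightarrow> J \<subseteq> ?I \<Longrightarrow> m = (\<Oplus>X\<in>J. p X m)" if "good m K" for m K
    using that unfolding good_def by (elim conjE; blast)+
  have recon: "\<exists>K. good m K" if "m \<in> carrier M" for m
    using gen that
  proof (induction rule: generates_induct)
    case vector show ?case by (rule AM.N.vector_sp_axioms)
  next
    case zero
    have "p X \<zero> = \<zero>" if "X \<in> ?I" for X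
      by (rule is_linear_zero[OF AM.N.vector_sp_axioms AM.N.vector_sp_axioms pl[OF that]])
    then have "good \<zero> {}"
      by (intro goodI AM.N.add.finprod_one_eqI[symmetric]) (simp_all add: subset_iff)
    then show ?case by (rule exI)
  next
    case (base v)
    then obtain Y where Y: "Y \<in> ?I" "v \<in> ?S Y" using weight_class by blast
    note vc = D(5)[OF Y(2)]
    have pv: "p X v = (if Y = X then v else \<zero>)" if "X \<in> ?I" for X
      using p_same[OF that] p_other[OF that Y(1) _ Y(2)] Y(2) by (cases "Y = X") simp_all
    have rec: "v = (\<Oplus>X\<in>J. p X v)" if J: "finite J" "Y \<in> J" "J \<subseteq> ?I" for J
    proof -
      have "(\<Oplus>X\<in>J. p X v) = (\<Oplus>X\<in>J. if Y = X then v else \<zero>)"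
        by (rule AM.N.finsum_cong'[OF refl _ pv[OF subsetD[OF J(3)]]]) (use vc in simp_all)
      also have "\<dots> = v" by (rule AM.N.finsum_singleton[OF J(2,1)]) (use vc in auto)
      finally show ?thesis by simp
    qed
    have van: "p X v = \<zero>" if "X \<in> ?I - {Y}" for X
      using pv[of X] that by (cases "Y = X") simp_all
    have "good v {Y}"
    proof (rule goodI)
      show "v = (\<Oplus>X\<in>J. p X v)" if "finite J" "{Y} \<subseteq> J" "J \<subseteq> ?I" for J
        by (rule rec[OF that(1) _ that(3)]) (use that(2) in blast)
      show "{Y} \<subseteq> ?I" using Y(1) by blast
    qed (simp, rule van)
    then show ?case by (rule exI)
  next
    case (add v w)
    obtain K K' where gK: "good v K" "good w K'" using add(3,4) by blast
    note K = goodD[OF gK(1)] and K' = goodD[OF gK(2)]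
    have rec: "v \<oplus> w = (\<Oplus>X\<in>J. p X (v \<oplus> w))" if J: "finite J" "K \<union> K' \<subseteq> J" "J \<subseteq> ?I" for J
    proof -
      have cl: "(\<lambda>X. p X v) \<in> J \<rightarrow> carrier M" "(\<lambda>X. p X w) \<in> J \<rightarrow> carrier M"
        using pD(1) add(1,2) J(3) by blast+
      have "(\<Oplus>X\<in>J. p X (v \<oplus> w)) = (\<Oplus>X\<in>J. p X v \<oplus> p X w)"
        by (rule AM.N.finsum_cong') (use pD(2)[OF _ add(1,2)] pD(1)[OF _ add(1)] pD(1)[OF _ add(2)] J(3) in auto)
      also have "\<dots> = (\<Oplus>X\<in>J. p X v) \<oplus> (\<Oplus>X\<in>J. p X w)" by (rule AM.N.finsum_addf[OF cl])
      also have "\<dots> = v \<oplus> w"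
        by (rule arg_cong2[OF K(4)[symmetric, OF J(1) _ J(3)] K'(4)[symmetric, OF J(1) _ J(3)]]) (use J(2) in auto)
      finally show ?thesis by (rule sym)
    qed
    have van: "p X (v \<oplus> w) = \<zero>" if "X \<in> ?I - (K \<union> K')" for X
      using pD(2)[OF _ add(1,2), of X] K(3) K'(3) that by simp
    have "good (v \<oplus> w) (K \<union> K')"
    proof (rule goodI[OF _ _ van rec])
      show "K \<union> K' \<subseteq> ?I" using K(2) K'(2) by blast
      show "finite (K \<union> K')" using K(1) K'(1) by blast
    qed
    then show ?case by (rule exI)
  next
    case (smult c v)
    obtain K where gK: "good v K" using smult(2) by blast
    note K = goodD[OF gK]
    have rec: "c \<odot> v = (\<Oplus>X\<in>J. p X (c \<odot> v))" if J: "finite J" "K \<subseteq> J" "J \<subseteq> ?I" for J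
    proof -
      have cl: "(\<lambda>X. p X v) \<in> J \<rightarrow> carrier M" using pD(1) smult(1) J(3) by blast
      have "(\<Oplus>X\<in>J. p X (c \<odot> v)) = (\<Oplus>X\<in>J. c \<odot> p X v)"
        by (rule AM.N.finsum_cong') (use pD(3)[OF _ smult(1)] pD(1)[OF _ smult(1)] J(3) in auto)
      also have "\<dots> = c \<odot> (\<Oplus>X\<in>J. p X v)" by (rule AM.N.finsum_smult[OF J(1) cl, symmetric])
      also have "\<dots> = c \<odot> v" by (rule arg_cong[OF K(4)[OF J, symmetric]])
      finally show ?thesis by (rule sym)
    qed
    have van: "p X (c \<odot> v) = \<zero>" if "X \<in> ?I - K" for X
      using pD(3)[OF _ smult(1), of X] K(3) that by simp
    have "good (c \<odot> v) K" by (rule goodI[OF K(1,2) van rec])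
    then show ?case by (rule exI)
  qed
  define F where "F = (\<lambda>m\<in>carrier M. \<lambda>X\<in>?I. p X m)"
  let ?P = "direct_sum ?I component"
  have Pc: "g \<in> carrier ?P \<longleftrightarrow> g \<in> Pi\<^sub>E ?I ?S \<and> finite {X \<in> ?I. g X \<noteq> \<zero>}" for g
    by (simp add: direct_sum_def component_def)
  have F_carrier: "F m \<in> carrier ?P" if m: "m \<in> carrier M" for m
  proof -
    obtain K where K: "good m K" using recon[OF m] by blast
    have Fm: "F m = (\<lambda>X\<in>?I. p X m)" using m by (simp add: F_def)
    have "{X \<in> ?I. F m X \<noteq> \<zero>} \<subseteq> K"
      using goodD(3)[OF K] unfolding Fm by (simp add: subset_iff) blast
    then have "finite {X \<in> ?I. F m X \<noteq> \<zero>}" using goodD(1)[OF K] by (rule finite_subset)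
    moreover have "F m \<in> Pi\<^sub>E ?I ?S" unfolding Fm restrict_PiE_iff by (rule ballI) (rule pS(1)[OF _ m])
    ultimately show ?thesis unfolding Pc by (intro conjI)
  qed
  have "F \<in> amod_hom A M ?P"
    unfolding amod_hom_def lin_maps_iff
  proof (intro CollectI conjI allI ballI)
    show "F \<in> extensional (carrier M)" by (simp add: F_def)
    show "is_linear M ?P F"
    proof (rule is_linearI[OF F_carrier])
      show "F (m \<oplus> m') = F m \<oplus>\<^bsub>?P\<^esub> F m'" if "m \<in> carrier M" "m' \<in> carrier M" for m m'
        using that pD(2) by (auto simp: F_def direct_sum_def component_def fun_eq_iff restrict_def)
      show "F (c \<odot> m) = c \<odot>\<^bsub>?P\<^esub> F m" if "m \<in> carrier M" for c m
        using that pD(3) by (auto simp: F_def direct_sum_def component_def fun_eq_iff restrict_def)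
    qed
    show "F (act M x m) = act ?P x (F m)" if m: "m \<in> carrier M" for x m
    proof -
      have "p X (act M x m) = act M x (p X m)" if "X \<in> ?I" for X
        by (rule p_commute[OF M_act_linear wspan_act wspan_act that m])
      then show ?thesis
        using m is_linearD(1)[OF M_act_linear]
        by (auto simp: F_def direct_sum_def component_def fun_eq_iff restrict_def)
    qed
    show "F (lact M a m) = lact ?P a (F m)" if a: "a \<in> carrier A" and m: "m \<in> carrier M" for a m
    proof -
      have "p X (lact M a m) = lact M a (p X m)" if X: "X \<in> ?I" for X
        by (rule p_commute[OF is_bilinearD(2)[OF amoduleD(3)[OF M_amodule] a] class_lact[OF X a] coclass_lact[OF X a] X m])
      then show ?thesis
        using m is_bilinearD(3)[OF amoduleD(3)[OF M_amodule] a m]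
        by (auto simp: F_def direct_sum_def component_def fun_eq_iff restrict_def)
    qed
  qed
  moreover have "bij_betw F (carrier M) (carrier ?P)"
    unfolding bij_betw_def
  proof (intro conjI inj_onI equalityI subsetI)
    fix m m' assume m: "m \<in> carrier M" "m' \<in> carrier M" and eq: "F m = F m'"
    have pe: "p X m = p X m'" if "X \<in> ?I" for X
      using fun_cong[OF eq, of X] m that by (simp add: F_def)
    obtain K K' where gK: "good m K" "good m' K'" using recon[OF m(1)] recon[OF m(2)] by blast
    note K = goodD[OF gK(1)] and K' = goodD[OF gK(2)]
    \<comment> \<open>Over one common index set both vectors are rebuilt from the same
      projections.\<close>
    let ?J = "K \<union> K'"
    have J: "finite ?J" "?J \<subseteq> ?I" using K(1,2) K'(1,2) by auto
    have "m = (\<Oplus>X\<in>?J. p X m)" by (rule K(4)[OF J(1) Un_upper1 J(2)])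
    also have "\<dots> = (\<Oplus>X\<in>?J. p X m')"
      by (rule AM.N.finsum_cong'[OF refl _ pe[OF subsetD[OF J(2)]]]) (use J(2) pD(1)[OF _ m(2)] in blast)+
    also have "\<dots> = m'" by (rule K'(4)[OF J(1) Un_upper2 J(2), symmetric])
    finally show "m = m'" .
  next
    fix g assume "g \<in> F ` carrier M" then show "g \<in> carrier ?P" using F_carrier by blast
  next
    fix g assume "g \<in> carrier ?P"
    then have g: "g \<in> Pi\<^sub>E ?I ?S" "finite {X \<in> ?I. g X \<noteq> \<zero>}" unfolding Pc by auto
    let ?J = "{X \<in> ?I. g X \<noteq> \<zero>}"
    have gS: "g X \<in> ?S X" if "X \<in> ?I" for X using g(1) that by (rule PiE_mem)
    have gc: "g X \<in> carrier M" if "X \<in> ?I" for X by (rule D(5)[OF gS[OF that]])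
    \<comment> \<open>The preimage of a finitely supported g is the sum of its values, taken in
      \<open>M\<close>.\<close>
    define m where "m = (\<Oplus>X\<in>?J. g X)"
    have m: "m \<in> carrier M" unfolding m_def by (rule AM.N.finsum_closed) (use gc in auto)
    have pm: "p X m = g X" if X: "X \<in> ?I" for X
    proof -
      have "p X m = (\<Oplus>Y\<in>?J. p X (g Y))"
        unfolding m_def by (rule is_linear_finsum[OF AM.N.vector_sp_axioms AM.N.vector_sp_axioms pl[OF X] g(2)]) (use gc in auto)
      also have "\<dots> = (\<Oplus>Y\<in>?J. if X = Y then g Y else \<zero>)"
      proof (rule AM.N.finsum_cong'[OF refl])
        fix Y assume Y: "Y \<in> ?J"
        then show "p X (g Y) = (if X = Y then g Y else \<zero>)"
          using p_same[OF X gS[OF X]] p_other[OF X _ _ gS, of Y] by (cases "X = Y") simp_all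
      qed (use gc in simp)
      also have "\<dots> = g X"
      proof (cases "X \<in> ?J")
        case True
        show ?thesis by (rule AM.N.finsum_singleton[OF True g(2)]) (use gc in auto)
      next
        case False
        then have "g X = \<zero>" using X by blast
        moreover have "(\<Oplus>Y\<in>?J. if X = Y then g Y else \<zero>) = \<zero>"
          by (rule AM.N.add.finprod_one_eqI) (use False in auto)
        ultimately show ?thesis by simp
      qed
      finally show ?thesis .
    qed
    have "F m = g"
    proof (rule extensionalityI[of _ ?I])
      show "F m \<in> extensional ?I" using m by (simp add: F_def)
      show "g \<in> extensional ?I" using g(1) by (simp add: PiE_def)
      show "F m X = g X" if "X \<in> ?I" for X using pm[OF that] m that by (simp add: F_def)
    qed
    then show "g \<in> F ` carrier M" using m by blast
  qed
  ultimately show ?thesis unfolding amod_iso_def by blast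
qed

end

context even_lattice
begin

text \<open>A morphism preserves weights, so the image of a weight vector lies in the span for its
  weight in \<open>X\<close> and, like all of \<open>N\<close>, in the span for \<open>Y\<close>;
  these meet in zero.\<close>

lemma graded_hom_zero:
  assumes X: "X \<in> carrier G" and Y: "Y \<in> carrier G" and "X \<noteq> Y"
    and M: "M \<in> local_modules_graded sc B L A X" and N: "N \<in> local_modules_graded sc B L A Y"
    and f: "f \<in> amod_hom A M N" and m: "m \<in> carrier M"
  shows "f m = \<zero>\<^bsub>N\<^esub>"
proof -
  have am: "amodule sc A M" "amodule sc A N"
    using M N by (simp_all add: local_modules_graded_def local_modules_def)
  interpret m: lattice_amodule sc Bs B L \<alpha> M by unfold_locales (rule am)
  interpret n: lattice_amodule sc Bs B L \<alpha> N by unfold_locales (rule am)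
  have lin: "is_linear M N f" and fact: "\<And>x m. m \<in> carrier M \<Longrightarrow> f (act M x m) = act N x (f m)"
    using f by (auto simp: amod_hom_def lin_maps_iff)
  have z: "is_linear M N (\<lambda>_. \<zero>\<^bsub>N\<^esub>)" by (rule is_linearI) auto
  have gM: "generates M (m.weights (pc ` X))" and gN: "generates N (n.weights (pc ` Y))"
    using m.graded_iff[OF X] n.graded_iff[OF Y] M N by blast+
  show ?thesis
  proof (rule generates_linear_eq[OF m.AM.N.vector_sp_axioms n.AM.N.vector_sp_axioms gM lin z _ m])
    fix v assume "v \<in> m.weights (pc ` X)"
    then obtain x where x: "x \<in> X" "v \<in> weight_space M L (pc x)" by blast
    note vc = m.weight_spaceD(1)[OF x(2)]
    have fc: "f v \<in> carrier N" by (rule is_linearD(1)[OF lin vc])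
    have "f v \<in> weight_space N L (pc x)"
      unfolding weight_space_def
    proof (intro CollectI conjI ballI)
      fix y assume "y \<in> L"
      then show "act N y (f v) = of_int (pc x y) \<odot>\<^bsub>N\<^esub> f v"
        unfolding fact[OF vc, symmetric] m.weight_spaceD(2)[OF x(2) \<open>y \<in> L\<close>] by (rule_tac is_linearD(3)[OF lin vc])
    qed (rule fc)
    then have 1: "f v \<in> n.wspan {pc x}" by (rule n.wspan_base[OF singletonI])
    have 2: "f v \<in> n.wspan (pc ` Y)" using gN fc by (auto simp: generates_def)
    have "pc x \<notin> pc ` Y" using G_class_disjoint[OF X Y x(1)] \<open>X \<noteq> Y\<close> by blast
    then show "f v = \<zero>\<^bsub>N\<^esub>"
      by (intro n.wspan_disjoint[OF _ _ _ 1 2]) (use pc_ext in auto)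
  qed
qed

lemma local_category_decomposition:
  "category_decomposition A (carrier G) (local_modules sc U A :: ('h, 'h \<Rightarrow>\<^sub>0 complex, 'v) amod set)
     (local_modules_graded sc B L A)"
  unfolding category_decomposition_def
proof (intro conjI ballI impI)
  fix M :: "('h, 'h \<Rightarrow>\<^sub>0 complex, 'v) amod" assume M: "M \<in> local_modules sc U A"
  then have "amodule sc A M" by (simp add: local_modules_def)
  then interpret m: lattice_amodule sc Bs B L \<alpha> M by unfold_locales
  show "\<exists>F :: 'h set \<Rightarrow> ('h, 'h \<Rightarrow>\<^sub>0 complex, 'v) amod.
      (\<forall>X\<in>carrier G. F X \<in> local_modules_graded sc B L A X) \<and> amod_iso A M (direct_sum (carrier G) F)"
    by (intro exI[of _ m.component] conjI ballI m.component_graded m.local_decomposition[OF M])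
next
  fix X Y and M N :: "('h, 'h \<Rightarrow>\<^sub>0 complex, 'v) amod" and f m
  assume "X \<in> carrier G" "Y \<in> carrier G" "X \<noteq> Y" "M \<in> local_modules_graded sc B L A X"
    "N \<in> local_modules_graded sc B L A Y" "f \<in> amod_hom A M N" "m \<in> carrier M"
  then show "f m = \<zero>\<^bsub>N\<^esub>" by (rule graded_hom_zero)
qed (auto simp: local_modules_graded_def)

end

theorem proposition5p3:
  fixes sc :: "complex \<Rightarrow> 'h::ab_group_add \<Rightarrow> 'h" and Bs :: "'h set"
    and B :: "'h \<Rightarrow> 'h \<Rightarrow> complex" and L :: "'h set"
    and \<alpha> :: "'h \<Rightarrow> 'h \<Rightarrow> complex"
  assumes "finite_dimensional_vector_space sc Bs"
    and "nondeg_sym_bilinear sc B"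
    and "subgroup L (add_grp UNIV)"
    and "\<forall>x\<in>L. \<forall>y\<in>L. B x y \<in> \<int>"
    and "\<forall>x\<in>L. \<exists>k::int. B x x = of_int (2 * k)"
    and "normalised_cocycle L \<alpha>"
    and "\<forall>x\<in>L. \<forall>y\<in>L. \<alpha> x y * inverse (\<alpha> y x) = exp (complex_of_real pi * \<i> * B x y)"
  defines "U \<equiv> some_onb sc B"
    and "A \<equiv> lattice_algebra B L \<alpha>"
    and "G \<equiv> grading_group B L"
  shows "category_decomposition A (carrier G)
           (local_modules sc U A :: ('h, 'h \<Rightarrow>\<^sub>0 complex, 'v) amod set)
           (local_modules_graded sc B L A)
       \<and> (\<forall>X\<in>carrier G. \<forall>Y\<in>carrier G.
            \<forall>(M :: ('h, 'h \<Rightarrow>\<^sub>0 complex, 'm) amod) \<in> local_modules_graded sc B L A X.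
            \<forall>(N :: ('h, 'h \<Rightarrow>\<^sub>0 complex, 'n) amod) \<in> local_modules_graded sc B L A Y.
              tensor_over U A M N \<in> local_modules_graded sc B L A (X \<otimes>\<^bsub>G\<^esub> Y))"
proof -
  interpret even_lattice sc Bs B L \<alpha>
    using assms(1-7) by (intro even_lattice.intro nondeg_form.intro nondeg_form_axioms.intro even_lattice_axioms.intro)
  show ?thesis
    unfolding U_def A_def G_def by (intro conjI ballI local_category_decomposition tensor_over_graded)
qed

end
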